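(* Let $k$ be a field of characteristic $0$, $R=k[x_1,\ldots,x_n]$, and let $I\subset R$ be a homogeneous Artinian ideal, with $f_2,\ldots,f_n$ and $J_1,\ldots,J_{n-1}$ defined for $\mathrm{gin}(I)$ as in the context. Then $\mathrm{gin}(I)$ is almost reverse lexicographic if and only if: (1) for every $0\le i\le n-3$, there exist generic linear forms $L_1,\ldots,L_i$ in $R$ such that $R/(I+(L_1,\ldots,L_i))$ has the strong Lefschetz property; and (2) for each $3\le i\le n-1$, whenever $\alpha=(\alpha_1,\ldots,\alpha_i)$ and $\beta=(\beta_1,\ldots,\beta_i)$ are elements of $J_i$ with $|\alpha|=|\beta|$ and $\alpha<\beta$, we have $f_{i+1}(\beta)\le f_{i+1}(\alpha)$.
   Context: Monomials of $R$ are ordered by the degree reverse lexicographic order with $x_1>\cdots>x_n$; $\mathrm{gin}(I)$ is the generic initial ideal of $I$ with respect to this order. A homogeneous ideal is Artinian if the quotient is finite-dimensional over $k$. A monomial ideal $J$ is almost reverse lexicographic if for every minimal generator $m$ of $J$ and every monomial $M$ with $\deg M=\deg m$ and $M>m$, we have $M\in J$. A standard graded Artinian algebra $A=\bigoplus_d A_d$ has the strong Lefschetz property if there is a linear form $L$ such that for all $d$ and $i$ the multiplication map $\times L^i:A_d\to A_{d+i}$ is injective or surjective. "Generic linear forms" means linear forms chosen from a suitable nonempty Zariski-open subset of the space of tuples of linear forms (for $i=0$ no forms are added). Define $f_1=\min\{t\mid x_1^t\in\mathrm{gin}(I)\}$ and for $2\le i\le n$, $f_i(\alpha_1,\ldots,\alpha_{i-1})=\min\{t\ge0\mid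 x_1^{\alpha_1}\cdots x_{i-1}^{\alpha_{i-1}}x_i^t\in\mathrm{gin}(I)\}$ (value $\infty$ if none). For $1\le i\le n-1$, $J_i=\{(\alpha_1,\ldots,\alpha_i)\in\mathbb{Z}_{\ge0}^i\mid \alpha_1<f_1,\ \alpha_j<f_j(\alpha_1,\ldots,\alpha_{j-1})\text{ for }2\le j\le i\}$. $|\alpha|=\sum_j\alpha_j$, and $\alpha<\beta$ means $x_1^{\alpha_1}\cdots x_i^{\alpha_i}<x_1^{\beta_1}\cdots x_i^{\beta_i}$ in the reverse lexicographic order. *)

theory Defs
  imports Main "HOL-Library.Poly_Mapping" "HOL-Library.Extended_Nat"
begin

text \<open>Polynomials in variables x_0, x_1, ... (the paper's x_1,...,x_n are x_0,...,x_(n-1)).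
  A monomial is an exponent vector; a polynomial is a finitely supported map from monomials to k.\<close>

type_synonym mon = "nat \<Rightarrow>\<^sub>0 nat"
type_synonym 'k mpoly = "mon \<Rightarrow>\<^sub>0 'k"

definition mdeg :: "mon \<Rightarrow> nat" where
  "mdeg m = (\<Sum>j\<in>Poly_Mapping.keys m. Poly_Mapping.lookup m j)"

definition var_mon :: "nat \<Rightarrow> mon" where
  "var_mon j = Poly_Mapping.single j 1"

definition const :: "'k::comm_ring_1 \<Rightarrow> 'k mpoly" where
  "const c = Poly_Mapping.single 0 c"

definition Var :: "nat \<Rightarrow> 'k::comm_ring_1 mpoly" where
  "Var j = Poly_Mapping.single (var_mon j) 1"

definition polyR :: "nat \<Rightarrow> 'k::comm_ring_1 mpoly set" where
  "polyR n = {p. \<forall>m\<in>Poly_Mapping.keys p. Poly_Mapping.keys m \<subseteq> {..<n}}"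

definition homog_of_deg :: "nat \<Rightarrow> 'k::comm_ring_1 mpoly \<Rightarrow> bool" where
  "homog_of_deg d p \<longleftrightarrow> (\<forall>m\<in>Poly_Mapping.keys p. mdeg m = d)"

definition homog_comp :: "nat \<Rightarrow> 'k::comm_ring_1 mpoly \<Rightarrow> 'k mpoly" where
  "homog_comp d p = (\<Sum>m\<in>{m\<in>Poly_Mapping.keys p. mdeg m = d}. Poly_Mapping.single m (Poly_Mapping.lookup p m))"

definition is_ideal :: "nat \<Rightarrow> 'k::comm_ring_1 mpoly set \<Rightarrow> bool" where
  "is_ideal n I \<longleftrightarrow> I \<subseteq> polyR n \<and> 0 \<in> I \<and> (\<forall>p\<in>I. \<forall>q\<in>I. p + q \<in> I)
      \<and> (\<forall>r\<in>polyR n. \<forall>p\<in>I. r * p \<in> I)"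

definition homogeneous_ideal :: "'k::comm_ring_1 mpoly set \<Rightarrow> bool" where
  "homogeneous_ideal I \<longleftrightarrow> (\<forall>p\<in>I. \<forall>d. homog_comp d p \<in> I)"

definition artinian :: "nat \<Rightarrow> 'k::comm_ring_1 mpoly set \<Rightarrow> bool" where
  "artinian n I \<longleftrightarrow> (\<exists>B. finite B \<and> B \<subseteq> polyR n \<and>
      (\<forall>p\<in>polyR n. \<exists>c. p - (\<Sum>b\<in>B. const (c b) * b) \<in> I))"

text \<open>Degree reverse lexicographic order with x_0 > x_1 > ...: strict "greater than".\<close>
definition mon_gt :: "mon \<Rightarrow> mon \<Rightarrow> bool" where
  "mon_gt m m' \<longleftrightarrow> mdeg m > mdeg m' \<or>
     (mdeg m = mdeg m' \<and> m \<noteq> m' \<and>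
       Poly_Mapping.lookup m (Max {j. Poly_Mapping.lookup m j \<noteq> Poly_Mapping.lookup m' j}) < Poly_Mapping.lookup m' (Max {j. Poly_Mapping.lookup m j \<noteq> Poly_Mapping.lookup m' j}))"

definition lm :: "'k::comm_ring_1 mpoly \<Rightarrow> mon" where
  "lm p = (THE m. m \<in> Poly_Mapping.keys p \<and> (\<forall>m'\<in>Poly_Mapping.keys p. m' \<noteq> m \<longrightarrow> mon_gt m m'))"

definition mon_dvd :: "mon \<Rightarrow> mon \<Rightarrow> bool" where
  "mon_dvd m m' \<longleftrightarrow> (\<exists>q. m' = m + q)"

text \<open>The monomials of the initial ideal in(J) (a monomial ideal is determined by its monomials).\<close>
definition init_mons :: "nat \<Rightarrow> 'k::comm_ring_1 mpoly set \<Rightarrow> mon set" where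
  "init_mons n J = {m. Poly_Mapping.keys m \<subseteq> {..<n} \<and> (\<exists>p\<in>J. p \<noteq> 0 \<and> mon_dvd (lm p) m)}"

definition eval :: "'k::comm_ring_1 mpoly \<Rightarrow> (nat \<Rightarrow> 'k) \<Rightarrow> 'k" where
  "eval p v = (\<Sum>m\<in>Poly_Mapping.keys p. Poly_Mapping.lookup p m * (\<Prod>j\<in>Poly_Mapping.keys m. v j ^ Poly_Mapping.lookup m j))"

definition subst :: "(nat \<Rightarrow> 'k::comm_ring_1 mpoly) \<Rightarrow> 'k mpoly \<Rightarrow> 'k mpoly" where
  "subst \<sigma> p = (\<Sum>m\<in>Poly_Mapping.keys p. const (Poly_Mapping.lookup p m) * (\<Prod>j\<in>Poly_Mapping.keys m. \<sigma> j ^ Poly_Mapping.lookup m j))"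

text \<open>Zariski-open subsets of k^N (points are functions nat => k, only coordinates < N matter).\<close>
definition zariski_open :: "nat \<Rightarrow> (nat \<Rightarrow> 'k::comm_ring_1) set \<Rightarrow> bool" where
  "zariski_open N U \<longleftrightarrow> (\<exists>S. S \<subseteq> polyR N \<and> U = {v. \<exists>h\<in>S. eval h v \<noteq> 0})"

definition generic :: "nat \<Rightarrow> ((nat \<Rightarrow> 'k::comm_ring_1) \<Rightarrow> bool) \<Rightarrow> bool" where
  "generic N P \<longleftrightarrow> (\<exists>U. zariski_open N U \<and> U \<noteq> {} \<and> (\<forall>v\<in>U. P v))"

text \<open>An n x n matrix g with entries g(l,j) = v(l*n+j), acting by x_j |-> sum_l g(l,j) x_l.\<close>
definition mat_invertible :: "nat \<Rightarrow> (nat \<Rightarrow> 'k::comm_ring_1) \<Rightarrow> bool" where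
  "mat_invertible n v \<longleftrightarrow> (\<forall>c. (\<forall>l<n. (\<Sum>j<n. v (l*n+j) * c j) = 0) \<longrightarrow> (\<forall>j<n. c j = 0))"

definition gsubst :: "nat \<Rightarrow> (nat \<Rightarrow> 'k::comm_ring_1) \<Rightarrow> nat \<Rightarrow> 'k mpoly" where
  "gsubst n v j = (if j < n then (\<Sum>l<n. const (v (l*n+j)) * Var l) else Var j)"

definition gact :: "nat \<Rightarrow> (nat \<Rightarrow> 'k::comm_ring_1) \<Rightarrow> 'k mpoly set \<Rightarrow> 'k mpoly set" where
  "gact n v I = subst (gsubst n v) ` I"

definition gin :: "nat \<Rightarrow> 'k::comm_ring_1 mpoly set \<Rightarrow> mon set" where
  "gin n I = (THE G. generic (n*n) (\<lambda>v. mat_invertible n v \<and> init_mons n (gact n v I) = G))"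

definition min_gen :: "mon set \<Rightarrow> mon \<Rightarrow> bool" where
  "min_gen G m \<longleftrightarrow> m \<in> G \<and> \<not> (\<exists>m'\<in>G. mon_dvd m' m \<and> m' \<noteq> m)"

definition almost_revlex :: "nat \<Rightarrow> mon set \<Rightarrow> bool" where
  "almost_revlex n G \<longleftrightarrow> (\<forall>m. min_gen G m \<longrightarrow>
      (\<forall>M. Poly_Mapping.keys M \<subseteq> {..<n} \<and> mdeg M = mdeg m \<and> mon_gt M m \<longrightarrow> M \<in> G))"

text \<open>f_i(alpha_1..alpha_(i-1)) with alpha a list of length i-1; f_1 is the case alpha = [].\<close>
definition fval :: "mon set \<Rightarrow> nat list \<Rightarrow> enat" where
  "fval G \<alpha> = (if \<exists>t. Poly_Mapping.nth \<alpha> + Poly_Mapping.single (length \<alpha>) (t::nat) \<in> G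
      then enat (LEAST t. Poly_Mapping.nth \<alpha> + Poly_Mapping.single (length \<alpha>) (t::nat) \<in> G) else \<infinity>)"

definition Jset :: "mon set \<Rightarrow> nat \<Rightarrow> nat list set" where
  "Jset G i = {\<alpha>. length \<alpha> = i \<and> (\<forall>j<i. enat (\<alpha> ! j) < fval G (take j \<alpha>))}"

definition slp :: "nat \<Rightarrow> 'k::comm_ring_1 mpoly set \<Rightarrow> bool" where
  "slp n J \<longleftrightarrow> (\<exists>L\<in>polyR n. homog_of_deg 1 L \<and> (\<forall>d i.
      (\<forall>p\<in>polyR n. homog_of_deg d p \<longrightarrow> L ^ i * p \<in> J \<longrightarrow> p \<in> J) \<or>
      (\<forall>q\<in>polyR n. homog_of_deg (d + i) q \<longrightarrow>
          (\<exists>p\<in>polyR n. homog_of_deg d p \<and> q - L ^ i * p \<in> J))))"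

definition lin :: "nat \<Rightarrow> (nat \<Rightarrow> 'k::comm_ring_1) \<Rightarrow> nat \<Rightarrow> 'k mpoly" where
  "lin n v j = (\<Sum>l<n. const (v (j*n+l)) * Var l)"

definition ideal_plus :: "nat \<Rightarrow> 'k::comm_ring_1 mpoly set \<Rightarrow> (nat \<Rightarrow> 'k mpoly) \<Rightarrow> nat \<Rightarrow> 'k mpoly set" where
  "ideal_plus n I Ls i = {p + (\<Sum>j<i. r j * Ls j) | p r. p \<in> I \<and> (\<forall>j<i. r j \<in> polyR n)}"

end

theory Submission
  imports Defs "HOL-Computational_Algebra.Polynomial"
begin

text \<open>
  In the reverse lexicographic order, killing general linear forms and multiplying by a power of
  another one is, after a general change of coordinates, visible on monomials: it corresponds to
  killing the last variables and multiplying by the last remaining variable modulo the generic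
  initial ideal. The standard monomials then split into strings \<open>a, a x\<^sub>j, \<dots>, a x\<^sub>j\<^bsup>f(a)-1\<^esup>\<close>, and
  multiplication by \<open>x\<^sub>j\<^bsup>e\<^esup>\<close> has maximal rank for all \<open>e\<close> and in all degrees iff no string both starts
  and ends strictly before another one. This compares \<open>f\<close> on monomials \<open>a\<close> of different degrees. In
  equal degree the comparison is the second condition of the theorem, except when \<open>a\<close> involves at
  most two variables, where it follows from strong stability of the generic initial ideal.

  Genericity is handled by lower semicontinuity of dimensions of spans of polynomial families. The
  generic initial ideal is read off at a coordinate change maximising all dimensions that determine
  initial monomials, and these are semicontinuous both in the coordinate change and in its inverse;
  this relates the matrix entries defining the generic initial ideal to the coefficients of the
  general linear forms without inverting a generic matrix. Strong stability comes from the
  first-order term in \<open>t\<close> of the substitution \<open>x\<^sub>b \<mapsto> x\<^sub>b + t x\<^sub>a\<close>.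
\<close>

abbreviation lookup :: "('a \<Rightarrow>\<^sub>0 'b::zero) \<Rightarrow> 'a \<Rightarrow> 'b" where
  "lookup \<equiv> Poly_Mapping.lookup"
abbreviation keys :: "('a \<Rightarrow>\<^sub>0 'b::zero) \<Rightarrow> 'a set" where
  "keys \<equiv> Poly_Mapping.keys"
abbreviation single :: "'a \<Rightarrow> 'b \<Rightarrow> 'a \<Rightarrow>\<^sub>0 'b::zero" where
  "single \<equiv> Poly_Mapping.single"

section \<open>Monomials\<close>

lemma keys_add_mon: "keys (a + b) = keys a \<union> keys (b :: mon)"
  by (auto simp: in_keys_iff lookup_add)

lemma mdeg_superset:
  assumes "finite S" "keys m \<subseteq> S"
  shows "mdeg m = (\<Sum>j\<in>S. lookup m j)"
  unfolding mdeg_def using assms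
  by (intro sum.mono_neutral_left) (auto simp: in_keys_iff)

lemma mdeg_add [simp]: "mdeg (a + b) = mdeg a + mdeg b"
proof -
  let ?S = "keys a \<union> keys b"
  have "mdeg (a + b) = (\<Sum>j\<in>?S. lookup (a + b) j)"
    by (rule mdeg_superset) (auto simp: keys_add_mon)
  moreover have "mdeg a = (\<Sum>j\<in>?S. lookup a j)" "mdeg b = (\<Sum>j\<in>?S. lookup b j)"
    by (rule mdeg_superset; auto)+
  ultimately show ?thesis
    by (simp add: lookup_add sum.distrib)
qed

lemma mdeg_single [simp]: "mdeg (single j e) = e"
  by (simp add: mdeg_def)

lemma mdeg_zero [simp]: "mdeg 0 = 0"
  by (simp add: mdeg_def)

lemma lookup_le_mdeg: "lookup m j \<le> mdeg m"
  by (cases "j \<in> keys m") (auto simp: mdeg_def in_keys_iff intro: member_le_sum)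

lemma mdeg_eq_0_iff: "mdeg m = 0 \<longleftrightarrow> m = 0"
  by (metis le_zero_eq lookup_le_mdeg lookup_zero mdeg_zero poly_mapping_eqI)

lemma lookup_eq_0_outside:
  assumes "keys m \<subseteq> {..<k}" "k \<le> l"
  shows "lookup (m :: mon) l = 0"
  using assms by (auto simp: in_keys_iff)

lemma mon_dvd_iff: "mon_dvd a b \<longleftrightarrow> (\<forall>k. lookup a k \<le> lookup b k)"
proof
  assume "\<forall>k. lookup a k \<le> lookup b k"
  then have "b = a + (b - a)"
    by (intro poly_mapping_eqI) (simp add: lookup_add lookup_minus)
  then show "mon_dvd a b"
    unfolding mon_dvd_def by blast
qed (auto simp: mon_dvd_def lookup_add)

lemma mon_dvd_add_diff: "mon_dvd a b \<Longrightarrow> a + (b - a) = b"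
  by (auto simp: mon_dvd_def)

lemma mon_dvd_single_iff: "mon_dvd (single j e) m \<longleftrightarrow> e \<le> lookup m j"
  by (auto simp: mon_dvd_iff lookup_single when_def)

lemma mon_dvd_mdeg: "mon_dvd a b \<Longrightarrow> mdeg a \<le> mdeg b"
  by (auto simp: mon_dvd_def)

lemma mon_dvd_keys: "mon_dvd a b \<Longrightarrow> keys a \<subseteq> keys b"
  by (auto simp: mon_dvd_def keys_add_mon)

lemma mon_dvd_mdeg_eq:
  assumes "mon_dvd a b" "mdeg a = mdeg b"
  shows "a = b"
  using assms by (auto simp: mon_dvd_def mdeg_eq_0_iff)

lemma ex_mon_dvd_mdeg: "c \<le> mdeg m \<Longrightarrow> \<exists>a. mon_dvd a m \<and> mdeg a = c"
proof (induction c)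
  case 0
  then show ?case
    by (intro exI[of _ 0]) (simp add: mon_dvd_iff)
next
  case (Suc c)
  then obtain a q where m_eq: "m = a + q" "mdeg a = c"
    by (auto simp: mon_dvd_def)
  then have "q \<noteq> 0"
    using Suc.prems by auto
  then obtain k where "k \<in> keys q"
    by (meson all_not_in_conv keys_eq_empty)
  then have "mon_dvd (single k 1) q"
    by (simp add: mon_dvd_single_iff in_keys_iff)
  then have "mon_dvd (a + single k 1) m"
    by (auto simp: m_eq mon_dvd_iff lookup_add)
  then show ?case
    using m_eq by (intro exI[of _ "a + single k 1"]) simp
qed

lemma split_last_var:
  fixes m :: mon
  assumes "keys m \<subseteq> {..<Suc j}"
  obtains a where "m = a + single j (lookup m j)" "keys a \<subseteq> {..<j}"
proof -
  let ?a = "m - single j (lookup m j)"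
  have "single j (lookup m j) + ?a = m"
    by (rule mon_dvd_add_diff) (simp add: mon_dvd_single_iff)
  moreover have "keys ?a \<subseteq> {..<j}"
    using assms
    by (auto simp: in_keys_iff lookup_minus lookup_single when_def less_Suc_eq subset_iff
        split: if_splits)
  ultimately show ?thesis
    using that[of ?a] by (simp add: add.commute)
qed

lemma lookup_nth_list: "lookup (Poly_Mapping.nth xs) k = (if k < length xs then xs ! k else 0)"
  by (simp add: nth_default_def)

lemma keys_nth_list: "keys (Poly_Mapping.nth xs) \<subseteq> {..<length xs}"
  by (auto simp: in_keys_iff lookup_nth_list simp del: lookup_nth keys_nth split: if_splits)

lemma mdeg_nth_list: "mdeg (Poly_Mapping.nth xs) = sum_list xs"
  by (subst mdeg_superset[OF _ keys_nth_list])
    (simp_all add: lookup_nth_list sum_list_sum_nth atLeast0LessThan del: lookup_nth)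

lemma nth_map_lookup:
  assumes "keys m \<subseteq> {..<k}"
  shows "Poly_Mapping.nth (map (lookup m) [0..<k]) = (m :: mon)"
  using lookup_eq_0_outside[OF assms]
  by (intro poly_mapping_eqI) (simp add: lookup_nth_list del: lookup_nth)

definition monomials :: "nat \<Rightarrow> nat \<Rightarrow> mon set" where
  "monomials n d = {m. keys m \<subseteq> {..<n} \<and> mdeg m = d}"

lemma finite_monomials: "finite (monomials n d)"
proof (rule finite_surj)
  show "finite {xs. set xs \<subseteq> {..d} \<and> length xs = n}"
    by (rule finite_lists_length_eq) simp
  show "monomials n d \<subseteq> Poly_Mapping.nth ` {xs. set xs \<subseteq> {..d} \<and> length xs = n}"
  proof
    fix m assume "m \<in> monomials n d"
    then have "m = Poly_Mapping.nth (map (lookup m) [0..<n])" "set (map (lookup m) [0..<n]) \<subseteq> {..d}"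
      by (auto simp: monomials_def nth_map_lookup lookup_le_mdeg)
    then show "m \<in> Poly_Mapping.nth ` {xs. set xs \<subseteq> {..d} \<and> length xs = n}"
      by (intro image_eqI[of _ _ "map (lookup m) [0..<n]"]) auto
  qed
qed

lemma monomials_add_iff:
  "a + b \<in> monomials n d \<longleftrightarrow> keys a \<subseteq> {..<n} \<and> keys b \<subseteq> {..<n} \<and> mdeg a + mdeg b = d"
  by (auto simp: monomials_def keys_add_mon)

section \<open>The degree reverse lexicographic order\<close>

lemma mon_gt_iff:
  "mon_gt m m' \<longleftrightarrow> mdeg m > mdeg m' \<or> (mdeg m = mdeg m' \<and>
     (\<exists>j. lookup m j < lookup m' j \<and> (\<forall>l>j. lookup m l = lookup m' l)))"
proof -
  let ?D = "{j. lookup m j \<noteq> lookup m' j}"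
  have fin: "finite ?D"
    by (rule finite_subset[of _ "keys m \<union> keys m'"]) (auto simp: in_keys_iff)
  have "(m \<noteq> m' \<and> lookup m (Max ?D) < lookup m' (Max ?D)) \<longleftrightarrow>
     (\<exists>j. lookup m j < lookup m' j \<and> (\<forall>l>j. lookup m l = lookup m' l))" (is "?L = ?R")
  proof
    assume ?L
    have "lookup m l = lookup m' l" if "l > Max ?D" for l
      using that Max_ge[OF fin, of l] by force
    then show ?R
      using \<open>?L\<close> by blast
  next
    assume ?R
    then obtain j where last_diff: "lookup m j < lookup m' j" "\<forall>l>j. lookup m l = lookup m' l"
      by blast
    have "Max ?D = j"
      by (rule Max_eqI) (use last_diff fin in \<open>auto simp: not_le intro: ccontr\<close>)
    then show ?L
      using last_diff by auto
  qed
  then show ?thesis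
    unfolding mon_gt_def by blast
qed

lemma mon_gt_irrefl [simp]: "\<not> mon_gt m m"
  by (simp add: mon_gt_iff)

lemma mon_gt_trans:
  assumes "mon_gt a b" "mon_gt b c"
  shows "mon_gt a c"
proof (cases "mdeg a > mdeg b \<or> mdeg b > mdeg c")
  case True
  then show ?thesis
    using assms by (auto simp: mon_gt_iff)
next
  case False
  then obtain i j where last_diff_ab: "lookup a i < lookup b i" "\<forall>l>i. lookup a l = lookup b l"
    and last_diff_bc: "lookup b j < lookup c j" "\<forall>l>j. lookup b l = lookup c l"
    and "mdeg a = mdeg c"
    using assms by (auto simp: mon_gt_iff)
  moreover have "lookup a (max i j) < lookup c (max i j) \<and> (\<forall>l>max i j. lookup a l = lookup c l)"
    using last_diff_ab last_diff_bc by (cases i j rule: linorder_cases) auto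
  ultimately show ?thesis
    by (auto simp: mon_gt_iff)
qed

lemma mon_gt_linear:
  assumes "a \<noteq> b"
  shows "mon_gt a b \<or> mon_gt b a"
proof -
  let ?D = "{j. lookup a j \<noteq> lookup b j}"
  have "finite ?D"
    by (rule finite_subset[of _ "keys a \<union> keys b"]) (auto simp: in_keys_iff)
  moreover have "?D \<noteq> {}"
    using assms by (auto simp: poly_mapping_eq_iff fun_eq_iff)
  ultimately have "lookup a (Max ?D) \<noteq> lookup b (Max ?D)"
    using Max_in by blast
  moreover have "{j. lookup b j \<noteq> lookup a j} = ?D"
    by auto
  ultimately show ?thesis
    using assms unfolding mon_gt_def by (metis linorder_neqE_nat)
qed

interpretation revlex: linorder "\<lambda>m m'. m = m' \<or> mon_gt m' m" "\<lambda>m m'. mon_gt m' m"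
proof
  fix x y z
  show "mon_gt y x \<longleftrightarrow> (x = y \<or> mon_gt y x) \<and> \<not> (y = x \<or> mon_gt x y)"
    using mon_gt_irrefl mon_gt_trans by metis
  show "x = y \<or> mon_gt y x \<Longrightarrow> y = z \<or> mon_gt z y \<Longrightarrow> x = z \<or> mon_gt z x"
    using mon_gt_trans by metis
  show "x = y \<or> mon_gt y x \<Longrightarrow> y = x \<or> mon_gt x y \<Longrightarrow> x = y"
    using mon_gt_irrefl mon_gt_trans by metis
  show "(x = y \<or> mon_gt y x) \<or> y = x \<or> mon_gt x y"
    using mon_gt_linear by metis
qed simp

lemma mon_gt_add_right_iff [simp]: "mon_gt (a + c) (b + c) \<longleftrightarrow> mon_gt a b"
  by (simp add: mon_gt_iff lookup_add)

lemma mon_gt_add_left_iff [simp]: "mon_gt (c + a) (c + b) \<longleftrightarrow> mon_gt a b"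
  by (simp add: mon_gt_iff lookup_add)

lemma mon_gt_of_extra_var:
  assumes "mdeg a = mdeg b" "keys a \<subseteq> {..<k}" "\<not> keys b \<subseteq> {..<k}"
  shows "mon_gt a b"
proof -
  let ?j = "Max (keys b)"
  obtain i where "i \<in> keys b" "k \<le> i"
    using assms(3) by (auto simp: not_less subset_iff)
  then have Max_b: "?j \<in> keys b" "k \<le> ?j"
    by (metis Max_in empty_iff finite_keys, metis Max_ge finite_keys le_trans)
  have "lookup b l = 0" if "l > ?j" for l
    using that Max_ge[OF finite_keys, of l b] by (meson not_in_keys_iff_lookup_eq_zero not_le)
  moreover have "lookup a l = 0" if "l \<ge> ?j" for l
    using lookup_eq_0_outside[OF assms(2)] that Max_b(2) by simp
  ultimately have "lookup a ?j < lookup b ?j \<and> (\<forall>l>?j. lookup a l = lookup b l)"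
    using Max_b(1) by (simp add: in_keys_iff)
  then show ?thesis
    unfolding mon_gt_iff using assms(1) by blast
qed

lemma mon_gt_lookup_last_le:
  assumes "mon_gt a b" "mdeg a = mdeg b" "keys b \<subseteq> {..<Suc j}"
  shows "lookup a j \<le> lookup b j"
proof -
  obtain i where last_diff: "lookup a i < lookup b i" "\<forall>l>i. lookup a l = lookup b l"
    using assms(1,2) by (auto simp: mon_gt_iff)
  then have "i \<in> keys b"
    by (simp add: in_keys_iff)
  then have "i \<le> j"
    using assms(3) by auto
  then show ?thesis
    using last_diff by (cases "i = j") auto
qed

lemma lookup_last_less_imp_mon_gt:
  assumes "lookup a j < lookup b j" "mdeg a = mdeg b" "keys a \<subseteq> {..<Suc j}" "keys b \<subseteq> {..<Suc j}"
  shows "mon_gt a b"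
  using assms lookup_eq_0_outside[of _ "Suc j"] by (auto simp: mon_gt_iff intro!: exI[of _ j])

lemma lm_eq_Max:
  assumes "p \<noteq> 0"
  shows "lm p = revlex.Max (keys p)"
  unfolding lm_def
proof (rule the_equality)
  have keys_nonempty: "keys p \<noteq> {}"
    using assms by simp
  show "revlex.Max (keys p) \<in> keys p \<and>
      (\<forall>m'\<in>keys p. m' \<noteq> revlex.Max (keys p) \<longrightarrow> mon_gt (revlex.Max (keys p)) m')"
    using revlex.Max_in[OF finite_keys keys_nonempty] revlex.Max_ge[OF finite_keys] by blast
  show "m = revlex.Max (keys p)" if "m \<in> keys p \<and> (\<forall>m'\<in>keys p. m' \<noteq> m \<longrightarrow> mon_gt m m')" for m
    using that by (intro revlex.Max_eqI[symmetric]) auto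
qed

lemma lm_in_keys: "p \<noteq> 0 \<Longrightarrow> lm p \<in> keys p"
  by (simp add: lm_eq_Max revlex.Max_in)

lemma mon_gt_lm: "m \<in> keys p \<Longrightarrow> m \<noteq> lm p \<Longrightarrow> mon_gt (lm p) m"
  using revlex.Max_ge[OF finite_keys] lm_eq_Max[of p] by fastforce

lemma lm_eqI:
  assumes "m \<in> keys p" "\<And>m'. m' \<in> keys p \<Longrightarrow> m' \<noteq> m \<Longrightarrow> mon_gt m m'"
  shows "lm p = m"
  using assms mon_gt_lm[of m p] lm_in_keys[of p] mon_gt_trans by fastforce

definition below :: "nat \<Rightarrow> mon \<Rightarrow> mon set" where
  "below n m = {m' \<in> monomials n (mdeg m). mon_gt m m'}"

lemma finite_below: "finite (below n m)"
  by (simp add: below_def finite_monomials)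

section \<open>Evaluation and substitution\<close>

lemma poly_mapping_sum_single: "p = (\<Sum>m\<in>keys p. single m (lookup p m))"
  by (rule poly_mapping_eqI) (auto simp: lookup_sum lookup_single when_def in_keys_iff)

definition mprod :: "(nat \<Rightarrow> 'r::comm_ring_1) \<Rightarrow> mon \<Rightarrow> 'r" where
  "mprod \<sigma> m = (\<Prod>j\<in>keys m. \<sigma> j ^ lookup m j)"

lemma mprod_superset:
  assumes "finite S" "keys m \<subseteq> S"
  shows "mprod \<sigma> m = (\<Prod>j\<in>S. \<sigma> j ^ lookup m j)"
  unfolding mprod_def using assms
  by (intro prod.mono_neutral_left) (auto simp: in_keys_iff)

lemma mprod_add: "mprod \<sigma> (a + b) = mprod \<sigma> a * mprod \<sigma> b"
proof -
  let ?S = "keys a \<union> keys b"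
  have "mprod \<sigma> (a + b) = (\<Prod>j\<in>?S. \<sigma> j ^ lookup (a + b) j)"
    by (rule mprod_superset) (auto simp: keys_add_mon)
  moreover have "mprod \<sigma> a = (\<Prod>j\<in>?S. \<sigma> j ^ lookup a j)" "mprod \<sigma> b = (\<Prod>j\<in>?S. \<sigma> j ^ lookup b j)"
    by (rule mprod_superset; auto)+
  ultimately show ?thesis
    by (simp add: lookup_add power_add prod.distrib)
qed

lemma mprod_zero [simp]: "mprod \<sigma> 0 = 1"
  by (simp add: mprod_def)

lemma mprod_single [simp]: "mprod \<sigma> (single j e) = \<sigma> j ^ e"
  by (simp add: mprod_def)

locale coeff_hom =
  fixes \<phi> :: "'k::comm_ring_1 \<Rightarrow> 'r::comm_ring_1"
  assumes hom_add: "\<phi> (a + b) = \<phi> a + \<phi> b"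
    and hom_mult: "\<phi> (a * b) = \<phi> a * \<phi> b"
    and hom_one: "\<phi> 1 = 1"
begin

lemma hom_zero: "\<phi> 0 = 0"
  using hom_add[of 0 0] by simp

definition insertion :: "(nat \<Rightarrow> 'r) \<Rightarrow> 'k mpoly \<Rightarrow> 'r" where
  "insertion \<sigma> p = (\<Sum>m\<in>keys p. \<phi> (lookup p m) * mprod \<sigma> m)"

lemma insertion_superset:
  assumes "finite S" "keys p \<subseteq> S"
  shows "insertion \<sigma> p = (\<Sum>m\<in>S. \<phi> (lookup p m) * mprod \<sigma> m)"
  unfolding insertion_def using assms
  by (intro sum.mono_neutral_left) (auto simp: in_keys_iff hom_zero)

lemma insertion_zero [simp]: "insertion \<sigma> 0 = 0"
  by (simp add: insertion_def)

lemma insertion_single: "insertion \<sigma> (single m c) = \<phi> c * mprod \<sigma> m"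
  by (simp add: insertion_def hom_zero)

lemma insertion_add: "insertion \<sigma> (p + q) = insertion \<sigma> p + insertion \<sigma> q"
proof -
  let ?S = "keys p \<union> keys q"
  have "insertion \<sigma> (p + q) = (\<Sum>m\<in>?S. \<phi> (lookup (p + q) m) * mprod \<sigma> m)"
    by (rule insertion_superset) (auto simp: Poly_Mapping.keys_add)
  moreover have "insertion \<sigma> p = (\<Sum>m\<in>?S. \<phi> (lookup p m) * mprod \<sigma> m)"
      "insertion \<sigma> q = (\<Sum>m\<in>?S. \<phi> (lookup q m) * mprod \<sigma> m)"
    by (rule insertion_superset; auto)+
  ultimately show ?thesis
    by (simp add: lookup_add hom_add algebra_simps sum.distrib)
qed

lemma insertion_sum: "insertion \<sigma> (sum f A) = (\<Sum>a\<in>A. insertion \<sigma> (f a))"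
  by (induction A rule: infinite_finite_induct) (auto simp: insertion_add)

lemma insertion_mult: "insertion \<sigma> (p * q) = insertion \<sigma> p * insertion \<sigma> q"
proof -
  have "p * q = (\<Sum>a\<in>keys p. \<Sum>b\<in>keys q. single (a + b) (lookup p a * lookup q b))"
    by (subst (1) poly_mapping_sum_single[of p], subst (1) poly_mapping_sum_single[of q])
      (simp add: sum_product Poly_Mapping.mult_single)
  then have "insertion \<sigma> (p * q) =
      (\<Sum>a\<in>keys p. \<Sum>b\<in>keys q. (\<phi> (lookup p a) * mprod \<sigma> a) * (\<phi> (lookup q b) * mprod \<sigma> b))"
    by (simp add: insertion_sum insertion_single mprod_add hom_mult mult_ac)
  then show ?thesis
    by (simp add: insertion_def sum_product)
qed

lemma insertion_one: "insertion \<sigma> 1 = 1"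
  using insertion_single[of \<sigma> 0 1] by (simp add: hom_one)

lemma insertion_power: "insertion \<sigma> (p ^ e) = insertion \<sigma> p ^ e"
  by (induction e) (auto simp: insertion_one insertion_mult)

lemma insertion_prod: "insertion \<sigma> (prod f A) = (\<Prod>a\<in>A. insertion \<sigma> (f a))"
  by (induction A rule: infinite_finite_induct) (auto simp: insertion_mult insertion_one)

end

lemma const_zero [simp]: "const 0 = 0"
  by (simp add: const_def)

lemma const_one [simp]: "const 1 = 1"
  by (simp add: const_def)

lemma const_add: "const (a + b) = const a + const b"
  by (simp add: const_def single_add)

lemma const_mult: "const (a * b) = const a * const b"
  by (simp add: const_def Poly_Mapping.mult_single)

lemma const_sum: "const (sum f A) = (\<Sum>a\<in>A. const (f a))"
  by (induction A rule: infinite_finite_induct) (auto simp: const_add)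

lemma const_mult_single [simp]: "const c * single m d = single m (c * d)"
  by (simp add: const_def Poly_Mapping.mult_single)

lemma lookup_const_mult [simp]: "lookup (const c * p) m = c * lookup p m"
  unfolding const_def mult_map_scale_conv_mult[symmetric]
  by (simp add: Poly_Mapping.map.rep_eq when_def)

lemma lookup_single_mult: "lookup (single q 1 * p) (q + m) = lookup (p :: 'k::comm_ring_1 mpoly) m"
proof -
  have "single q 1 * p = (\<Sum>m\<in>keys p. single (q + m) (lookup p m))"
    by (subst (1) poly_mapping_sum_single[of p]) (simp add: sum_distrib_left Poly_Mapping.mult_single)
  then show ?thesis
    by (auto simp: lookup_sum lookup_single when_def in_keys_iff)
qed

lemma keys_single_mult: "keys (single q 1 * (p :: 'k::comm_ring_1 mpoly)) = (+) q ` keys p"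
proof
  show "keys (single q 1 * p) \<subseteq> (+) q ` keys p"
    using Poly_Mapping.keys_mult[of "single q 1" p] by (auto split: if_splits)
  show "(+) q ` keys p \<subseteq> keys (single q 1 * p)"
    by (auto simp: in_keys_iff lookup_single_mult)
qed

lemma single_dvd_polyE:
  fixes p :: "'k::comm_ring_1 mpoly"
  assumes "\<And>m. m \<in> keys p \<Longrightarrow> mon_dvd a m"
  obtains q where "p = single a 1 * q"
proof -
  have "single a 1 * (\<Sum>m\<in>keys p. single (m - a) (lookup p m)) = (\<Sum>m\<in>keys p. single m (lookup p m))"
    using assms by (simp add: sum_distrib_left Poly_Mapping.mult_single mon_dvd_add_diff)
  then show ?thesis
    using that poly_mapping_sum_single[of p] by metis
qed

interpretation evaluation: coeff_hom "\<lambda>c. c"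
  by unfold_locales auto

interpretation substitution: coeff_hom const
  by unfold_locales (auto simp: const_add const_mult)

lemma eval_eq_insertion: "eval p v = evaluation.insertion v p"
  by (simp add: eval_def evaluation.insertion_def mprod_def)

lemma subst_eq_insertion: "subst \<sigma> p = substitution.insertion \<sigma> p"
  by (simp add: subst_def substitution.insertion_def mprod_def)

lemma subst_zero [simp]: "subst \<sigma> 0 = 0"
  by (simp add: subst_eq_insertion)

lemma subst_add: "subst \<sigma> (p + q) = subst \<sigma> p + subst \<sigma> q"
  by (simp add: subst_eq_insertion substitution.insertion_add)

lemma subst_mult: "subst \<sigma> (p * q) = subst \<sigma> p * subst \<sigma> q"
  by (simp add: subst_eq_insertion substitution.insertion_mult)

lemma subst_diff: "subst \<sigma> (p - q) = subst \<sigma> p - subst \<sigma> q"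
  using subst_add[of \<sigma> "p - q" q] by simp

lemma subst_sum: "subst \<sigma> (sum f A) = (\<Sum>a\<in>A. subst \<sigma> (f a))"
  by (simp add: subst_eq_insertion substitution.insertion_sum)

lemma subst_power: "subst \<sigma> (p ^ e) = subst \<sigma> p ^ e"
  by (simp add: subst_eq_insertion substitution.insertion_power)

lemma subst_single: "subst \<sigma> (single m c) = const c * mprod \<sigma> m"
  by (simp add: subst_eq_insertion substitution.insertion_single)

lemma subst_const [simp]: "subst \<sigma> (const c) = const c"
  by (simp add: const_def[of c] subst_single)

lemma subst_Var [simp]: "subst \<sigma> (Var j) = \<sigma> j"
  by (simp add: Var_def var_mon_def subst_single)

lemma subst_mprod: "subst \<sigma> (mprod \<tau> m) = mprod (\<lambda>j. subst \<sigma> (\<tau> j)) m"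
  unfolding mprod_def subst_eq_insertion
  by (simp add: substitution.insertion_prod substitution.insertion_power)

lemma subst_subst: "subst \<sigma> (subst \<tau> p) = subst (\<lambda>j. subst \<sigma> (\<tau> j)) p"
  by (subst (2) subst_eq_insertion, subst (2) subst_eq_insertion)
    (simp add: substitution.insertion_def subst_sum subst_mult subst_mprod)

lemma Var_power: "Var j ^ e = single (single j e) 1"
  by (induction e) (auto simp: Var_def var_mon_def Poly_Mapping.mult_single single_add[symmetric])

lemma mprod_Var: "mprod Var m = single m 1"
proof -
  have "(\<Prod>j\<in>S. Var j ^ lookup m j) = single (\<Sum>j\<in>S. single j (lookup m j)) 1" if "finite S" for S
    using that by (induction S) (auto simp: Var_power Poly_Mapping.mult_single)
  from this[of "keys m"] show ?thesis
    unfolding mprod_def by (simp flip: poly_mapping_sum_single)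
qed

lemma subst_cong:
  assumes "p \<in> polyR n" "\<And>j. j < n \<Longrightarrow> \<sigma> j = \<tau> j"
  shows "subst \<sigma> p = subst \<tau> p"
  unfolding subst_def using assms
  by (intro sum.cong refl arg_cong2[where f="(*)"] prod.cong) (auto simp: polyR_def subset_iff)

lemma subst_id:
  assumes "p \<in> polyR n" "\<And>j. j < n \<Longrightarrow> \<sigma> j = Var j"
  shows "subst \<sigma> p = p"
proof -
  have "subst \<sigma> p = subst Var p"
    by (rule subst_cong) (use assms in auto)
  also have "\<dots> = p"
    unfolding subst_eq_insertion substitution.insertion_def
    by (subst (3) poly_mapping_sum_single) (simp add: mprod_Var)
  finally show ?thesis .
qed

section \<open>The graded polynomial ring\<close>

lemma polyR_0 [simp]: "0 \<in> polyR n"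
  by (simp add: polyR_def)

lemma polyR_add: "p \<in> polyR n \<Longrightarrow> q \<in> polyR n \<Longrightarrow> p + q \<in> polyR n"
  using Poly_Mapping.keys_add[of p q] by (auto simp: polyR_def)

lemma polyR_single: "keys m \<subseteq> {..<n} \<Longrightarrow> single m c \<in> polyR n"
  by (simp add: polyR_def)

lemma polyR_const [simp]: "const c \<in> polyR n"
  by (simp add: const_def polyR_single)

lemma polyR_1 [simp]: "1 \<in> polyR n"
  using polyR_const[of 1] by simp

lemma polyR_Var [simp]: "j < n \<Longrightarrow> Var j \<in> polyR n"
  by (simp add: Var_def var_mon_def polyR_single)

lemma polyR_mult: "p \<in> polyR n \<Longrightarrow> q \<in> polyR n \<Longrightarrow> p * q \<in> polyR n"
  using Poly_Mapping.keys_mult[of p q] by (fastforce simp: polyR_def keys_add_mon)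

lemma polyR_diff: "p \<in> polyR n \<Longrightarrow> q \<in> polyR n \<Longrightarrow> p - q \<in> polyR n"
  using keys_diff[of p q] by (auto simp: polyR_def)

lemma polyR_sum: "(\<And>a. a \<in> A \<Longrightarrow> f a \<in> polyR n) \<Longrightarrow> sum f A \<in> polyR n"
  by (induction A rule: infinite_finite_induct) (auto intro: polyR_add)

lemma polyR_prod: "(\<And>a. a \<in> A \<Longrightarrow> f a \<in> polyR n) \<Longrightarrow> prod f A \<in> polyR n"
  by (induction A rule: infinite_finite_induct) (auto intro: polyR_mult)

lemma polyR_power: "p \<in> polyR n \<Longrightarrow> p ^ e \<in> polyR n"
  by (induction e) (auto intro: polyR_mult)

lemma polyR_subst:
  assumes "p \<in> polyR n" "\<And>j. j < n \<Longrightarrow> \<sigma> j \<in> polyR n"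
  shows "subst \<sigma> p \<in> polyR n"
  unfolding subst_def using assms(1)
  by (intro polyR_sum polyR_mult polyR_prod polyR_power polyR_const assms(2)) (auto simp: polyR_def)

definition forms :: "nat \<Rightarrow> nat \<Rightarrow> 'k::comm_ring_1 mpoly set" where
  "forms n d = {p \<in> polyR n. homog_of_deg d p}"

lemma forms_iff_keys: "p \<in> forms n d \<longleftrightarrow> keys p \<subseteq> monomials n d"
  by (auto simp: forms_def polyR_def homog_of_deg_def monomials_def)

lemma forms_polyR: "p \<in> forms n d \<Longrightarrow> p \<in> polyR n"
  by (simp add: forms_def)

lemma forms_0 [simp]: "0 \<in> forms n d"
  by (simp add: forms_iff_keys)

lemma forms_add: "p \<in> forms n d \<Longrightarrow> q \<in> forms n d \<Longrightarrow> p + q \<in> forms n d"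
  using Poly_Mapping.keys_add[of p q] by (auto simp: forms_iff_keys)

lemma forms_diff: "p \<in> forms n d \<Longrightarrow> q \<in> forms n d \<Longrightarrow> p - q \<in> forms n d"
  using keys_diff[of p q] by (auto simp: forms_iff_keys)

lemma forms_mult: "p \<in> forms n d \<Longrightarrow> q \<in> forms n e \<Longrightarrow> p * q \<in> forms n (d + e)"
  using Poly_Mapping.keys_mult[of p q] by (fastforce simp: forms_iff_keys monomials_def keys_add_mon)

lemma forms_single: "m \<in> monomials n d \<Longrightarrow> single m c \<in> forms n d"
  by (simp add: forms_iff_keys)

lemma forms_const: "const c \<in> forms n 0"
  by (simp add: const_def forms_single monomials_def)

lemma forms_scale: "p \<in> forms n d \<Longrightarrow> const c * p \<in> forms n d"
  using forms_mult[OF forms_const] by fastforce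

lemma forms_Var: "j < n \<Longrightarrow> Var j \<in> forms n 1"
  by (simp add: Var_def var_mon_def forms_single monomials_def)

lemma forms_sum: "(\<And>a. a \<in> A \<Longrightarrow> f a \<in> forms n d) \<Longrightarrow> sum f A \<in> forms n d"
  by (induction A rule: infinite_finite_induct) (auto intro: forms_add)

lemma forms_power: "p \<in> forms n d \<Longrightarrow> p ^ e \<in> forms n (e * d)"
proof (induction e)
  case 0
  then show ?case
    using forms_const[of 1] by simp
next
  case (Suc e)
  then show ?case
    using forms_mult[of p n d "p ^ e" "e * d"] by simp
qed

lemma forms_mprod:
  assumes "\<And>j. j < n \<Longrightarrow> \<sigma> j \<in> forms k 1" "keys m \<subseteq> {..<n}"
  shows "mprod \<sigma> m \<in> forms k (mdeg m)"
proof -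
  have "(\<Prod>j\<in>S. \<sigma> j ^ lookup m j) \<in> forms k (\<Sum>j\<in>S. lookup m j)" if "finite S" "S \<subseteq> {..<n}" for S
    using that
  proof (induction S rule: finite_induct)
    case empty
    then show ?case
      using forms_const[of 1] by simp
  next
    case (insert j S)
    then show ?case
      using forms_mult[OF forms_power[OF assms(1)]] by fastforce
  qed
  from this[of "keys m"] assms(2) show ?thesis
    by (simp add: mprod_def mdeg_def)
qed

lemma forms_subst:
  assumes "p \<in> forms n d" "\<And>j. j < n \<Longrightarrow> \<sigma> j \<in> forms k 1"
  shows "subst \<sigma> p \<in> forms k d"
  unfolding subst_eq_insertion substitution.insertion_def
proof (intro forms_sum forms_scale)
  fix m assume "m \<in> keys p"
  then have "keys m \<subseteq> {..<n}" "mdeg m = d"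
    using assms(1) by (auto simp: forms_iff_keys monomials_def)
  then show "mprod \<sigma> m \<in> forms k d"
    using forms_mprod[of n \<sigma> k m] assms(2) by simp
qed

lemma lookup_homog_comp: "lookup (homog_comp d p) m = (if mdeg m = d then lookup p m else 0)"
  unfolding homog_comp_def by (auto simp: lookup_sum lookup_single when_def in_keys_iff)

lemma homog_comp_in_forms: "p \<in> polyR n \<Longrightarrow> homog_comp d p \<in> forms n d"
  by (auto simp: forms_iff_keys monomials_def polyR_def in_keys_iff lookup_homog_comp split: if_splits)

lemma homog_comp_add: "homog_comp d (p + q) = homog_comp d p + homog_comp d q"
  by (rule poly_mapping_eqI) (simp add: lookup_homog_comp lookup_add)

lemma homog_comp_0 [simp]: "homog_comp d 0 = 0"
  by (rule poly_mapping_eqI) (simp add: lookup_homog_comp)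

lemma homog_comp_sum: "homog_comp d (sum f A) = (\<Sum>a\<in>A. homog_comp d (f a))"
  by (induction A rule: infinite_finite_induct) (auto simp: homog_comp_add)

lemma homog_comp_forms: "p \<in> forms n e \<Longrightarrow> homog_comp d p = (if d = e then p else 0)"
  by (rule poly_mapping_eqI) (auto simp: lookup_homog_comp forms_iff_keys monomials_def in_keys_iff)

lemma poly_eq_sum_homog_comp:
  "p = (\<Sum>d\<in>mdeg ` keys p. homog_comp d p)"
  by (rule poly_mapping_eqI) (auto simp: lookup_sum lookup_homog_comp in_keys_iff)

lemma homog_comp_mult_form:
  assumes "p \<in> polyR n" "q \<in> forms n e"
  shows "homog_comp d (p * q) = (if e \<le> d then homog_comp (d - e) p * q else 0)"
proof -
  have "p * q = (\<Sum>i\<in>mdeg ` keys p. homog_comp i p * q)"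
    by (subst (1) poly_eq_sum_homog_comp[of p]) (simp add: sum_distrib_right)
  also have "homog_comp d \<dots> = (\<Sum>i\<in>mdeg ` keys p. if d = i + e then homog_comp i p * q else 0)"
    using homog_comp_forms[OF forms_mult[OF homog_comp_in_forms[OF assms(1)] assms(2)]]
    by (simp add: homog_comp_sum)
  also have "\<dots> = (if e \<le> d then homog_comp (d - e) p * q else 0)"
  proof (cases "e \<le> d \<and> d - e \<in> mdeg ` keys p")
    case True
    then have "(if d = i + e then homog_comp i p * q else 0) =
        (if i = d - e then homog_comp i p * q else 0)" for i
      by auto
    then show ?thesis
      using True by simp
  next
    case False
    then have "e \<le> d \<Longrightarrow> homog_comp (d - e) p = 0"
      by (intro poly_mapping_eqI)
        (auto simp: lookup_homog_comp image_iff not_in_keys_iff_lookup_eq_zero[symmetric])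
    then show ?thesis
      using False by (auto intro!: sum.neutral)
  qed
  finally show ?thesis .
qed

definition linform :: "nat \<Rightarrow> (nat \<Rightarrow> 'k::comm_ring_1) \<Rightarrow> 'k mpoly" where
  "linform n c = (\<Sum>l<n. const (c l) * Var l)"

lemma lin_eq_linform: "lin n v j = linform n (\<lambda>l. v (j * n + l))"
  by (simp add: lin_def linform_def)

lemma gsubst_eq_linform: "j < n \<Longrightarrow> gsubst n v j = linform n (\<lambda>l. v (l * n + j))"
  by (simp add: gsubst_def linform_def)

lemma linform_cong: "(\<And>l. l < n \<Longrightarrow> a l = b l) \<Longrightarrow> linform n a = linform n b"
  by (simp add: linform_def)

lemma linform_in_forms: "linform n c \<in> forms n 1"
  unfolding linform_def by (intro forms_sum forms_scale forms_Var) simp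

lemma subst_linform: "subst \<sigma> (linform n c) = (\<Sum>l<n. const (c l) * \<sigma> l)"
  by (simp add: linform_def subst_sum subst_mult)

lemma lookup_linform: "lookup (linform n c) (var_mon k) = (if k < n then c k else 0)"
proof -
  have "var_mon l = var_mon k \<longleftrightarrow> l = k" for l
    unfolding var_mon_def by (metis lookup_single_eq lookup_single_not_eq zero_neq_one)
  then have "lookup (linform n c) (var_mon k) = (\<Sum>l<n. if l = k then c l else 0)"
    by (auto simp: linform_def lookup_sum Var_def lookup_single when_def intro!: sum.cong)
  then show ?thesis
    by simp
qed

lemma monomials_1: "monomials n 1 = var_mon ` {..<n}"
proof
  show "monomials n 1 \<subseteq> var_mon ` {..<n}"
  proof
    fix m assume m_degree: "m \<in> monomials n 1"
    then obtain k where k_key: "k \<in> keys m"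
      by (fastforce simp: monomials_def)
    then have "mon_dvd (var_mon k) m"
      by (simp add: var_mon_def mon_dvd_single_iff in_keys_iff)
    moreover have "k < n"
      using k_key m_degree by (auto simp: monomials_def)
    ultimately show "m \<in> var_mon ` {..<n}"
      using mon_dvd_mdeg_eq[of "var_mon k" m] m_degree by (auto simp: monomials_def var_mon_def)
  qed
qed (auto simp: monomials_def var_mon_def)

lemma forms_1_eq_linform:
  assumes "p \<in> forms n 1"
  shows "p = linform n (\<lambda>l. lookup p (var_mon l))"
proof (rule poly_mapping_eqI)
  fix m
  show "lookup p m = lookup (linform n (\<lambda>l. lookup p (var_mon l))) m"
  proof (cases "m \<in> monomials n 1")
    case True
    then obtain k where "m = var_mon k" "k < n"
      unfolding monomials_1 by blast
    then show ?thesis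
      by (simp add: lookup_linform)
  next
    case False
    then have "m \<notin> keys p" "m \<notin> keys (linform n (\<lambda>l. lookup p (var_mon l)))"
      using assms linform_in_forms by (auto simp: forms_iff_keys simp del: One_nat_def)
    then show ?thesis
      by (simp add: in_keys_iff)
  qed
qed

section \<open>Finite-dimensional sets in a vector space\<close>

context vector_space
begin

definition fin_dim :: "'b set \<Rightarrow> bool" where
  "fin_dim S \<longleftrightarrow> (\<exists>T. finite T \<and> S \<subseteq> span T)"

lemma finite_imp_fin_dim: "finite S \<Longrightarrow> local.fin_dim S"
  unfolding local.fin_dim_def using span_superset by blast

lemma fin_dim_subset_span:
  assumes "local.fin_dim T" "S \<subseteq> span T"
  shows "local.fin_dim S"
proof -
  obtain U where "finite U" "T \<subseteq> span U"
    using assms(1) by (auto simp: local.fin_dim_def)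
  then show ?thesis
    unfolding local.fin_dim_def using assms(2) span_minimal[OF _ subspace_span] by blast
qed

lemma fin_dim_Un:
  assumes "local.fin_dim S" "local.fin_dim T"
  shows "local.fin_dim (S \<union> T)"
proof -
  obtain U V where "finite U" "S \<subseteq> span U" "finite V" "T \<subseteq> span V"
    using assms by (auto simp: local.fin_dim_def)
  then show ?thesis
    unfolding local.fin_dim_def using span_mono[of U "U \<union> V"] span_mono[of V "U \<union> V"]
    by (intro exI[of _ "U \<union> V"]) blast
qed

lemma fin_dim_linear_image:
  assumes "Vector_Spaces.linear scale scale f" "local.fin_dim S"
  shows "local.fin_dim (f ` S)"
proof -
  interpret f: Vector_Spaces.linear scale scale f by fact
  show ?thesis
    using assms(2) unfolding local.fin_dim_def by (meson f.spans_image finite_imageI)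
qed

lemma fin_dim_basis:
  assumes "local.fin_dim S"
  obtains B where "B \<subseteq> S" "finite B" "independent B" "span B = span S" "card B = dim S"
proof -
  obtain B where B_basis: "B \<subseteq> S" "independent B" "S \<subseteq> span B" "card B = dim S"
    by (rule basis_exists)
  moreover have "finite B"
    using B_basis(1,2) assms independent_span_bound by (meson local.fin_dim_def subset_trans)
  moreover have "span B = span S"
    using B_basis(1,3) by (simp add: span_eq subset_trans[OF B_basis(1) span_superset])
  ultimately show ?thesis
    using that by blast
qed

lemma dim_le_of_subset_span:
  assumes "local.fin_dim T" "S \<subseteq> span T"
  shows "dim S \<le> dim T"
proof -
  obtain B where "finite B" "span B = span T" "card B = dim T"
    using fin_dim_basis[OF assms(1)] by metis
  then show ?thesis
    using dim_le_card[of S B] assms(2) by simp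
qed

lemma dim_insert_fin_dim:
  assumes "local.fin_dim S"
  shows "dim (insert x S) = (if x \<in> span S then dim S else Suc (dim S))"
proof (cases "x \<in> span S")
  case True
  then show ?thesis
    by (simp add: span_eq_dim[OF span_redundant])
next
  case False
  obtain B where B_basis: "B \<subseteq> S" "finite B" "independent B" "span B = span S" "card B = dim S"
    by (rule fin_dim_basis[OF assms])
  have "card (insert x B) = dim (insert x S)"
  proof (rule basis_card_eq_dim)
    show "insert x B \<subseteq> insert x S"
      using B_basis(1) by blast
    have "S \<subseteq> span (insert x B)"
      using B_basis(4) span_superset[of S] span_mono[of B "insert x B"] by blast
    then show "insert x S \<subseteq> span (insert x B)"
      by (simp add: span_base)
    show "independent (insert x B)"
      using False B_basis(3,4) by (simp add: independent_insertI)
  qed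
  moreover have "x \<notin> B"
    using False B_basis(1) span_base by blast
  ultimately show ?thesis
    using False B_basis(2,5) by simp
qed

lemma dim_eq_0_iff:
  assumes "local.fin_dim S"
  shows "dim S = 0 \<longleftrightarrow> S \<subseteq> {0}"
proof
  assume "dim S = 0"
  moreover obtain B where "finite B" "span B = span S" "card B = dim S"
    using fin_dim_basis[OF assms] by metis
  ultimately show "S \<subseteq> {0}"
    using span_superset[of S] by auto
next
  assume "S \<subseteq> {0}"
  then show "dim S = 0"
    using dim_le_card[of S "{}"] by simp
qed

lemma dim_le_iff_subset_span:
  assumes "local.fin_dim T" "S \<subseteq> span T"
  shows "dim T \<le> dim S \<longleftrightarrow> T \<subseteq> span S"
proof
  assume dim_le: "dim T \<le> dim S"
  show "T \<subseteq> span S"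
  proof
    fix x assume "x \<in> T"
    then have "dim (insert x S) \<le> dim T"
      using assms by (intro dim_le_of_subset_span) (auto intro: span_base)
    then show "x \<in> span S"
      using dim_insert_fin_dim[OF fin_dim_subset_span[OF assms], of x] dim_le
      by (auto split: if_splits)
  qed
qed (rule dim_le_of_subset_span[OF fin_dim_subset_span[OF assms]])

lemma dim_image_inj:
  assumes "Vector_Spaces.linear scale scale f" "inj_on f (span S)"
  shows "dim (f ` S) = dim S"
proof -
  interpret f: Vector_Spaces.linear scale scale f by fact
  obtain B where B_basis: "B \<subseteq> S" "independent B" "S \<subseteq> span B" "card B = dim S"
    by (rule basis_exists)
  have inj: "inj_on f (span B)"
    using assms(2) span_mono[OF B_basis(1)] by (rule inj_on_subset)
  have "card (f ` B) = dim (f ` S)"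
  proof (rule basis_card_eq_dim)
    show "f ` S \<subseteq> span (f ` B)"
      using B_basis(3) by (rule f.spans_image)
    show "independent (f ` B)"
      using B_basis(2) inj by (rule f.independent_injective_image)
  qed (use B_basis(1) in blast)
  moreover have "card (f ` B) = card B"
    using inj span_superset by (intro card_image) (rule inj_on_subset)
  ultimately show ?thesis
    using B_basis(4) by simp
qed

lemma dim_Un_linear_image:
  assumes "Vector_Spaces.linear scale scale f" "local.fin_dim U" "finite C" "independent C"
    and "\<And>x. x \<in> span C \<Longrightarrow> f x \<in> span U \<Longrightarrow> x = 0"
  shows "dim (U \<union> f ` C) = dim U + card C"
proof -
  interpret f: Vector_Spaces.linear scale scale f by fact
  show ?thesis
    using assms(3-)
  proof (induction C rule: finite_induct)
    case (insert c C)
    have "c \<notin> span C" "independent C"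
      using insert.prems(1) insert.hyps(2) by (auto simp: independent_insert)
    have "f c \<notin> span (U \<union> f ` C)"
    proof
      assume "f c \<in> span (U \<union> f ` C)"
      then obtain u x where "f c = u + f x" "u \<in> span U" "x \<in> span C"
        by (auto simp: span_Un f.span_image)
      then have "f (c - x) \<in> span U" "c - x \<in> span (insert c C)"
        using span_mono[of C "insert c C"] by (auto simp: f.diff intro: span_diff span_base)
      then have "c - x = 0"
        using insert.prems(2) by blast
      then show False
        using \<open>c \<notin> span C\<close> \<open>x \<in> span C\<close> by simp
    qed
    moreover have "local.fin_dim (U \<union> f ` C)"
      using fin_dim_Un[OF assms(2)
          fin_dim_linear_image[OF assms(1) finite_imp_fin_dim[OF insert.hyps(1)]]] .
    moreover have "dim (U \<union> f ` C) = dim U + card C"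
      using insert.IH \<open>independent C\<close> insert.prems(2) span_mono[of C "insert c C"] by blast
    ultimately show ?case
      using insert.hyps by (simp add: dim_insert_fin_dim)
  qed simp
qed

lemma span_Int_of_independent:
  assumes "independent (B \<union> C)" "B \<inter> C = {}" "x \<in> span B" "x \<in> span C"
  shows "x = 0"
proof -
  have ind: "independent B" "independent C"
    using independent_mono[OF assms(1)] by auto
  have "representation B x = representation C x"
    using representation_extend[OF assms(1)] assms(3,4) by (metis Un_upper1 Un_upper2)
  then have "representation B x b = 0" for b
    using representation_ne_zero assms(2) by (metis disjoint_iff)
  then show ?thesis
    using sum_nonzero_representation_eq[OF ind(1) assms(3)] by simp
qed

lemma fin_dim_basis_extension:
  assumes "local.fin_dim V" "N \<subseteq> V"
  obtains B C where "B \<subseteq> N" "N \<subseteq> span B" "card B = dim N"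
    "C \<subseteq> V" "finite C" "independent (B \<union> C)" "B \<inter> C = {}" "V \<subseteq> span (B \<union> C)"
    "card B + card C = dim V"
proof -
  obtain B where B_basis: "B \<subseteq> N" "independent B" "N \<subseteq> span B" "card B = dim N"
    by (rule basis_exists)
  obtain A where A_basis: "B \<subseteq> A" "A \<subseteq> V" "independent A" "V \<subseteq> span A"
    by (rule maximal_independent_subset_extend[OF subset_trans[OF B_basis(1) assms(2)] B_basis(2)])
  have "finite A"
    using A_basis(2,3) assms(1) independent_span_bound by (meson local.fin_dim_def subset_trans)
  moreover have "card A = dim V"
    using A_basis(2-4) by (intro basis_card_eq_dim)
  ultimately have "finite (A - B)" "card B + card (A - B) = dim V"
    using A_basis(1) finite_subset[OF A_basis(1)] card_mono[of A B] by (simp_all add: card_Diff_subset)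
  moreover have "A - B \<subseteq> V"
    using A_basis(2) by blast
  ultimately show ?thesis
    using that[of B "A - B"] A_basis(3,4) B_basis(1,3,4) by (simp add: Un_absorb1[OF A_basis(1)])
qed

text \<open>Rank--nullity for the map \<open>V \<rightarrow> (U + f V) / U\<close>.\<close>

lemma dim_linear_preimage:
  assumes lin: "Vector_Spaces.linear scale scale f" and "subspace V" "subspace U"
    and fin: "local.fin_dim V" "local.fin_dim U"
  shows "dim {x \<in> V. f x \<in> U} + dim (U \<union> f ` V) = dim V + dim U"
proof -
  interpret f: Vector_Spaces.linear scale scale f by fact
  let ?N = "{x \<in> V. f x \<in> U}"
  obtain B C where B_kernel: "B \<subseteq> ?N" "?N \<subseteq> span B" "card B = dim ?N"
    and C_complement: "C \<subseteq> V" "finite C" and BC_basis: "independent (B \<union> C)" "B \<inter> C = {}"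
      "V \<subseteq> span (B \<union> C)"
    and card: "card B + card C = dim V"
    by (rule fin_dim_basis_extension[of V ?N]) (use fin(1) in auto)
  have kernel_disjoint: "x = 0" if "x \<in> span C" "f x \<in> span U" for x
  proof (rule span_Int_of_independent[OF BC_basis(1,2) _ that(1)])
    have "x \<in> V"
      using that(1) span_minimal[OF C_complement(1) \<open>subspace V\<close>] by blast
    then show "x \<in> span B"
      using that(2) \<open>subspace U\<close> B_kernel(2) by (auto simp: span_eq_iff[THEN iffD2])
  qed
  have "independent C"
    using BC_basis(1) by (rule independent_mono) simp
  with lin fin(2) C_complement(2) have "dim (U \<union> f ` C) = dim U + card C"
    using kernel_disjoint by (rule dim_Un_linear_image)
  moreover have "dim (U \<union> f ` V) = dim (U \<union> f ` C)"
  proof (rule span_eq_dim)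
    have "f ` V \<subseteq> span (f ` (B \<union> C))"
      using BC_basis(3) by (rule f.spans_image)
    also have "\<dots> \<subseteq> span (U \<union> f ` C)"
      using B_kernel(1) by (intro span_mono) auto
    finally show "span (U \<union> f ` V) = span (U \<union> f ` C)"
      using span_superset[of "U \<union> f ` C"] span_superset[of "U \<union> f ` V"] C_complement(1)
      by (simp only: span_eq) blast
  qed
  ultimately show ?thesis
    using B_kernel(3) card by simp
qed

end

interpretation mp: vector_space "\<lambda>(c::'k::field) (p::'k mpoly). const c * p"
  by unfold_locales (auto simp: distrib_left const_add const_mult distrib_right mult.assoc)

lemma in_span_const_mult_iff:
  assumes "c \<noteq> 0"
  shows "const c * p \<in> mp.span S \<longleftrightarrow> p \<in> mp.span S"
proof
  assume "const c * p \<in> mp.span S"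
  then have "const (inverse c) * (const c * p) \<in> mp.span S"
    by (rule mp.span_scale)
  then show "p \<in> mp.span S"
    using assms by (simp add: mult.assoc[symmetric] const_mult[symmetric])
qed (rule mp.span_scale)

abbreviation mpoly_linear :: "('k::field mpoly \<Rightarrow> 'k mpoly) \<Rightarrow> bool" where
  "mpoly_linear \<equiv> Vector_Spaces.linear (\<lambda>c p. const c * p) (\<lambda>c p. const c * p)"

lemma mpoly_linear_subst: "mpoly_linear (subst \<sigma>)"
  by unfold_locales (auto simp: subst_add subst_mult)

lemma mpoly_linear_mult: "mpoly_linear ((*) f)"
  by unfold_locales (auto simp: distrib_left mult.left_commute)

abbreviation mon_polys :: "mon set \<Rightarrow> 'k::field mpoly set" where
  "mon_polys M \<equiv> (\<lambda>m. single m 1) ` M"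

lemma subspace_keys_subset: "mp.subspace {p :: 'k::field mpoly. keys p \<subseteq> M}"
proof (rule mp.subspaceI)
  fix p q :: "'k mpoly" assume "p \<in> {p. keys p \<subseteq> M}" "q \<in> {p. keys p \<subseteq> M}"
  then show "p + q \<in> {p. keys p \<subseteq> M}"
    using Poly_Mapping.keys_add[of p q] by auto
qed (auto simp: in_keys_iff subset_iff)

lemma in_span_mon_polys_iff: "p \<in> mp.span (mon_polys M) \<longleftrightarrow> keys p \<subseteq> M"
proof
  have "mp.span (mon_polys M) \<subseteq> {p :: 'a mpoly. keys p \<subseteq> M}"
    by (rule mp.span_minimal[OF _ subspace_keys_subset]) auto
  then show "p \<in> mp.span (mon_polys M) \<Longrightarrow> keys p \<subseteq> M"
    by blast
next
  assume "keys p \<subseteq> M"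
  then have "(\<Sum>m\<in>keys p. const (lookup p m) * single m 1) \<in> mp.span (mon_polys M)"
    by (intro mp.span_sum mp.span_scale mp.span_base) auto
  then show "p \<in> mp.span (mon_polys M)"
    by (simp flip: poly_mapping_sum_single)
qed

lemma forms_eq_span: "forms n d = mp.span (mon_polys (monomials n d))"
  by (auto simp: forms_iff_keys in_span_mon_polys_iff)

lemma span_forms [simp]: "mp.span (forms n d) = forms n d"
  by (simp add: forms_eq_span)

lemma subspace_forms: "mp.subspace (forms n d)"
  by (metis mp.subspace_span span_forms)

lemma fin_dim_forms: "mp.fin_dim (forms n d)"
  unfolding mp.fin_dim_def forms_eq_span using finite_monomials by blast

lemma fin_dim_subset_forms: "S \<subseteq> forms n d \<Longrightarrow> mp.fin_dim S"
  using mp.fin_dim_subset_span[OF fin_dim_forms[of n d]] mp.span_superset by blast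

section \<open>Polynomial functions and the Zariski topology\<close>

definition polyfun :: "nat \<Rightarrow> ((nat \<Rightarrow> 'k::comm_ring_1) \<Rightarrow> 'k) \<Rightarrow> bool" where
  "polyfun N f \<longleftrightarrow> (\<exists>h\<in>polyR N. f = eval h)"

lemma polyfun_const: "polyfun N (\<lambda>v. c)"
  unfolding polyfun_def
  by (rule bexI[of _ "const c"])
    (auto simp: eval_eq_insertion const_def[of c] evaluation.insertion_single polyR_single)

lemma polyfun_coord: "k < N \<Longrightarrow> polyfun N (\<lambda>v. v k)"
  unfolding polyfun_def
  by (rule bexI[of _ "Var k"])
    (auto simp: eval_eq_insertion Var_def var_mon_def evaluation.insertion_single polyR_single)

lemma polyfun_add: "polyfun N f \<Longrightarrow> polyfun N g \<Longrightarrow> polyfun N (\<lambda>v. f v + g v)"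
  unfolding polyfun_def
  by (metis (no_types, lifting) eval_eq_insertion evaluation.insertion_add ext polyR_add)

lemma polyfun_mult: "polyfun N f \<Longrightarrow> polyfun N g \<Longrightarrow> polyfun N (\<lambda>v. f v * g v)"
  unfolding polyfun_def
  by (metis (no_types, lifting) eval_eq_insertion evaluation.insertion_mult ext polyR_mult)

lemma polyfun_uminus: "polyfun N f \<Longrightarrow> polyfun N (\<lambda>v. - f v)"
  using polyfun_mult[OF polyfun_const[of N "-1"], of f] by simp

lemma polyfun_sum: "(\<And>a. a \<in> A \<Longrightarrow> polyfun N (f a)) \<Longrightarrow> polyfun N (\<lambda>v. \<Sum>a\<in>A. f a v)"
  by (induction A rule: infinite_finite_induct) (auto intro: polyfun_add polyfun_const)

lemma polyfun_prod: "(\<And>a. a \<in> A \<Longrightarrow> polyfun N (f a)) \<Longrightarrow> polyfun N (\<lambda>v. \<Prod>a\<in>A. f a v)"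
  by (induction A rule: infinite_finite_induct) (auto intro: polyfun_mult polyfun_const)

lemma polyfun_power: "polyfun N f \<Longrightarrow> polyfun N (\<lambda>v. f v ^ e)"
  by (induction e) (auto intro: polyfun_mult polyfun_const)

lemma polyfun_compose:
  assumes "polyfun N f" "\<And>k. k < N \<Longrightarrow> polyfun M (\<lambda>v. s v k)"
  shows "polyfun M (\<lambda>v. f (s v))"
proof -
  obtain h where f_eq_eval: "h \<in> polyR N" "f = eval h"
    using assms(1) by (auto simp: polyfun_def)
  show ?thesis
    unfolding f_eq_eval(2) eval_def using f_eq_eval(1)
    by (intro polyfun_sum polyfun_mult polyfun_prod polyfun_power polyfun_const assms(2))
      (auto simp: polyR_def)
qed

lemma polyfun_cong:
  assumes "polyfun N f" "\<And>k. k < N \<Longrightarrow> a k = b k"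
  shows "f a = f b"
proof -
  obtain h where f_eq_eval: "h \<in> polyR N" "f = eval h"
    using assms(1) by (auto simp: polyfun_def)
  show ?thesis
    unfolding f_eq_eval(2) eval_def using f_eq_eval(1) assms(2)
    by (intro sum.cong refl arg_cong2[where f="(*)"] prod.cong) (auto simp: polyR_def subset_iff)
qed

lemma polyfun_univariate:
  assumes "polyfun 1 f"
  obtains p where "\<And>v. f v = poly p (v 0)"
proof -
  obtain h where f_eq_eval: "h \<in> polyR 1" "f = eval h"
    using assms(1) by (auto simp: polyfun_def)
  have "f v = poly (\<Sum>m\<in>keys h. Polynomial.monom (lookup h m) (lookup m 0)) (v 0)" for v
    unfolding f_eq_eval(2) eval_eq_insertion evaluation.insertion_def poly_sum
  proof (rule sum.cong[OF refl])
    fix m assume "m \<in> keys h"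
    then have "keys m \<subseteq> {0}"
      using f_eq_eval(1) by (auto simp: polyR_def)
    then have "mprod v m = v 0 ^ lookup m 0"
      by (subst mprod_superset[of "{0}"]) auto
    then show "lookup h m * mprod v m = poly (Polynomial.monom (lookup h m) (lookup m 0)) (v 0)"
      by (simp add: poly_monom)
  qed
  then show ?thesis
    using that by blast
qed

text \<open>Restrict both functions to the line through the two points.\<close>

lemma polyfun_common_nonzero:
  fixes f g :: "(nat \<Rightarrow> 'k::field_char_0) \<Rightarrow> 'k"
  assumes "polyfun N f" "polyfun N g" "f a \<noteq> 0" "g b \<noteq> 0"
  shows "\<exists>c. f c * g c \<noteq> 0"
proof -
  define line where "line = (\<lambda>(t :: nat \<Rightarrow> 'k) k. a k + t 0 * (b k - a k))"
  have line: "polyfun 1 (\<lambda>t. line t k)" for k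
    unfolding line_def by (intro polyfun_add polyfun_mult polyfun_const polyfun_coord) auto
  obtain p where f_on_line: "\<And>t. f (line t) = poly p (t 0)"
    using polyfun_univariate[OF polyfun_compose[of N f 1 line, OF assms(1) line]] by metis
  obtain q where g_on_line: "\<And>t. g (line t) = poly q (t 0)"
    using polyfun_univariate[OF polyfun_compose[of N g 1 line, OF assms(2) line]] by metis
  have "poly p 0 \<noteq> 0" "poly q 1 \<noteq> 0"
    using f_on_line[of "\<lambda>_. 0"] g_on_line[of "\<lambda>_. 1"] assms(3,4) by (simp_all add: line_def)
  then have "p * q \<noteq> 0"
    by auto
  then have "finite {x. poly (p * q) x = 0}"
    by (rule poly_roots_finite)
  then obtain x where "poly (p * q) x \<noteq> 0"
    using infinite_UNIV_char_0 by (metis (mono_tags, lifting) UNIV_I ex_new_if_finite mem_Collect_eq)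
  then have "f (line (\<lambda>_. x)) * g (line (\<lambda>_. x)) \<noteq> 0"
    by (simp add: f_on_line g_on_line)
  then show ?thesis
    by blast
qed

lemma generic_iff:
  "generic N P \<longleftrightarrow> (\<exists>f. polyfun N f \<and> (\<exists>v. f v \<noteq> 0) \<and> (\<forall>v. f v \<noteq> 0 \<longrightarrow> P v))" (is "?L = ?R")
proof
  assume ?L
  then obtain S where "S \<subseteq> polyR N" "{v. \<exists>h\<in>S. eval h v \<noteq> 0} \<noteq> {}" "\<forall>v\<in>{v. \<exists>h\<in>S. eval h v \<noteq> 0}. P v"
    unfolding generic_def zariski_open_def by blast
  then show ?R
    unfolding polyfun_def by blast
next
  assume ?R
  then obtain h where "h \<in> polyR N" "\<exists>v. eval h v \<noteq> 0" "\<forall>v. eval h v \<noteq> 0 \<longrightarrow> P v"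
    unfolding polyfun_def by blast
  then show ?L
    unfolding generic_def zariski_open_def
    by (intro exI[of _ "{v. eval h v \<noteq> 0}"]) (auto intro!: exI[of _ "{h}"])
qed

definition zariski_nhds :: "nat \<Rightarrow> (nat \<Rightarrow> 'k::field) \<Rightarrow> (nat \<Rightarrow> 'k) filter" where
  "zariski_nhds N a = Abs_filter (\<lambda>P. \<exists>f. polyfun N f \<and> f a \<noteq> 0 \<and> (\<forall>v. f v \<noteq> 0 \<longrightarrow> P v))"

lemma eventually_zariski_nhds:
  fixes P :: "(nat \<Rightarrow> 'k::field) \<Rightarrow> bool"
  shows "eventually P (zariski_nhds N a) \<longleftrightarrow> (\<exists>f. polyfun N f \<and> f a \<noteq> 0 \<and> (\<forall>v. f v \<noteq> 0 \<longrightarrow> P v))"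
  unfolding zariski_nhds_def
proof (rule eventually_Abs_filter, rule is_filter.intro)
  show "\<exists>f. polyfun N f \<and> f a \<noteq> 0 \<and> (\<forall>v. f v \<noteq> 0 \<longrightarrow> True)"
    by (intro exI[of _ "\<lambda>v. 1"]) (auto intro: polyfun_const)
next
  fix P Q :: "(nat \<Rightarrow> 'k) \<Rightarrow> bool"
  assume "\<exists>f. polyfun N f \<and> f a \<noteq> 0 \<and> (\<forall>v. f v \<noteq> 0 \<longrightarrow> P v)"
    and "\<exists>f. polyfun N f \<and> f a \<noteq> 0 \<and> (\<forall>v. f v \<noteq> 0 \<longrightarrow> Q v)"
  then obtain f g where "polyfun N f" "f a \<noteq> 0" "\<And>v. f v \<noteq> 0 \<Longrightarrow> P v"
    and "polyfun N g" "g a \<noteq> 0" "\<And>v. g v \<noteq> 0 \<Longrightarrow> Q v"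
    by metis
  then show "\<exists>f. polyfun N f \<and> f a \<noteq> 0 \<and> (\<forall>v. f v \<noteq> 0 \<longrightarrow> P v \<and> Q v)"
    by (intro exI[of _ "\<lambda>v. f v * g v"]) (auto intro: polyfun_mult)
qed blast

definition zariski_generic :: "nat \<Rightarrow> (nat \<Rightarrow> 'k::field_char_0) filter" where
  "zariski_generic N = Abs_filter (generic N)"

lemma eventually_zariski_generic:
  fixes P :: "(nat \<Rightarrow> 'k::field_char_0) \<Rightarrow> bool"
  shows "eventually P (zariski_generic N) \<longleftrightarrow> generic N P"
  unfolding zariski_generic_def
proof (rule eventually_Abs_filter, rule is_filter.intro)
  show "generic N (\<lambda>v. True)"
    unfolding generic_iff by (intro exI[of _ "\<lambda>v. 1"]) (auto intro: polyfun_const)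
next
  fix P Q :: "(nat \<Rightarrow> 'k) \<Rightarrow> bool"
  assume "generic N P" "generic N Q"
  then obtain f g a b where f_nonzero: "polyfun N f" "f a \<noteq> 0" "\<And>v. f v \<noteq> 0 \<Longrightarrow> P v"
    and g_nonzero: "polyfun N g" "g b \<noteq> 0" "\<And>v. g v \<noteq> 0 \<Longrightarrow> Q v"
    unfolding generic_iff by metis
  then show "generic N (\<lambda>v. P v \<and> Q v)"
    unfolding generic_iff
    using polyfun_common_nonzero[OF f_nonzero(1) g_nonzero(1) f_nonzero(2) g_nonzero(2)]
    by (intro exI[of _ "\<lambda>v. f v * g v"]) (auto intro: polyfun_mult)
qed (auto simp: generic_def)

lemma generic_iff_nhds: "generic N P \<longleftrightarrow> (\<exists>a. eventually P (zariski_nhds N a))"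
  unfolding generic_iff eventually_zariski_nhds by blast

lemma zariski_generic_le_nhds: "zariski_generic N \<le> zariski_nhds N a"
  unfolding le_filter_def eventually_zariski_generic generic_iff_nhds by blast

lemma eventually_nhds_imp_generic:
  "eventually P (zariski_nhds N a) \<Longrightarrow> eventually P (zariski_generic N)"
  by (rule filter_leD[OF zariski_generic_le_nhds])

lemma zariski_generic_neq_bot [simp]: "zariski_generic N \<noteq> bot"
  unfolding trivial_limit_def eventually_zariski_generic by (auto simp: generic_iff)

lemma filterlim_zariski_generic:
  fixes s :: "(nat \<Rightarrow> 'k::field_char_0) \<Rightarrow> nat \<Rightarrow> 'k"
  assumes poly: "\<And>k. k < N \<Longrightarrow> polyfun M (\<lambda>v. s v k)"
    and surj: "\<And>a. \<exists>b. \<forall>k<N. s b k = a k"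
  shows "filterlim s (zariski_generic N) (zariski_generic M)"
  unfolding filterlim_iff
proof (intro allI impI)
  fix P :: "(nat \<Rightarrow> 'k) \<Rightarrow> bool"
  assume "eventually P (zariski_generic N)"
  then obtain f a where f_nonzero: "polyfun N f" "f a \<noteq> 0" "\<forall>v. f v \<noteq> 0 \<longrightarrow> P v"
    unfolding eventually_zariski_generic generic_iff by blast
  obtain b where "\<forall>k<N. s b k = a k"
    using surj by blast
  then have "f (s b) = f a"
    using polyfun_cong[OF f_nonzero(1)] by blast
  moreover have "polyfun M (\<lambda>v. f (s v))"
    using f_nonzero(1) poly by (rule polyfun_compose)
  ultimately show "\<forall>\<^sub>F v in zariski_generic M. P (s v)"
    unfolding eventually_zariski_generic generic_iff using f_nonzero(2,3)
    by (intro exI[of _ "\<lambda>v. f (s v)"]) (auto intro: exI[of _ b])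
qed

lemma zariski_generic_antimono:
  assumes "N \<le> M"
  shows "zariski_generic M \<le> (zariski_generic N :: (nat \<Rightarrow> 'k::field_char_0) filter)"
proof -
  have "filterlim (\<lambda>v. v) (zariski_generic N) (zariski_generic M :: (nat \<Rightarrow> 'k) filter)"
    using assms by (intro filterlim_zariski_generic polyfun_coord) auto
  then show ?thesis
    by (simp add: filterlim_def)
qed

definition splice :: "nat \<Rightarrow> (nat \<Rightarrow> 'a) \<Rightarrow> (nat \<Rightarrow> 'a) \<Rightarrow> nat \<Rightarrow> 'a" where
  "splice N u v k = (if k < N then u k else v k)"

lemma eventually_splice_left:
  assumes "eventually P (zariski_generic M)"
  obtains v where "\<forall>\<^sub>F u in zariski_generic N. P (splice N u v)"
proof -
  obtain f v where f_nonzero: "polyfun M f" "f v \<noteq> 0" "\<forall>u. f u \<noteq> 0 \<longrightarrow> P u"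
    using assms unfolding eventually_zariski_generic generic_iff by blast
  have "polyfun N (\<lambda>u. splice N u v k)" for k
    by (cases "k < N") (auto simp: splice_def intro: polyfun_coord polyfun_const)
  then have "polyfun N (\<lambda>u. f (splice N u v))"
    by (rule polyfun_compose[OF f_nonzero(1)])
  moreover have "splice N v v = v"
    by (simp add: splice_def fun_eq_iff)
  ultimately have "\<forall>\<^sub>F u in zariski_generic N. P (splice N u v)"
    unfolding eventually_zariski_generic generic_iff using f_nonzero(2,3)
    by (intro exI[of _ "\<lambda>u. f (splice N u v)"]) (auto intro: exI[of _ v])
  then show ?thesis
    using that by blast
qed

lemma eventually_splice_right:
  assumes "eventually P (zariski_generic M)"
  shows "\<forall>\<^sub>F u in zariski_generic M. \<forall>\<^sub>F v in zariski_generic M. P (splice N u v)"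
proof -
  obtain f a where f_nonzero: "polyfun M f" "f a \<noteq> 0" "\<forall>v. f v \<noteq> 0 \<longrightarrow> P v"
    using assms unfolding eventually_zariski_generic generic_iff by blast
  have "\<forall>\<^sub>F v in zariski_generic M. P (splice N u v)" if "f u \<noteq> 0" for u
  proof -
    have "polyfun M (\<lambda>v. splice N u v k)" if "k < M" for k
      using that by (cases "k < N") (auto simp: splice_def intro: polyfun_coord polyfun_const)
    then have "polyfun M (\<lambda>v. f (splice N u v))"
      by (rule polyfun_compose[OF f_nonzero(1)])
    moreover have "splice N u u = u"
      by (simp add: splice_def fun_eq_iff)
    ultimately show ?thesis
      unfolding eventually_zariski_generic generic_iff using f_nonzero(3) that
      by (intro exI[of _ "\<lambda>v. f (splice N u v)"]) (auto intro: exI[of _ u])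
  qed
  then show ?thesis
    using f_nonzero
    unfolding eventually_zariski_generic generic_iff[of M "\<lambda>u. generic M (\<lambda>v. P (splice N u v))"]
    by blast
qed

section \<open>Semicontinuity of dimension\<close>

definition polyfam :: "nat \<Rightarrow> ((nat \<Rightarrow> 'k::comm_ring_1) \<Rightarrow> 'k mpoly) \<Rightarrow> bool" where
  "polyfam N W \<longleftrightarrow> (\<exists>X. finite X \<and> (\<forall>v. keys (W v) \<subseteq> X)) \<and> (\<forall>m. polyfun N (\<lambda>v. lookup (W v) m))"

lemma polyfam_const: "polyfam N (\<lambda>v. p)"
  unfolding polyfam_def by (intro conjI exI[of _ "keys p"]) (auto intro: polyfun_const)

lemma polyfam_single:
  assumes "polyfun N f"
  shows "polyfam N (\<lambda>v. single m (f v))"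
  unfolding polyfam_def
proof (intro conjI allI)
  show "\<exists>X. finite X \<and> (\<forall>v. keys (single m (f v)) \<subseteq> X)"
    by (rule exI[of _ "{m}"]) simp
  show "polyfun N (\<lambda>v. lookup (single m (f v)) m')" for m'
    using assms polyfun_const[of N 0] by (cases "m' = m") (simp_all add: lookup_single)
qed

lemma polyfam_coeff: "polyfun N f \<Longrightarrow> polyfam N (\<lambda>v. const (f v))"
  unfolding const_def by (rule polyfam_single)

lemma polyfam_add:
  assumes "polyfam N W" "polyfam N V"
  shows "polyfam N (\<lambda>v. W v + V v)"
  unfolding polyfam_def
proof (intro conjI allI)
  obtain X Y where "finite X" "\<And>v. keys (W v) \<subseteq> X" "finite Y" "\<And>v. keys (V v) \<subseteq> Y"
    using assms by (auto simp: polyfam_def)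
  then show "\<exists>Z. finite Z \<and> (\<forall>v. keys (W v + V v) \<subseteq> Z)"
    by (intro exI[of _ "X \<union> Y"]) (meson Poly_Mapping.keys_add Un_mono finite_UnI subset_trans)
  show "polyfun N (\<lambda>v. lookup (W v + V v) m)" for m
    using assms by (auto simp: polyfam_def lookup_add intro: polyfun_add)
qed

lemma polyfam_sum: "(\<And>a. a \<in> A \<Longrightarrow> polyfam N (f a)) \<Longrightarrow> polyfam N (\<lambda>v. \<Sum>a\<in>A. f a v)"
  by (induction A rule: infinite_finite_induct) (auto intro: polyfam_add polyfam_const)

lemma polyfam_mult:
  assumes "polyfam N W" "polyfam N V"
  shows "polyfam N (\<lambda>v. W v * V v)"
proof -
  obtain X Y where X_keys: "finite X" "\<And>v. keys (W v) \<subseteq> X" and Y_keys: "finite Y" "\<And>v. keys (V v) \<subseteq> Y"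
    using assms by (auto simp: polyfam_def)
  have expand: "(\<Sum>a\<in>A. single a (lookup p a)) = p" if "finite A" "keys p \<subseteq> A" for A and p :: "'a mpoly"
    by (subst (2) poly_mapping_sum_single) (intro sum.mono_neutral_right that; auto simp: in_keys_iff)
  have "W v * V v = (\<Sum>a\<in>X. single a (lookup (W v) a)) * (\<Sum>b\<in>Y. single b (lookup (V v) b))" for v
    using expand[OF X_keys] expand[OF Y_keys] by simp
  then have "W v * V v = (\<Sum>a\<in>X. \<Sum>b\<in>Y. single (a + b) (lookup (W v) a * lookup (V v) b))" for v
    by (simp add: sum_product Poly_Mapping.mult_single)
  moreover have "polyfam N (\<lambda>v. \<Sum>a\<in>X. \<Sum>b\<in>Y. single (a + b) (lookup (W v) a * lookup (V v) b))"
    using assms unfolding polyfam_def[of N W] polyfam_def[of N V]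
    by (intro polyfam_sum polyfam_single polyfun_mult) blast+
  ultimately show ?thesis
    by simp
qed

lemma polyfam_prod: "(\<And>a. a \<in> A \<Longrightarrow> polyfam N (f a)) \<Longrightarrow> polyfam N (\<lambda>v. \<Prod>a\<in>A. f a v)"
  by (induction A rule: infinite_finite_induct) (auto intro: polyfam_mult polyfam_const)

lemma polyfam_power: "polyfam N f \<Longrightarrow> polyfam N (\<lambda>v. f v ^ e)"
  by (induction e) (auto intro: polyfam_mult polyfam_const)

lemma polyfam_subst:
  assumes "p \<in> polyR n" "\<And>j. j < n \<Longrightarrow> polyfam N (\<lambda>v. \<sigma> v j)"
  shows "polyfam N (\<lambda>v. subst (\<sigma> v) p)"
  unfolding subst_def using assms(1)
  by (intro polyfam_sum polyfam_mult polyfam_prod polyfam_power polyfam_const assms(2))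
    (auto simp: polyR_def)

lemma polyfam_linform: "(\<And>l. l < n \<Longrightarrow> polyfun N (\<lambda>v. c v l)) \<Longrightarrow> polyfam N (\<lambda>v. linform n (c v))"
  unfolding linform_def by (intro polyfam_sum polyfam_mult polyfam_const polyfam_coeff) auto

lemma eventually_polyfun_neq_0: "polyfun N f \<Longrightarrow> f a \<noteq> 0 \<Longrightarrow> \<forall>\<^sub>F v in zariski_nhds N a. f v \<noteq> 0"
  unfolding eventually_zariski_nhds by blast

text \<open>One step of fraction-free Gaussian elimination; the pivot is the coefficient at \<open>x\<close> of \<open>W r\<close>.\<close>

lemma dim_eliminate:
  fixes W :: "'i \<Rightarrow> 'k::field mpoly"
  assumes "finite F" "lookup (W r) x \<noteq> 0"
  shows "mp.dim (W ` insert r F) =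
    Suc (mp.dim ((\<lambda>i. const (lookup (W r) x) * W i - const (lookup (W i) x) * W r) ` F))"
proof -
  let ?c = "lookup (W r) x"
  define V where "V = (\<lambda>i. const ?c * W i - const (lookup (W i) x) * W r)"
  have "V ` F \<subseteq> mp.span (W ` insert r F)"
    unfolding V_def by (auto intro!: mp.span_diff mp.span_scale intro: mp.span_base)
  moreover have "W i \<in> mp.span (insert (W r) (V ` F))" if "i \<in> F" for i
  proof -
    have "V i + const (lookup (W i) x) * W r \<in> mp.span (insert (W r) (V ` F))"
      using that by (intro mp.span_add mp.span_scale) (auto intro: mp.span_base)
    then have "const ?c * W i \<in> mp.span (insert (W r) (V ` F))"
      by (simp add: V_def)
    then show ?thesis
      using in_span_const_mult_iff[OF assms(2)] by blast
  qed
  ultimately have "mp.span (W ` insert r F) = mp.span (insert (W r) (V ` F))"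
    by (auto simp: mp.span_eq intro: mp.span_base)
  then have "mp.dim (W ` insert r F) = mp.dim (insert (W r) (V ` F))"
    by (rule mp.span_eq_dim)
  moreover have "W r \<notin> mp.span (V ` F)"
  proof -
    have "V ` F \<subseteq> {p. keys p \<subseteq> - {x}}"
      by (auto simp: V_def in_keys_iff lookup_minus)
    from mp.span_minimal[OF this subspace_keys_subset] show ?thesis
      using assms(2) by (auto simp: in_keys_iff)
  qed
  ultimately show ?thesis
    using assms(1) unfolding V_def[symmetric] by (simp add: mp.dim_insert_fin_dim mp.finite_imp_fin_dim)
qed

lemma dim_semicontinuous:
  fixes W :: "'i \<Rightarrow> (nat \<Rightarrow> 'k::field) \<Rightarrow> 'k mpoly"
  assumes "finite F" "\<And>i. i \<in> F \<Longrightarrow> polyfam N (W i)"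
  shows "\<forall>\<^sub>F v in zariski_nhds N a. mp.dim ((\<lambda>i. W i a) ` F) \<le> mp.dim ((\<lambda>i. W i v) ` F)"
  using assms
proof (induction F arbitrary: W rule: finite_induct)
  case (insert r F)
  show ?case
  proof (cases "W r a = 0")
    case True
    have "\<forall>\<^sub>F v in zariski_nhds N a. mp.dim ((\<lambda>i. W i a) ` F) \<le> mp.dim ((\<lambda>i. W i v) ` F)"
      using insert.IH insert.prems by blast
    moreover have "mp.dim ((\<lambda>i. W i a) ` insert r F) = mp.dim ((\<lambda>i. W i a) ` F)"
      using True by (intro mp.span_eq_dim) simp
    moreover have "mp.dim ((\<lambda>i. W i v) ` F) \<le> mp.dim ((\<lambda>i. W i v) ` insert r F)" for v
      using insert.hyps(1)
      by (intro mp.dim_le_of_subset_span mp.finite_imp_fin_dim) (auto intro: mp.span_base)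
    ultimately show ?thesis
      by (auto elim!: eventually_mono intro: order_trans)
  next
    case False
    then obtain x where pivot: "lookup (W r a) x \<noteq> 0"
      by (metis lookup_zero poly_mapping_eqI)
    let ?V = "\<lambda>i v. const (lookup (W r v) x) * W i v + const (- lookup (W i v) x) * W r v"
    have W_lookup: "polyfun N (\<lambda>v. lookup (W i v) x)" if "i \<in> insert r F" for i
      using insert.prems[OF that] by (simp add: polyfam_def)
    then have "polyfam N (?V i)" if "i \<in> F" for i
      using that insert.prems by (intro polyfam_add polyfam_mult polyfam_coeff polyfun_uminus) auto
    then have "\<forall>\<^sub>F v in zariski_nhds N a. mp.dim ((\<lambda>i. ?V i a) ` F) \<le> mp.dim ((\<lambda>i. ?V i v) ` F)"
      by (rule insert.IH)
    moreover have "\<forall>\<^sub>F v in zariski_nhds N a. lookup (W r v) x \<noteq> 0"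
      using W_lookup pivot by (intro eventually_polyfun_neq_0) auto
    moreover have "mp.dim ((\<lambda>i. W i v) ` insert r F) = Suc (mp.dim ((\<lambda>i. ?V i v) ` F))"
      if "lookup (W r v) x \<noteq> 0" for v
      using dim_eliminate[of F "\<lambda>i. W i v" r x] insert.hyps(1) that
      by (simp add: const_def Poly_Mapping.single_uminus)
    ultimately show ?thesis
      using pivot by (auto elim: eventually_elim2)
  qed
qed simp

lemma ex_polyfam_spanning_Un_image:
  fixes f :: "(nat \<Rightarrow> 'k::field) \<Rightarrow> 'k mpoly \<Rightarrow> 'k mpoly"
  assumes lin: "\<And>v. mpoly_linear (f v)" and poly: "\<And>p. p \<in> S \<Longrightarrow> polyfam N (\<lambda>v. f v p)"
    and fin: "mp.fin_dim A" "mp.fin_dim S"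
  obtains F :: "('k mpoly + 'k mpoly) set" and W where "finite F" "\<And>i. i \<in> F \<Longrightarrow> polyfam N (W i)"
    "\<And>v. mp.span ((\<lambda>i. W i v) ` F) = mp.span (A \<union> f v ` S)"
proof -
  obtain B where B_basis: "B \<subseteq> A" "finite B" "mp.span B = mp.span A"
    using mp.fin_dim_basis[OF fin(1)] by metis
  obtain T where T_basis: "T \<subseteq> S" "finite T" "mp.span T = mp.span S"
    using mp.fin_dim_basis[OF fin(2)] by metis
  define W where "W = (\<lambda>i v. case i of Inl p \<Rightarrow> p | Inr p \<Rightarrow> f v p)"
  have "mp.span ((\<lambda>i. W i v) ` (B <+> T)) = mp.span (A \<union> f v ` S)" for v
  proof -
    interpret f: Vector_Spaces.linear "\<lambda>(c::'k) p. const c * p" "\<lambda>c p. const c * p" "f v"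
      by (rule lin)
    have "(\<lambda>i. W i v) ` (B <+> T) = B \<union> f v ` T"
      by (force simp: W_def Plus_def)
    then show ?thesis
      by (simp add: mp.span_Un f.span_image B_basis(3) T_basis(3))
  qed
  moreover have "polyfam N (W i)" if "i \<in> B <+> T" for i
    using that poly T_basis(1) by (auto simp: W_def intro: polyfam_const)
  ultimately show ?thesis
    using that[of "B <+> T" W] B_basis(2) T_basis(2) by simp
qed

lemma dim_Un_image_semicontinuous:
  fixes f :: "(nat \<Rightarrow> 'k::field) \<Rightarrow> 'k mpoly \<Rightarrow> 'k mpoly"
  assumes "\<And>v. mpoly_linear (f v)" "\<And>p. p \<in> S \<Longrightarrow> polyfam N (\<lambda>v. f v p)" "mp.fin_dim A" "mp.fin_dim S"
  shows "\<forall>\<^sub>F v in zariski_nhds N a. mp.dim (A \<union> f a ` S) \<le> mp.dim (A \<union> f v ` S)"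
proof -
  obtain F :: "('k mpoly + 'k mpoly) set" and W where "finite F" "\<And>i. i \<in> F \<Longrightarrow> polyfam N (W i)"
    and span: "\<And>v. mp.span ((\<lambda>i. W i v) ` F) = mp.span (A \<union> f v ` S)"
    using ex_polyfam_spanning_Un_image[of f S N A, OF assms] by blast
  then show ?thesis
    using dim_semicontinuous[of F N W a] mp.span_eq_dim[OF span] by simp
qed

lemma in_span_specialization:
  fixes f :: "(nat \<Rightarrow> 'k::field_char_0) \<Rightarrow> 'k mpoly \<Rightarrow> 'k mpoly"
  assumes "\<And>v. mpoly_linear (f v)" "\<And>p. p \<in> S \<Longrightarrow> polyfam N (\<lambda>v. f v p)" "mp.fin_dim A" "mp.fin_dim S"
    and q_polyfam: "polyfam N q"
    and dim: "\<forall>\<^sub>F v in zariski_generic N. mp.dim (A \<union> f v ` S) \<le> mp.dim (A \<union> f a ` S)"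
    and in_span: "\<forall>\<^sub>F v in zariski_generic N. q v \<in> mp.span (A \<union> f v ` S)"
  shows "q a \<in> mp.span (A \<union> f a ` S)"
proof -
  obtain F :: "('k mpoly + 'k mpoly) set" and W where fin: "finite F"
    and poly: "\<And>i. i \<in> F \<Longrightarrow> polyfam N (W i)"
    and span: "\<And>v. mp.span ((\<lambda>i. W i v) ` F) = mp.span (A \<union> f v ` S)"
    using ex_polyfam_spanning_Un_image[of f S N A, OF assms(1-4)] by blast
  let ?X = "\<lambda>v. (\<lambda>i. W i v) ` F"
  have insert_eq: "(\<lambda>i. case_option q W i v) ` insert None (Some ` F) = insert (q v) (?X v)" for v
    by force
  have "polyfam N (case_option q W i)" if "i \<in> insert None (Some ` F)" for i
    using that poly q_polyfam by auto
  then have "\<forall>\<^sub>F v in zariski_nhds N a. mp.dim (insert (q a) (?X a)) \<le> mp.dim (insert (q v) (?X v))"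
    using dim_semicontinuous[of "insert None (Some ` F)" N "case_option q W" a] fin
    unfolding insert_eq by blast
  then have "\<forall>\<^sub>F v in zariski_generic N. mp.dim (insert (q a) (?X a)) \<le> mp.dim (insert (q v) (?X v))"
    by (rule eventually_nhds_imp_generic)
  with dim in_span
  have "\<forall>\<^sub>F v :: nat \<Rightarrow> 'k in zariski_generic N. mp.dim (insert (q a) (?X a)) \<le> mp.dim (?X a)"
  proof eventually_elim
    case (elim v)
    then show ?case
      using mp.dim_insert_fin_dim[OF mp.finite_imp_fin_dim, of "?X v" "q v"] fin
        mp.span_eq_dim[OF span[of v]] mp.span_eq_dim[OF span[of a]]
      by (simp add: span)
  qed
  then have "mp.dim (insert (q a) (?X a)) \<le> mp.dim (?X a)"
    by simp
  then have "q a \<in> mp.span (?X a)"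
    using fin mp.dim_insert_fin_dim[OF mp.finite_imp_fin_dim, of "?X a" "q a"]
    by (auto split: if_splits)
  then show ?thesis
    by (simp add: span)
qed

section \<open>Initial monomials of homogeneous ideals\<close>

lemma is_ideal_polyR: "is_ideal n J \<Longrightarrow> p \<in> J \<Longrightarrow> p \<in> polyR n"
  by (auto simp: is_ideal_def)

lemma is_ideal_mult: "is_ideal n J \<Longrightarrow> r \<in> polyR n \<Longrightarrow> p \<in> J \<Longrightarrow> r * p \<in> J"
  by (simp add: is_ideal_def)

lemma is_ideal_subspace: "is_ideal n J \<Longrightarrow> mp.subspace J"
  by (rule mp.subspaceI) (auto simp: is_ideal_def)

lemma is_ideal_diff: "is_ideal n (J :: 'k::field mpoly set) \<Longrightarrow> p \<in> J \<Longrightarrow> q \<in> J \<Longrightarrow> p - q \<in> J"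
  by (rule mp.subspace_diff[OF is_ideal_subspace])

lemma is_ideal_scale: "is_ideal n (J :: 'k::field mpoly set) \<Longrightarrow> p \<in> J \<Longrightarrow> const c * p \<in> J"
  by (rule mp.subspace_scale[OF is_ideal_subspace])

lemma subspace_ideal_forms: "is_ideal n J \<Longrightarrow> mp.subspace (J \<inter> forms n d)"
  by (intro mp.subspace_inter is_ideal_subspace subspace_forms)

lemma span_ideal_forms: "is_ideal n J \<Longrightarrow> mp.span (J \<inter> forms n d) = J \<inter> forms n d"
  by (simp add: subspace_ideal_forms)

lemma init_mons_vars: "m \<in> init_mons n J \<Longrightarrow> keys m \<subseteq> {..<n}"
  by (simp add: init_mons_def)

lemma init_mons_add:
  assumes "m \<in> init_mons n J" "keys q \<subseteq> {..<n}"
  shows "m + q \<in> init_mons n J"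
  using assms unfolding init_mons_def mon_dvd_def by (auto simp: keys_add_mon add.assoc)

lemma lm_in_init_mons:
  assumes "is_ideal n J" "p \<in> J" "p \<noteq> 0"
  shows "lm p \<in> init_mons n J"
  using assms lm_in_keys[of p] is_ideal_polyR[of n J p] unfolding init_mons_def
  by (auto simp: polyR_def mon_dvd_iff)

lemma keys_minus_monomial_subset_below:
  fixes p :: "'k::comm_ring_1 mpoly"
  assumes "keys (p - single m 1) \<subseteq> below n m"
  shows "lookup p m = 1" "m' \<in> keys p \<Longrightarrow> m' \<noteq> m \<Longrightarrow> m' \<in> below n m"
proof -
  have "m \<notin> keys (p - single m 1)"
    using assms by (auto simp: below_def)
  then show "lookup p m = 1"
    by (simp add: in_keys_iff lookup_minus)
  assume "m' \<in> keys p" "m' \<noteq> m"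
  then have "m' \<in> keys (p - single m 1)"
    by (simp add: in_keys_iff lookup_minus lookup_single)
  then show "m' \<in> below n m"
    using assms by blast
qed

lemma lm_of_keys_minus_monomial:
  fixes p :: "'k::comm_ring_1 mpoly"
  assumes "keys (p - single m 1) \<subseteq> below n m"
  shows "lm p = m" "p \<noteq> 0"
proof -
  note lead = keys_minus_monomial_subset_below[OF assms]
  show "lm p = m"
    using lead by (intro lm_eqI) (auto simp: in_keys_iff below_def)
  show "p \<noteq> 0"
    using lead(1) by auto
qed

lemma keys_subset_below:
  fixes p :: "'k::comm_ring_1 mpoly"
  assumes "keys (p - single m 1) \<subseteq> below n m" "keys p \<subseteq> monomials n (mdeg m')" "mon_gt m' m"
  shows "keys p \<subseteq> below n m'"
proof
  fix q assume "q \<in> keys p"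
  then have "q = m \<or> mon_gt m q"
    using keys_minus_monomial_subset_below(2)[OF assms(1)] by (auto simp: below_def)
  then show "q \<in> below n m'"
    using assms(2,3) mon_gt_trans[of m' m q] \<open>q \<in> keys p\<close> by (auto simp: below_def)
qed

lemma init_mons_imp_monic_form:
  fixes J :: "'k::field mpoly set"
  assumes ideal_J: "is_ideal n J" "homogeneous_ideal J" and m_init: "m \<in> init_mons n J"
  obtains p where "p \<in> J \<inter> forms n (mdeg m)" "keys (p - single m 1) \<subseteq> below n m"
proof -
  obtain f q where f_mem: "f \<in> J" "f \<noteq> 0" and mult: "m = lm f + q"
    using m_init by (auto simp: init_mons_def mon_dvd_def)
  define c where "c = lookup f (lm f)"
  define p where "p = const (inverse c) * homog_comp (mdeg m) (single q 1 * f)"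
  have "keys q \<subseteq> {..<n}"
    using init_mons_vars[OF m_init] unfolding mult keys_add_mon by blast
  then have "single q 1 * f \<in> J"
    using f_mem(1) by (intro is_ideal_mult[OF ideal_J(1)] polyR_single)
  then have p_form: "p \<in> J \<inter> forms n (mdeg m)"
    unfolding p_def using ideal_J
    by (auto simp: homogeneous_ideal_def
        intro: is_ideal_scale forms_scale homog_comp_in_forms is_ideal_polyR)
  have "mon_gt m m'" if "m' \<in> keys p" "m' \<noteq> m" for m'
  proof -
    have "m' \<in> keys (single q 1 * f)"
      using that(1) by (auto simp: p_def in_keys_iff lookup_homog_comp split: if_splits)
    then obtain a where a_key: "a \<in> keys f" "m' = q + a"
      by (auto simp: keys_single_mult)
    then have "a \<noteq> lm f"
      using that(2) mult by (metis add.commute)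
    then have "mon_gt (q + lm f) (q + a)"
      using mon_gt_lm[OF a_key(1)] by simp
    then show ?thesis
      using a_key(2) mult by (metis add.commute)
  qed
  moreover have "lookup p m = 1"
    using lm_in_keys[OF f_mem(2)] lookup_single_mult[of q f "lm f"]
    by (simp add: p_def lookup_homog_comp mult add.commute c_def in_keys_iff)
  ultimately have "keys (p - single m 1) \<subseteq> below n m"
    using p_form
    by (auto simp: below_def forms_iff_keys in_keys_iff lookup_minus lookup_single when_def
        split: if_splits)
  with p_form show ?thesis
    by (rule that)
qed

lemma init_mons_iff:
  fixes J :: "'k::field mpoly set"
  assumes ideal_J: "is_ideal n J" "homogeneous_ideal J"
  shows "m \<in> init_mons n J \<longleftrightarrow>
    keys m \<subseteq> {..<n} \<and> (\<exists>p \<in> J \<inter> forms n (mdeg m). keys (p - single m 1) \<subseteq> below n m)"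
proof
  assume "m \<in> init_mons n J"
  then show "keys m \<subseteq> {..<n} \<and> (\<exists>p \<in> J \<inter> forms n (mdeg m). keys (p - single m 1) \<subseteq> below n m)"
    using init_mons_vars init_mons_imp_monic_form[OF ideal_J] by metis
next
  assume "keys m \<subseteq> {..<n} \<and> (\<exists>p \<in> J \<inter> forms n (mdeg m). keys (p - single m 1) \<subseteq> below n m)"
  then obtain p where "p \<in> J" "keys (p - single m 1) \<subseteq> below n m"
    by blast
  then show "m \<in> init_mons n J"
    using lm_in_init_mons[OF ideal_J(1)] lm_of_keys_minus_monomial by metis
qed

lemma init_mons_iff_span:
  fixes J :: "'k::field mpoly set"
  assumes ideal_J: "is_ideal n J" "homogeneous_ideal J" and m_degree: "m \<in> monomials n d"
  shows "m \<in> init_mons n J \<longleftrightarrow> single m 1 \<in> mp.span (J \<inter> forms n d \<union> mon_polys (below n m))"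
proof -
  have "single m 1 \<in> mp.span (J \<inter> forms n d \<union> mon_polys (below n m)) \<longleftrightarrow>
      (\<exists>p q. single m 1 = p + q \<and> p \<in> J \<inter> forms n d \<and> q \<in> mp.span (mon_polys (below n m)))"
    by (simp only: mp.span_Un span_ideal_forms[OF ideal_J(1)] mem_Collect_eq)
  also have "\<dots> \<longleftrightarrow> (\<exists>p \<in> J \<inter> forms n d. single m 1 - p \<in> mp.span (mon_polys (below n m)))"
  proof -
    have "single m 1 = p + q \<longleftrightarrow> q = single m 1 - p" for p q :: "'k mpoly"
      by (auto simp: algebra_simps)
    then show ?thesis
      by simp blast
  qed
  also have "\<dots> \<longleftrightarrow> (\<exists>p \<in> J \<inter> forms n d. keys (p - single m 1) \<subseteq> below n m)"
    unfolding in_span_mon_polys_iff by (metis keys_minus minus_diff_eq)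
  also have "\<dots> \<longleftrightarrow> m \<in> init_mons n J"
    using init_mons_iff[OF ideal_J] m_degree by (simp add: monomials_def)
  finally show ?thesis ..
qed

definition augmented_dim :: "nat \<Rightarrow> 'k::field mpoly set \<Rightarrow> nat \<Rightarrow> mon set \<Rightarrow> nat" where
  "augmented_dim n J d M = mp.dim (J \<inter> forms n d \<union> mon_polys M)"

lemma init_mons_iff_augmented_dim:
  assumes ideal_J: "is_ideal n J" "homogeneous_ideal J" and m_degree: "m \<in> monomials n d"
  shows "m \<in> init_mons n J \<longleftrightarrow>
      augmented_dim n J d (insert m (below n m)) = augmented_dim n J d (below n m)"
proof -
  have "mp.fin_dim (J \<inter> forms n d \<union> mon_polys (below n m))"
    by (intro mp.fin_dim_Un fin_dim_subset_forms[of _ n d] mp.finite_imp_fin_dim)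
      (auto simp: finite_below)
  then show ?thesis
    unfolding init_mons_iff_span[OF ideal_J m_degree] augmented_dim_def
    by (simp add: mp.dim_insert_fin_dim)
qed

lemma ex_normal_form:
  fixes J :: "'k::field mpoly set"
  assumes ideal_J: "is_ideal n J" "homogeneous_ideal J" and p_form: "p \<in> forms n d"
  obtains r where "r \<in> forms n d" "keys r \<inter> init_mons n J = {}" "p - r \<in> J"
proof -
  let ?S = "monomials n d - init_mons n J"
  let ?X = "J \<union> mon_polys ?S"
  let ?bad = "{m \<in> monomials n d. single m 1 \<notin> mp.span ?X}"
  have "?bad = {}"
  proof (rule ccontr)
    assume "?bad \<noteq> {}"
    moreover have "finite ?bad"
      by (simp add: finite_monomials)
    ultimately obtain m where least_bad: "m \<in> ?bad" "\<And>m'. m' \<in> ?bad \<Longrightarrow> m = m' \<or> mon_gt m' m"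
      using revlex.Min_in[of ?bad] revlex.Min_le[of ?bad] by blast
    then have "m \<in> init_mons n J"
      using mp.span_base[of "single m 1" ?X] by blast
    then obtain f where f_lead: "f \<in> J" "keys (f - single m 1) \<subseteq> below n m"
      using init_mons_iff[OF ideal_J] by blast
    have "single m' 1 \<in> mp.span ?X" if "m' \<in> below n m" for m'
      using that least_bad mon_gt_trans[of m m' m] by (auto simp: below_def monomials_def)
    then have "(\<Sum>m'\<in>keys (f - single m 1). const (lookup (f - single m 1) m') * single m' 1)
        \<in> mp.span ?X"
      using f_lead(2) by (intro mp.span_sum mp.span_scale) blast
    then have tail: "f - single m 1 \<in> mp.span ?X"
      by (simp flip: poly_mapping_sum_single)
    have "f \<in> mp.span ?X"
      using f_lead(1) by (simp add: mp.span_base)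
    from mp.span_diff[OF this tail] show False
      using least_bad(1) by simp
  qed
  then have "mon_polys (monomials n d) \<subseteq> mp.span ?X"
    by blast
  from mp.span_minimal[OF this mp.subspace_span] have "p \<in> mp.span ?X"
    using p_form by (auto simp: forms_eq_span)
  then obtain q r where "p = q + r" "q \<in> J" "keys r \<subseteq> ?S"
    using mp.span_eq_iff[THEN iffD2, OF is_ideal_subspace[OF ideal_J(1)]]
    by (auto simp: mp.span_Un in_span_mon_polys_iff)
  then show ?thesis
    using that[of r] by (auto simp: forms_iff_keys)
qed

section \<open>Linear changes of coordinates\<close>

abbreviation act :: "nat \<Rightarrow> (nat \<Rightarrow> 'k::comm_ring_1) \<Rightarrow> 'k mpoly \<Rightarrow> 'k mpoly" where
  "act n v \<equiv> subst (gsubst n v)"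

lemma gsubst_in_forms: "j < n \<Longrightarrow> gsubst n v j \<in> forms n 1"
  by (simp add: gsubst_eq_linform linform_in_forms del: One_nat_def)

lemma act_polyR: "p \<in> polyR n \<Longrightarrow> act n v p \<in> polyR n"
  by (rule polyR_subst) (auto intro: forms_polyR gsubst_in_forms)

lemma act_forms: "p \<in> forms n d \<Longrightarrow> act n v p \<in> forms n d"
  by (rule forms_subst[OF _ gsubst_in_forms])

lemma homog_comp_act:
  assumes "p \<in> polyR n"
  shows "homog_comp d (act n v p) = act n v (homog_comp d p)"
proof -
  have "act n v p = (\<Sum>i\<in>mdeg ` keys p. act n v (homog_comp i p))"
    by (subst (1) poly_eq_sum_homog_comp[of p]) (rule subst_sum)
  also have "homog_comp d \<dots> = (\<Sum>i\<in>mdeg ` keys p. act n v (homog_comp d (homog_comp i p)))"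
    unfolding homog_comp_sum using homog_comp_forms[OF act_forms[OF homog_comp_in_forms[OF assms]]]
      homog_comp_forms[OF homog_comp_in_forms[OF assms]]
    by (intro sum.cong) simp_all
  also have "\<dots> = act n v (homog_comp d p)"
    using arg_cong[OF poly_eq_sum_homog_comp[of p], of "homog_comp d"]
    unfolding homog_comp_sum subst_sum[symmetric] by simp
  finally show ?thesis .
qed

lemma matrix_index_less:
  assumes "l < n" "j < (i :: nat)"
  shows "j * n + l < n * i"
proof -
  have "j * n + l < Suc j * n"
    using assms(1) by simp
  also have "\<dots> \<le> i * n"
    using assms(2) by (intro mult_le_mono1) simp
  finally show ?thesis
    by (simp add: mult.commute)
qed

lemma polyfam_act: "p \<in> polyR n \<Longrightarrow> polyfam (n * n) (\<lambda>v. act n v p)"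
  by (rule polyfam_subst)
    (auto simp: gsubst_eq_linform intro!: polyfam_linform polyfun_coord matrix_index_less)

lemma act_linform: "act n v (linform n c) = linform n (\<lambda>l. \<Sum>j<n. v (l * n + j) * c j)"
proof -
  have "act n v (linform n c) = (\<Sum>j<n. \<Sum>l<n. const (v (l * n + j) * c j) * Var l)"
    unfolding subst_linform
    by (intro sum.cong) (auto simp: gsubst_def sum_distrib_left const_mult mult_ac)
  also have "\<dots> = (\<Sum>l<n. \<Sum>j<n. const (v (l * n + j) * c j) * Var l)"
    by (rule sum.swap)
  finally show ?thesis
    by (simp add: linform_def sum_distrib_right const_sum)
qed

lemma mat_invertible_iff: "mat_invertible n v \<longleftrightarrow> (\<forall>p\<in>forms n 1. act n v p = 0 \<longrightarrow> p = 0)"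
proof -
  have linform_eq_0: "linform n a = 0 \<longleftrightarrow> (\<forall>l<n. a l = 0)" for a :: "nat \<Rightarrow> 'a"
  proof
    assume "linform n a = 0"
    then show "\<forall>l<n. a l = 0"
      using lookup_linform[of n a] by (metis lookup_zero)
  qed (simp add: linform_def)
  have "(\<forall>p\<in>forms n 1. act n v p = 0 \<longrightarrow> p = 0) \<longleftrightarrow> (\<forall>c. act n v (linform n c) = 0 \<longrightarrow> linform n c = 0)"
    using forms_1_eq_linform linform_in_forms by metis
  then show ?thesis
    by (simp add: mat_invertible_def act_linform linform_eq_0)
qed

lemma mat_invertible_iff_dim:
  fixes v :: "nat \<Rightarrow> 'k::field"
  shows "mat_invertible n v \<longleftrightarrow> mp.dim (forms n 1 :: 'k mpoly set) \<le> mp.dim (act n v ` forms n 1)"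
proof -
  let ?K = "{p \<in> forms n 1. act n v p \<in> {0}}"
  have "mp.dim ?K + mp.dim ({0} \<union> act n v ` forms n 1) =
      mp.dim (forms n 1 :: 'k mpoly set) + mp.dim {0 :: 'k mpoly}"
    by (intro mp.dim_linear_preimage mpoly_linear_subst subspace_forms fin_dim_forms
        mp.subspace_single_0 mp.finite_imp_fin_dim) simp
  moreover have "mp.dim {0 :: 'k mpoly} = 0"
    using mp.dim_eq_0_iff[OF mp.finite_imp_fin_dim, of "{0}"] by simp
  moreover have "mp.dim ({0} \<union> act n v ` forms n 1) = mp.dim (act n v ` forms n 1)"
    by (intro mp.span_eq_dim) simp
  ultimately have "mp.dim (forms n 1 :: 'k mpoly set) \<le> mp.dim (act n v ` forms n 1) \<longleftrightarrow> mp.dim ?K = 0"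
    by arith
  also have "\<dots> \<longleftrightarrow> ?K \<subseteq> {0}"
    using mp.dim_eq_0_iff[OF fin_dim_subset_forms[of ?K n 1]] by blast
  finally show ?thesis
    unfolding mat_invertible_iff by blast
qed

lemma eventually_mat_invertible:
  fixes a :: "nat \<Rightarrow> 'k::field"
  assumes "mat_invertible n a"
  shows "\<forall>\<^sub>F v in zariski_nhds (n * n) a. mat_invertible n v"
proof -
  have "\<forall>\<^sub>F v in zariski_nhds (n * n) a.
      mp.dim ({} \<union> act n a ` forms n 1) \<le> mp.dim ({} \<union> act n v ` forms n 1)"
    by (intro dim_Un_image_semicontinuous mpoly_linear_subst fin_dim_forms mp.finite_imp_fin_dim)
      (auto intro: polyfam_act forms_polyR)
  then show ?thesis
    by (rule eventually_mono) (use assms in \<open>simp add: mat_invertible_iff_dim\<close>)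
qed

definition inverse_pair :: "nat \<Rightarrow> (nat \<Rightarrow> 'k::comm_ring_1) \<Rightarrow> (nat \<Rightarrow> 'k) \<Rightarrow> bool" where
  "inverse_pair n v w \<longleftrightarrow> (\<forall>p\<in>polyR n. act n v (act n w p) = p \<and> act n w (act n v p) = p)"

lemma inverse_pairD:
  assumes "inverse_pair n v w" "p \<in> polyR n"
  shows "act n v (act n w p) = p" "act n w (act n v p) = p"
  using assms by (auto simp: inverse_pair_def)

lemma inverse_pair_sym: "inverse_pair n v w \<Longrightarrow> inverse_pair n w v"
  by (auto simp: inverse_pair_def)

lemma inverse_pair_imp_mat_invertible:
  assumes "inverse_pair n v w"
  shows "mat_invertible n v"
  unfolding mat_invertible_iff using inverse_pairD(2)[OF assms] forms_polyR by fastforce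

lemma ex_inverse_pair:
  fixes v :: "nat \<Rightarrow> 'k::field"
  assumes "mat_invertible n v"
  obtains w where "inverse_pair n v w"
proof -
  interpret act: Vector_Spaces.linear "\<lambda>(c::'k) p. const c * p" "\<lambda>c p. const c * p" "act n v"
    by (rule mpoly_linear_subst)
  have "act n v ` forms n 1 \<subseteq> mp.span (forms n 1)"
    using act_forms mp.span_superset by blast
  then have "forms n 1 \<subseteq> mp.span (act n v ` forms n 1)"
    using assms mp.dim_le_iff_subset_span[OF fin_dim_forms] unfolding mat_invertible_iff_dim by blast
  then have surj: "forms n 1 \<subseteq> act n v ` forms n 1"
    by (simp add: act.span_image)
  have "\<exists>c. act n v (linform n c) = Var j" if "j < n" for j
    using subsetD[OF surj forms_Var[OF that]] forms_1_eq_linform by (metis imageE)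
  then obtain c where preimage: "\<And>j. j < n \<Longrightarrow> act n v (linform n (c j)) = Var j"
    by metis
  define w where "w = (\<lambda>k. c (k mod n) (k div n))"
  have act_vw: "act n v (gsubst n w j) = Var j" if "j < n" for j
    using preimage[OF that] that by (simp add: gsubst_eq_linform w_def cong: linform_cong)
  have act_wv: "act n w (gsubst n v j) = Var j" if j_less: "j < n" for j
  proof -
    have "act n v (act n w (gsubst n v j)) = gsubst n v j"
      unfolding subst_subst by (rule subst_id[OF forms_polyR[OF gsubst_in_forms[OF j_less]] act_vw])
    then have "act n v (act n w (gsubst n v j) - Var j) = 0"
      by (simp add: subst_diff)
    moreover have "act n w (gsubst n v j) - Var j \<in> forms n 1"
      using j_less by (intro forms_diff act_forms gsubst_in_forms forms_Var)
    ultimately show ?thesis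
      using assms unfolding mat_invertible_iff by fastforce
  qed
  have "inverse_pair n v w"
    unfolding inverse_pair_def subst_subst using act_vw act_wv by (auto intro!: subst_id)
  then show ?thesis
    by (rule that)
qed

lemma act_image_forms:
  fixes v :: "nat \<Rightarrow> 'k::field"
  assumes "mat_invertible n v"
  shows "act n v ` forms n d = forms n d"
proof
  obtain w where inverse: "inverse_pair n v w"
    by (rule ex_inverse_pair[OF assms])
  show "forms n d \<subseteq> act n v ` forms n d"
    using inverse_pairD(1)[OF inverse] act_forms forms_polyR by (metis image_eqI subsetI)
qed (use act_forms in blast)

lemma gact_iff:
  assumes "inverse_pair n v w" "is_ideal n I"
  shows "p \<in> gact n v I \<longleftrightarrow> p \<in> polyR n \<and> act n w p \<in> I"
proof
  assume "p \<in> gact n v I"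
  then show "p \<in> polyR n \<and> act n w p \<in> I"
    using inverse_pairD(2)[OF assms(1)] is_ideal_polyR[OF assms(2)]
    by (auto simp: gact_def intro: act_polyR)
next
  assume "p \<in> polyR n \<and> act n w p \<in> I"
  then show "p \<in> gact n v I"
    using inverse_pairD(1)[OF assms(1)] unfolding gact_def by (metis imageI)
qed

lemma act_in_gact_iff:
  fixes v :: "nat \<Rightarrow> 'k::field"
  assumes "mat_invertible n v" "is_ideal n I" "p \<in> polyR n"
  shows "act n v p \<in> gact n v I \<longleftrightarrow> p \<in> I"
proof -
  obtain w where "inverse_pair n v w"
    by (rule ex_inverse_pair[OF assms(1)])
  then show ?thesis
    using assms(2,3) by (simp add: gact_iff inverse_pairD act_polyR)
qed

lemma is_ideal_gact:
  fixes v :: "nat \<Rightarrow> 'k::field"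
  assumes "mat_invertible n v" "is_ideal n I"
  shows "is_ideal n (gact n v I)"
proof -
  obtain w where "inverse_pair n v w"
    by (rule ex_inverse_pair[OF assms(1)])
  note gact_iff = gact_iff[OF this assms(2)]
  show ?thesis
    using assms(2) unfolding is_ideal_def
    by (auto simp: gact_iff subst_add subst_mult polyR_add polyR_mult act_polyR)
qed

lemma homogeneous_gact:
  fixes v :: "nat \<Rightarrow> 'k::field"
  assumes "mat_invertible n v" "is_ideal n I" "homogeneous_ideal I"
  shows "homogeneous_ideal (gact n v I)"
proof -
  obtain w where "inverse_pair n v w"
    by (rule ex_inverse_pair[OF assms(1)])
  note gact_iff = gact_iff[OF this assms(2)]
  show ?thesis
    using assms(3) homog_comp_in_forms forms_polyR
    by (fastforce simp: homogeneous_ideal_def gact_iff homog_comp_act[symmetric])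
qed

lemma gact_Int_forms:
  fixes v :: "nat \<Rightarrow> 'k::field"
  assumes "mat_invertible n v" "is_ideal n I"
  shows "gact n v I \<inter> forms n d = act n v ` (I \<inter> forms n d)"
proof
  show "act n v ` (I \<inter> forms n d) \<subseteq> gact n v I \<inter> forms n d"
    by (auto simp: gact_def act_forms)
  show "gact n v I \<inter> forms n d \<subseteq> act n v ` (I \<inter> forms n d)"
  proof
    fix p assume "p \<in> gact n v I \<inter> forms n d"
    moreover from this obtain q where "q \<in> forms n d" "p = act n v q"
      using act_image_forms[OF assms(1)] by blast
    ultimately show "p \<in> act n v ` (I \<inter> forms n d)"
      using act_in_gact_iff[OF assms forms_polyR] by blast
  qed
qed

lemma augmented_dim_gact_inverse:
  fixes v :: "nat \<Rightarrow> 'k::field"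
  assumes "inverse_pair n v w" "is_ideal n I" "M \<subseteq> monomials n d"
  shows "augmented_dim n (gact n v I) d M = mp.dim (I \<inter> forms n d \<union> act n w ` mon_polys M)"
proof -
  let ?A = "gact n v I \<inter> forms n d \<union> mon_polys M"
  have sub: "?A \<subseteq> forms n d"
    using assms(3) by (auto intro: forms_single)
  have "act n v (act n w p) = p" "act n w (act n v p) = p" if "p \<in> forms n d" for p
    using inverse_pairD[OF assms(1) forms_polyR[OF that]] by auto
  then have "act n w ` act n v ` (I \<inter> forms n d) = I \<inter> forms n d"
    and "inj_on (act n w) (forms n d)"
    by (force simp: image_image, metis inj_on_inverseI)
  moreover from this(2) have "inj_on (act n w) (mp.span ?A)"
    using mp.span_minimal[OF sub subspace_forms] inj_on_subset by blast
  ultimately show ?thesis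
    using mp.dim_image_inj[OF mpoly_linear_subst, of "gsubst n w" ?A]
      gact_Int_forms[OF inverse_pair_imp_mat_invertible[OF assms(1)] assms(2)]
    by (simp add: augmented_dim_def image_Un)
qed

lemma augmented_dim_gact_eq:
  fixes v :: "nat \<Rightarrow> 'k::field"
  assumes "mat_invertible n v" "is_ideal n I"
  shows "augmented_dim n (gact n v I) d M = mp.dim (mon_polys M \<union> act n v ` (I \<inter> forms n d))"
  using gact_Int_forms[OF assms] by (simp add: augmented_dim_def Un_commute)

lemma eventually_augmented_dim_ge:
  fixes a :: "nat \<Rightarrow> 'k::field"
  assumes "mat_invertible n a" "is_ideal n I" "M \<subseteq> monomials n d"
  shows "\<forall>\<^sub>F v in zariski_nhds (n * n) a. mat_invertible n v \<and>
    augmented_dim n (gact n a I) d M \<le> augmented_dim n (gact n v I) d M"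
proof -
  have "\<forall>\<^sub>F v in zariski_nhds (n * n) a.
      mp.dim (mon_polys M \<union> act n a ` (I \<inter> forms n d)) \<le>
      mp.dim (mon_polys M \<union> act n v ` (I \<inter> forms n d))"
    using assms(3)
    by (intro dim_Un_image_semicontinuous mpoly_linear_subst fin_dim_subset_forms[of _ n d])
      (auto intro: polyfam_act forms_polyR forms_single)
  with eventually_mat_invertible[OF assms(1)] show ?thesis
    by eventually_elim (simp add: augmented_dim_gact_eq assms(1,2))
qed

lemma eventually_augmented_dim_ge_inverse:
  fixes a :: "nat \<Rightarrow> 'k::field"
  assumes "inverse_pair n a b" "is_ideal n I" "M \<subseteq> monomials n d"
  shows "\<forall>\<^sub>F w in zariski_nhds (n * n) b. mat_invertible n w \<and> (\<forall>v. inverse_pair n v w \<longrightarrow>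
    augmented_dim n (gact n a I) d M \<le> augmented_dim n (gact n v I) d M)"
proof -
  have invertible: "mat_invertible n b"
    using inverse_pair_sym[OF assms(1)] by (rule inverse_pair_imp_mat_invertible)
  have "\<forall>\<^sub>F w in zariski_nhds (n * n) b.
      mp.dim (I \<inter> forms n d \<union> act n b ` mon_polys M) \<le> mp.dim (I \<inter> forms n d \<union> act n w ` mon_polys M)"
    using assms(3)
    by (intro dim_Un_image_semicontinuous mpoly_linear_subst fin_dim_subset_forms[of _ n d])
      (auto intro: polyfam_act forms_polyR forms_single)
  with eventually_mat_invertible[OF invertible] show ?thesis
  proof eventually_elim
    case (elim w)
    then show ?case
      using augmented_dim_gact_inverse[OF assms] augmented_dim_gact_inverse[OF _ assms(2,3)] by metis
  qed
qed

section \<open>The generic initial ideal\<close>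

locale artinian_ideal =
  fixes n :: nat and I :: "'k::field_char_0 mpoly set"
  assumes ideal: "is_ideal n I" and homogeneous: "homogeneous_ideal I" and artinian: "artinian n I"
begin

lemma ex_forms_subset_bound: "\<exists>D. \<forall>d\<ge>D. forms n d \<subseteq> I"
proof -
  obtain B where B_spanning: "finite B" "\<And>p. p \<in> polyR n \<Longrightarrow> \<exists>c. p - (\<Sum>b\<in>B. const (c b) * b) \<in> I"
    using artinian by (auto simp: artinian_def)
  define D where "D = Suc (Max (insert 0 (mdeg ` (\<Union>b\<in>B. keys b))))"
  have less: "mdeg m < D" if "b \<in> B" "m \<in> keys b" for b m
    unfolding D_def using that B_spanning(1) by (intro le_imp_less_Suc Max_ge) auto
  have "p \<in> I" if high: "d \<ge> D" "p \<in> forms n d" for d p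
  proof -
    obtain c where remainder_mem: "p - (\<Sum>b\<in>B. const (c b) * b) \<in> I"
      using B_spanning(2)[OF forms_polyR[OF high(2)]] by blast
    have "homog_comp d (p - (\<Sum>b\<in>B. const (c b) * b)) = p"
    proof (rule poly_mapping_eqI)
      fix m
      have "lookup b m = 0" if "b \<in> B" "mdeg m = d" for b
        using less[OF that(1), of m] that(2) high(1) by (auto simp: in_keys_iff)
      moreover have "lookup p m = 0" if "mdeg m \<noteq> d"
        using high(2) that by (auto simp: forms_iff_keys monomials_def in_keys_iff)
      ultimately show "lookup (homog_comp d (p - (\<Sum>b\<in>B. const (c b) * b))) m = lookup p m"
        by (auto simp: lookup_homog_comp lookup_minus lookup_sum)
    qed
    moreover have "homog_comp d (p - (\<Sum>b\<in>B. const (c b) * b)) \<in> I"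
      using homogeneous remainder_mem by (simp add: homogeneous_ideal_def)
    ultimately show ?thesis
      by simp
  qed
  then show ?thesis
    by blast
qed

definition max_augmented :: "nat \<Rightarrow> mon set \<Rightarrow> (nat \<Rightarrow> 'k) \<Rightarrow> bool" where
  "max_augmented d M v \<longleftrightarrow> (\<forall>v'. mat_invertible n v' \<longrightarrow>
     augmented_dim n (gact n v' I) d M \<le> augmented_dim n (gact n v I) d M)"

lemma ex_max_augmented:
  assumes "M \<subseteq> monomials n d"
  obtains v w where "inverse_pair n v w" "max_augmented d M v"
proof -
  let ?dim = "\<lambda>v. augmented_dim n (gact n v I) d M"
  have "mat_invertible n (\<lambda>k. if k div n = k mod n then 1 else (0 :: 'k))"
    by (simp add: mat_invertible_def if_distrib[of "\<lambda>x. x * _"] cong: if_cong)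
  moreover have "?dim v \<le> card (monomials n d)" for v
    unfolding augmented_dim_def
  proof (rule order_trans[OF mp.dim_le_card])
    show "gact n v I \<inter> forms n d \<union> mon_polys M \<subseteq> mp.span (mon_polys (monomials n d))"
      using assms by (auto simp: forms_eq_span intro: mp.span_base)
  qed (simp_all add: finite_monomials card_image_le)
  ultimately obtain v where v_max: "mat_invertible n v" "\<And>v'. mat_invertible n v' \<Longrightarrow> ?dim v' \<le> ?dim v"
    using ex_has_greatest_nat[of "mat_invertible n" _ ?dim] by (metis le_imp_less_Suc)
  then show ?thesis
    using that ex_inverse_pair unfolding max_augmented_def by metis
qed

lemma max_augmented_mono:
  assumes "max_augmented d M v" "augmented_dim n (gact n v I) d M \<le> augmented_dim n (gact n v' I) d M"
  shows "max_augmented d M v'"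
  using assms order_trans unfolding max_augmented_def by blast

lemma max_augmented_high_degree:
  assumes "forms n d \<subseteq> I" "mat_invertible n v"
  shows "max_augmented d M v"
proof -
  have "gact n v' I \<inter> forms n d = forms n d" if "mat_invertible n v'" for v'
    using act_image_forms[OF that] gact_Int_forms[OF that ideal] assms(1) by (metis Int_absorb1)
  then show ?thesis
    using assms(2) by (simp add: max_augmented_def augmented_dim_def)
qed

definition maximal_coords :: "(nat \<Rightarrow> 'k) \<Rightarrow> bool" where
  "maximal_coords v \<longleftrightarrow> mat_invertible n v \<and> (\<forall>d. \<forall>M\<subseteq>monomials n d. max_augmented d M v)"

text \<open>Semicontinuity holds in \<open>v\<close> and in its inverse \<open>w\<close> alike: the coefficients of the general
  linear forms are entries of \<open>w\<close>, whereas \<^const>\<open>gin\<close> is defined through \<open>v\<close>.\<close>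

lemma eventually_max_augmented:
  assumes "M \<subseteq> monomials n d"
  shows "\<forall>\<^sub>F v in zariski_generic (n * n). mat_invertible n v \<and> max_augmented d M v"
    and "\<forall>\<^sub>F w in zariski_generic (n * n). mat_invertible n w \<and>
      (\<forall>v. inverse_pair n v w \<longrightarrow> max_augmented d M v)"
proof -
  obtain a b where inverse_ab: "inverse_pair n a b" "max_augmented d M a"
    using ex_max_augmented[OF assms] .
  note mono = max_augmented_mono[OF inverse_ab(2)]
  note invertible = inverse_pair_imp_mat_invertible[OF inverse_ab(1)]
  show "\<forall>\<^sub>F v in zariski_generic (n * n). mat_invertible n v \<and> max_augmented d M v"
    using eventually_augmented_dim_ge[OF invertible ideal assms, THEN eventually_nhds_imp_generic]
    by (rule eventually_mono) (blast intro: mono)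
  show "\<forall>\<^sub>F w in zariski_generic (n * n). mat_invertible n w \<and>
      (\<forall>v. inverse_pair n v w \<longrightarrow> max_augmented d M v)"
    using eventually_augmented_dim_ge_inverse[OF inverse_ab(1) ideal assms,
        THEN eventually_nhds_imp_generic]
    by (rule eventually_mono) (blast intro: mono)
qed

lemma maximal_coords_finitely_determined:
  obtains T where "finite T" "T \<noteq> {}" "\<And>d M. (d, M) \<in> T \<Longrightarrow> M \<subseteq> monomials n d"
    "\<And>v. mat_invertible n v \<Longrightarrow> \<forall>(d, M)\<in>T. max_augmented d M v \<Longrightarrow> maximal_coords v"
proof -
  obtain D where high_degree: "\<And>d. d \<ge> D \<Longrightarrow> forms n d \<subseteq> I"
    using ex_forms_subset_bound by blast
  let ?T = "SIGMA d:{..D}. Pow (monomials n d)"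
  have "maximal_coords v" if v_max: "mat_invertible n v" "\<forall>(d, M)\<in>?T. max_augmented d M v" for v
  proof -
    have "max_augmented d M v" if "M \<subseteq> monomials n d" for d M
      using v_max max_augmented_high_degree[OF high_degree v_max(1), of d] that by (cases "d \<le> D") auto
    then show ?thesis
      using v_max(1) by (simp add: maximal_coords_def)
  qed
  then show ?thesis
    by (intro that[of ?T]) (auto simp: finite_monomials)
qed

lemma eventually_maximal_coords:
  "\<forall>\<^sub>F v in zariski_generic (n * n). maximal_coords v"
  "\<forall>\<^sub>F w in zariski_generic (n * n). \<exists>v. inverse_pair n v w \<and> maximal_coords v"
proof -
  obtain T where T_family: "finite T" "T \<noteq> {}" "\<And>d M. (d, M) \<in> T \<Longrightarrow> M \<subseteq> monomials n d"
    and maximal: "\<And>v. mat_invertible n v \<Longrightarrow> \<forall>(d, M)\<in>T. max_augmented d M v \<Longrightarrow> maximal_coords v"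
    using maximal_coords_finitely_determined by blast
  have "\<forall>\<^sub>F v in zariski_generic (n * n). \<forall>(d, M)\<in>T. mat_invertible n v \<and> max_augmented d M v"
    using eventually_max_augmented(1)[OF T_family(3)]
    by (intro eventually_ball_finite[OF T_family(1)]) auto
  then show "\<forall>\<^sub>F v in zariski_generic (n * n). maximal_coords v"
    by (rule eventually_mono) (use T_family(2) in \<open>auto intro!: maximal\<close>)
  have "\<forall>\<^sub>F w in zariski_generic (n * n). \<forall>(d, M)\<in>T.
      mat_invertible n w \<and> (\<forall>v. inverse_pair n v w \<longrightarrow> max_augmented d M v)"
    using eventually_max_augmented(2)[OF T_family(3)]
    by (intro eventually_ball_finite[OF T_family(1)]) auto
  then show "\<forall>\<^sub>F w in zariski_generic (n * n). \<exists>v. inverse_pair n v w \<and> maximal_coords v"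
  proof (rule eventually_mono)
    fix w assume w_max: "\<forall>(d, M)\<in>T. mat_invertible n w \<and> (\<forall>v. inverse_pair n v w \<longrightarrow> max_augmented d M v)"
    then have "mat_invertible n w"
      using T_family(2) by auto
    then obtain v where "inverse_pair n w v"
      using ex_inverse_pair by blast
    then have inverse: "inverse_pair n v w"
      by (rule inverse_pair_sym)
    then have "maximal_coords v"
      using w_max by (intro maximal inverse_pair_imp_mat_invertible[OF inverse]) auto
    with inverse show "\<exists>v. inverse_pair n v w \<and> maximal_coords v"
      by blast
  qed
qed

lemma maximal_coords_invertible: "maximal_coords v \<Longrightarrow> mat_invertible n v"
  by (simp add: maximal_coords_def)

lemma augmented_dim_maximal_coords:
  assumes "maximal_coords v" "mat_invertible n v'" "M \<subseteq> monomials n d"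
  shows "augmented_dim n (gact n v' I) d M \<le> augmented_dim n (gact n v I) d M"
  using assms by (simp add: maximal_coords_def max_augmented_def)

lemma init_mons_maximal_coords:
  assumes maximal: "maximal_coords v" "maximal_coords v'"
  shows "init_mons n (gact n v I) = init_mons n (gact n v' I)"
proof -
  note invertible = maximal[THEN maximal_coords_invertible]
  have dim: "augmented_dim n (gact n v I) d M = augmented_dim n (gact n v' I) d M"
    if "M \<subseteq> monomials n d" for d M
    using maximal invertible that by (intro le_antisym augmented_dim_maximal_coords)
  have "m \<in> init_mons n (gact n v I) \<longleftrightarrow> m \<in> init_mons n (gact n v' I)"
    if m_degree: "m \<in> monomials n d" for m d
  proof -
    have below: "below n m \<subseteq> monomials n d" "insert m (below n m) \<subseteq> monomials n d"
      using m_degree by (auto simp: below_def monomials_def)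
    have "m \<in> init_mons n (gact n u I) \<longleftrightarrow>
        augmented_dim n (gact n u I) d (insert m (below n m)) =
        augmented_dim n (gact n u I) d (below n m)"
      if "mat_invertible n u" for u
      using is_ideal_gact[OF that ideal] homogeneous_gact[OF that ideal homogeneous] m_degree
      by (rule init_mons_iff_augmented_dim)
    then show ?thesis
      using invertible dim[OF below(1)] dim[OF below(2)] by simp
  qed
  then show ?thesis
    using init_mons_vars by (simp add: monomials_def) blast
qed

lemma gin_eq_init_mons:
  assumes "maximal_coords v"
  shows "gin n I = init_mons n (gact n v I)"
  unfolding gin_def
proof (rule the_equality)
  let ?is_gin = "\<lambda>G v. mat_invertible n v \<and> init_mons n (gact n v I) = G"
  have "\<forall>\<^sub>F v' in zariski_generic (n * n). ?is_gin (init_mons n (gact n v I)) v'"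
    using eventually_maximal_coords(1)
    by (rule eventually_mono)
      (use init_mons_maximal_coords[OF assms] maximal_coords_invertible in blast)
  then show generic: "generic (n * n) (?is_gin (init_mons n (gact n v I)))"
    by (simp add: eventually_zariski_generic)
  fix G assume "generic (n * n) (?is_gin G)"
  with generic have "\<forall>\<^sub>F v' in zariski_generic (n * n).
      ?is_gin (init_mons n (gact n v I)) v' \<and> ?is_gin G v'"
    unfolding eventually_zariski_generic[symmetric] by (rule eventually_conj)
  then show "G = init_mons n (gact n v I)"
    using eventually_happens'[OF zariski_generic_neq_bot] by blast
qed

lemma ex_maximal_coords:
  obtains v where "maximal_coords v"
  using eventually_happens'[OF zariski_generic_neq_bot eventually_maximal_coords(1)] by blast

end

subsection \<open>Strong stability\<close>

definition shear :: "nat \<Rightarrow> nat \<Rightarrow> 'k::comm_ring_1 \<Rightarrow> nat \<Rightarrow> 'k mpoly" where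
  "shear a b t j = (if j = b then Var b + const t * Var a else Var j)"

definition shear_quotient :: "nat \<Rightarrow> nat \<Rightarrow> 'k::comm_ring_1 \<Rightarrow> 'k mpoly \<Rightarrow> 'k mpoly" where
  "shear_quotient a b t p = (\<Sum>m\<in>keys p. const (lookup p m) *
     (\<Sum>k=1..lookup m b. single (m - single b k + single a k)
         (of_nat (lookup m b choose k) * t ^ (k - 1))))"

text \<open>The operator \<open>x\<^sub>a \<partial>/\<partial>x\<^sub>b\<close>.\<close>

definition polarize :: "nat \<Rightarrow> nat \<Rightarrow> 'k::comm_ring_1 mpoly \<Rightarrow> 'k mpoly" where
  "polarize a b p =
    (\<Sum>m\<in>keys p. single (m - single b 1 + single a 1) (of_nat (lookup m b) * lookup p m))"

lemma subst_shear_monomial: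
  fixes t :: "'k::comm_ring_1"
  assumes "a \<noteq> b"
  shows "subst (shear a b t) (single m 1) =
    (\<Sum>k\<le>lookup m b. single (m - single b k + single a k) (of_nat (lookup m b choose k) * t ^ k))"
proof -
  let ?e = "lookup m b"
  define r where "r = m - single b ?e"
  have m_eq: "m = r + single b ?e"
    by (rule poly_mapping_eqI) (auto simp: r_def lookup_add lookup_minus lookup_single when_def)
  have "mprod (shear a b t) r = mprod Var r"
    unfolding mprod_def
    by (intro prod.cong) (auto simp: shear_def r_def in_keys_iff lookup_minus)
  then have "subst (shear a b t) (single m 1) = single r 1 * (const t * Var a + Var b) ^ ?e"
    by (subst (1) m_eq) (simp add: subst_single mprod_add mprod_Var shear_def add.commute)
  also have "\<dots> = (\<Sum>k\<le>?e. single (r + single a k + single b (?e - k)) (of_nat (?e choose k) * t ^ k))"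
    unfolding binomial_ring sum_distrib_left
  proof (rule sum.cong[OF refl])
    fix k
    have "const t ^ k = const (t ^ k)"
      by (induction k) (simp_all add: const_mult)
    then show "single r 1 * (of_nat (?e choose k) * (const t * Var a) ^ k * Var b ^ (?e - k)) =
        single (r + single a k + single b (?e - k)) (of_nat (?e choose k) * t ^ k)"
      by (simp add: power_mult_distrib Var_power const_def Poly_Mapping.mult_single add_ac
          flip: single_of_nat)
  qed
  also have "\<dots> = (\<Sum>k\<le>?e. single (m - single b k + single a k) (of_nat (?e choose k) * t ^ k))"
  proof (rule sum.cong[OF refl])
    fix k assume "k \<in> {..?e}"
    then have "r + single a k + single b (?e - k) = m - single b k + single a k"
      by (intro poly_mapping_eqI) (auto simp: r_def lookup_add lookup_minus lookup_single when_def)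
    then show "single (r + single a k + single b (?e - k)) (of_nat (?e choose k) * t ^ k) =
        single (m - single b k + single a k) (of_nat (?e choose k) * t ^ k)"
      by simp
  qed
  finally show ?thesis .
qed

lemma subst_shear:
  assumes "a \<noteq> b"
  shows "subst (shear a b t) p = p + const t * shear_quotient a b t p"
proof -
  let ?c = "\<lambda>m k. single (m - single b k + single a k) (of_nat (lookup m b choose k) * t ^ (k - 1))"
  have mon: "subst (shear a b t) (single m 1) = single m 1 + const t * (\<Sum>k=1..lookup m b. ?c m k)" for m
  proof -
    have "single (m - single b k + single a k) (of_nat (lookup m b choose k) * t ^ k) =
        const t * ?c m k"
      if "k \<in> {1..lookup m b}" for k
      using that by (cases k) (simp_all add: mult_ac)
    then show ?thesis
      unfolding subst_shear_monomial[OF assms] sum_distrib_left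
      by (simp add: atMost_atLeast0 sum.atLeast_Suc_atMost)
  qed
  have p_expand: "p = (\<Sum>m\<in>keys p. const (lookup p m) * single m 1)"
    by (simp flip: poly_mapping_sum_single)
  have "subst (shear a b t) p = (\<Sum>m\<in>keys p. const (lookup p m) * subst (shear a b t) (single m 1))"
    by (subst (1) p_expand) (simp only: subst_sum subst_mult subst_const)
  also have "\<dots> = (\<Sum>m\<in>keys p. const (lookup p m) * single m 1) + const t * shear_quotient a b t p"
    unfolding mon shear_quotient_def
    by (simp only: distrib_left sum.distrib sum_distrib_left mult.left_commute)
  finally show ?thesis
    using p_expand by simp
qed

lemma shear_quotient_0: "shear_quotient a b 0 p = polarize a b p"
proof -
  have "(\<Sum>k=1..e. single (m - single b k + single a k) (of_nat (e choose k) * 0 ^ (k - 1))) =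
      single (m - single b 1 + single a 1) (of_nat e :: 'a)" for e and m :: mon
  proof (cases e)
    case (Suc i)
    have "(\<Sum>k=1..e. single (m - single b k + single a k) (of_nat (e choose k) * 0 ^ (k - 1) :: 'a)) =
        (\<Sum>k\<in>{1}. single (m - single b k + single a k) (of_nat (e choose k) * 0 ^ (k - 1)))"
      using Suc by (intro sum.mono_neutral_right) (auto simp: power_0_left split: if_splits)
    then show ?thesis
      by simp
  qed simp
  then show ?thesis
    unfolding shear_quotient_def polarize_def by (simp add: mult.commute)
qed

lemma polyfam_shear_quotient: "polyfam 1 (\<lambda>t. shear_quotient a b (t 0) p)"
  unfolding shear_quotient_def
  by (intro polyfam_sum polyfam_mult polyfam_const polyfam_single polyfun_mult polyfun_const
      polyfun_power polyfun_coord) simp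

lemma lookup_polarize:
  "lookup (polarize a b p) q =
    (\<Sum>m\<in>keys p. of_nat (lookup m b) * lookup p m when q + single b 1 = m + single a 1)"
proof -
  have "lookup (single (m - single b 1 + single a 1) (of_nat (lookup m b) * lookup p m)) q =
      (of_nat (lookup m b) * lookup p m when q + single b 1 = m + single a 1)" for m
  proof (cases "lookup m b = 0")
    case False
    then have "single b 1 + (m - single b 1) = m"
      by (intro mon_dvd_add_diff) (simp add: mon_dvd_single_iff)
    then have "m + single a 1 = (m - single b 1 + single a 1) + single b 1"
      by (metis add.commute add.left_commute)
    then show ?thesis
      by (auto simp: lookup_single when_def)
  qed simp
  then show ?thesis
    by (simp add: polarize_def lookup_sum)
qed

lemma keys_polarize_minus_lead:
  fixes f :: "'k::comm_ring_1 mpoly"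
  assumes f_lead: "keys (f - single m 1) \<subseteq> below n m"
    and m'_eq: "m' + single b 1 = m + single a 1" and "a < n"
  shows "keys (polarize a b f - single m' (of_nat (lookup m b))) \<subseteq> below n m'"
proof
  fix q assume q_key: "q \<in> keys (polarize a b f - single m' (of_nat (lookup m b)))"
  note lead = keys_minus_monomial_subset_below[OF f_lead]
  have "lookup (polarize a b f) m' = (\<Sum>\<nu>\<in>keys f. if \<nu> = m then of_nat (lookup m b) else 0)"
    unfolding lookup_polarize m'_eq using lead(1) by (intro sum.cong) auto
  also have "\<dots> = of_nat (lookup m b)"
    using lead(1) by (simp add: in_keys_iff)
  finally have "q \<noteq> m'"
    using q_key by (auto simp: in_keys_iff lookup_minus)
  then have "lookup (polarize a b f) q \<noteq> 0"
    using q_key by (simp add: in_keys_iff lookup_minus lookup_single)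
  then obtain \<nu> where \<nu>: "\<nu> \<in> keys f" "q + single b 1 = \<nu> + single a 1"
    unfolding lookup_polarize
    by (rule sum.not_neutral_contains_not_neutral) (auto simp: when_def split: if_splits)
  have "\<nu> \<noteq> m"
    using \<nu>(2) m'_eq \<open>q \<noteq> m'\<close> by (metis add_right_cancel)
  then have below: "\<nu> \<in> monomials n (mdeg m)" "mon_gt m \<nu>"
    using lead(2)[OF \<nu>(1)] by (auto simp: below_def)
  then have "mon_gt (m' + single b 1) (q + single b 1)"
    unfolding m'_eq \<nu>(2) by simp
  moreover have "mdeg q = mdeg m'" "keys q \<subseteq> {..<n}"
    using arg_cong[OF \<nu>(2), of mdeg] arg_cong[OF m'_eq, of mdeg] arg_cong[OF \<nu>(2), of keys]
      below(1) \<open>a < n\<close>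
    by (auto simp: monomials_def keys_add_mon)
  ultimately show "q \<in> below n m'"
    by (simp add: below_def monomials_def)
qed

definition add_row :: "nat \<Rightarrow> nat \<Rightarrow> nat \<Rightarrow> 'k::comm_ring_1 \<Rightarrow> (nat \<Rightarrow> 'k) \<Rightarrow> nat \<Rightarrow> 'k" where
  "add_row n a b t v k = v k + (if k div n = a then t * v (b * n + k mod n) else 0)"

lemma add_row_0 [simp]: "add_row n a b 0 v = v"
  by (simp add: add_row_def fun_eq_iff)

lemma gsubst_add_row:
  assumes "a < n" "b < n" "j < n"
  shows "gsubst n (add_row n a b t v) j = subst (shear a b t) (gsubst n v j)"
proof -
  have "gsubst n (add_row n a b t v) j =
      (\<Sum>l<n. const (v (l * n + j)) * Var l + (if l = a then const (t * v (b * n + j)) * Var l else 0))"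
    using assms(3) by (auto simp: gsubst_def add_row_def const_add distrib_right intro!: sum.cong)
  also have "\<dots> = (\<Sum>l<n. const (v (l * n + j)) * Var l) + const (t * v (b * n + j)) * Var a"
    using assms(1) by (simp add: sum.distrib)
  also have "\<dots> = (\<Sum>l<n. const (v (l * n + j)) * Var l +
      (if l = b then const (v (l * n + j)) * (const t * Var a) else 0))"
    using assms(2) by (simp add: sum.distrib const_mult mult_ac)
  also have "\<dots> = (\<Sum>l<n. const (v (l * n + j)) * shear a b t l)"
    by (intro sum.cong) (auto simp: shear_def distrib_left)
  finally show ?thesis
    using assms(3) by (simp add: gsubst_eq_linform subst_linform)
qed

lemma act_add_row:
  assumes "a < n" "b < n" "p \<in> polyR n"
  shows "act n (add_row n a b t v) p = subst (shear a b t) (act n v p)"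
  unfolding subst_subst using assms gsubst_add_row by (intro subst_cong) auto

lemma mat_invertible_add_row:
  assumes "mat_invertible n v" "a < n" "b < n" "a \<noteq> b"
  shows "mat_invertible n (add_row n a b t v)"
  unfolding mat_invertible_def
proof (rule allI, rule impI)
  fix c assume kernel: "\<forall>l<n. (\<Sum>j<n. add_row n a b t v (l * n + j) * c j) = 0"
  have row: "(\<Sum>j<n. add_row n a b t v (l * n + j) * c j) =
      (\<Sum>j<n. v (l * n + j) * c j) + (if l = a then t * (\<Sum>j<n. v (b * n + j) * c j) else 0)" for l
    by (simp add: add_row_def distrib_right sum.distrib sum_distrib_left mult.assoc)
  have "(\<Sum>j<n. v (l * n + j) * c j) = 0" if "l < n" for l
    using kernel row[of l] row[of b] that assms(3,4) by (auto split: if_splits)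
  then show "\<forall>j<n. c j = 0"
    using assms(1) by (simp add: mat_invertible_def)
qed

lemma polyfam_act_add_row:
  assumes "p \<in> polyR n"
  shows "polyfam 1 (\<lambda>t. act n (add_row n a b (t 0) v) p)"
proof (rule polyfam_subst[OF assms])
  have "polyfun 1 (\<lambda>t. add_row n a b (t 0) v k)" for k
    unfolding add_row_def
    by (cases "k div n = a") (auto intro!: polyfun_add polyfun_mult polyfun_const polyfun_coord)
  then show "polyfam 1 (\<lambda>t. gsubst n (add_row n a b (t 0) v) j)" if "j < n" for j
    using that by (simp add: gsubst_eq_linform polyfam_linform del: One_nat_def)
qed

context artinian_ideal
begin

lemma shear_quotient_in_span:
  assumes invertible: "mat_invertible n v" and ab_less: "a < n" "b < n" "a \<noteq> b" and "t \<noteq> 0"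
    and f_mem: "f \<in> gact n v I \<inter> forms n d" "keys f \<subseteq> M"
  shows "shear_quotient a b t f \<in> mp.span (mon_polys M \<union> act n (add_row n a b t v) ` (I \<inter> forms n d))"
    (is "_ \<in> mp.span ?X")
proof -
  obtain p where f_eq: "p \<in> I \<inter> forms n d" "f = act n v p"
    using f_mem(1) gact_Int_forms[OF invertible ideal] by blast
  then have "subst (shear a b t) f = act n (add_row n a b t v) p"
    using act_add_row[OF ab_less(1,2) is_ideal_polyR[OF ideal]] by simp
  then have "subst (shear a b t) f \<in> mp.span ?X"
    using f_eq(1) by (simp add: mp.span_base)
  moreover have "f \<in> mp.span ?X"
    using f_mem(2) in_span_mon_polys_iff mp.span_mono[OF Un_upper1] by blast
  ultimately have "subst (shear a b t) f - f \<in> mp.span ?X"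
    by (rule mp.span_diff)
  then show ?thesis
    using in_span_const_mult_iff[OF \<open>t \<noteq> 0\<close>] by (simp add: subst_shear[OF ab_less(3)])
qed

text \<open>Let \<open>t\<close> tend to \<open>0\<close>: as \<open>v\<close> is maximal, the dimension of the span does not drop.\<close>

lemma polarize_in_span:
  assumes maximal: "maximal_coords v" and ab_less: "a < n" "b < n" "a \<noteq> b"
    and f_mem: "f \<in> gact n v I \<inter> forms n d" "keys f \<subseteq> M" and M_degree: "M \<subseteq> monomials n d"
  shows "polarize a b f \<in> mp.span (gact n v I \<inter> forms n d \<union> mon_polys M)"
proof -
  note invertible = maximal_coords_invertible[OF maximal]
  define s where "s = (\<lambda>t :: nat \<Rightarrow> 'k. add_row n a b (t 0) v)"
  let ?X = "\<lambda>t. mon_polys M \<union> act n (s t) ` (I \<inter> forms n d)"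
  have s_0: "s (\<lambda>_. 0) = v"
    by (simp add: s_def)
  have "mat_invertible n (s t)" for t
    using invertible ab_less by (simp add: s_def mat_invertible_add_row)
  then have dim_le: "mp.dim (?X t) \<le> mp.dim (?X (\<lambda>_. 0))" for t
    using augmented_dim_maximal_coords[OF maximal _ M_degree] invertible
    by (simp add: s_0 augmented_dim_gact_eq[OF _ ideal, symmetric])
  have "shear_quotient a b ((\<lambda>_. 0) 0) f \<in> mp.span (?X (\<lambda>_. 0))"
  proof (rule in_span_specialization[where f = "\<lambda>t. act n (s t)" and N = 1])
    show "polyfam 1 (\<lambda>t. act n (s t) p)" if "p \<in> I \<inter> forms n d" for p
      using that is_ideal_polyR[OF ideal] unfolding s_def by (intro polyfam_act_add_row) auto
    show "mp.fin_dim (mon_polys M)" "mp.fin_dim (I \<inter> forms n d)"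
      using M_degree by (auto intro!: fin_dim_subset_forms[of _ n d] forms_single)
    show "polyfam 1 (\<lambda>t. shear_quotient a b (t 0) f)"
      by (rule polyfam_shear_quotient)
    show "\<forall>\<^sub>F t in zariski_generic 1. mp.dim (?X t) \<le> mp.dim (?X (\<lambda>_. 0))"
      using dim_le by simp
    have "\<forall>\<^sub>F t in zariski_generic 1. t 0 \<noteq> (0 :: 'k)"
      by (rule eventually_nhds_imp_generic[OF eventually_polyfun_neq_0, of _ _ "\<lambda>_. 1"])
        (auto intro: polyfun_coord)
    then show "\<forall>\<^sub>F t in zariski_generic 1. shear_quotient a b (t 0) f \<in> mp.span (?X t)"
      by (rule eventually_mono)
        (use shear_quotient_in_span[OF invertible ab_less _ f_mem] in \<open>simp add: s_def\<close>)
  qed (rule mpoly_linear_subst)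
  then show ?thesis
    by (simp add: s_0 shear_quotient_0 gact_Int_forms[OF invertible ideal] Un_commute)
qed

theorem gin_replace_variable:
  assumes "m + single b 1 \<in> gin n I" "a < b" "b < n"
  shows "m + single a 1 \<in> gin n I"
proof -
  obtain v where maximal: "maximal_coords v"
    by (rule ex_maximal_coords)
  let ?J = "gact n v I" and ?m = "m + single b 1" and ?m' = "m + single a 1"
  have ideal_J: "is_ideal n ?J" "homogeneous_ideal ?J" and gin: "gin n I = init_mons n ?J"
    using is_ideal_gact[OF _ ideal] homogeneous_gact[OF _ ideal homogeneous]
      gin_eq_init_mons[OF maximal]
      maximal_coords_invertible[OF maximal] by auto
  let ?d = "mdeg ?m" and ?X = "?J \<inter> forms n (mdeg ?m) \<union> mon_polys (below n ?m')"
  have m'_degree: "?m' \<in> monomials n ?d" "mdeg ?m' = ?d"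
    using init_mons_vars assms unfolding gin by (fastforce simp: monomials_def keys_add_mon)+
  have "mon_gt ?m' ?m"
    using assms(2) by (auto simp: mon_gt_iff lookup_add lookup_single when_def intro!: exI[of _ b])
  obtain f where f_mem: "f \<in> ?J \<inter> forms n ?d" and lead: "keys (f - single ?m 1) \<subseteq> below n ?m"
    using assms(1) unfolding gin init_mons_iff[OF ideal_J] by blast
  have "keys f \<subseteq> below n ?m'"
    using f_mem m'_degree \<open>mon_gt ?m' ?m\<close>
    by (intro keys_subset_below[OF lead]) (simp_all add: forms_iff_keys)
  then have "polarize a b f \<in> mp.span ?X"
    using m'_degree(2) assms(2,3) f_mem by (intro polarize_in_span[OF maximal]) (auto simp: below_def)
  moreover have "keys (polarize a b f - single ?m' (of_nat (lookup ?m b))) \<subseteq> below n ?m'"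
    using lead assms(2,3) by (intro keys_polarize_minus_lead) (auto simp: add_ac)
  then have "polarize a b f - single ?m' (of_nat (lookup ?m b)) \<in> mp.span ?X"
    using in_span_mon_polys_iff mp.span_mono[OF Un_upper2] by blast
  ultimately have "const (of_nat (lookup ?m b)) * single ?m' 1 \<in> mp.span ?X"
    using mp.span_diff by fastforce
  moreover have "(of_nat (lookup ?m b) :: 'k) \<noteq> 0"
    unfolding of_nat_eq_0_iff by (simp add: lookup_add)
  ultimately have "single ?m' 1 \<in> mp.span ?X"
    using in_span_const_mult_iff by blast
  then show ?thesis
    unfolding gin using init_mons_iff_span[OF ideal_J m'_degree(1)] by blast
qed

end

section \<open>Lefschetz elements\<close>

definition mult_inj_mod :: "nat \<Rightarrow> 'k::comm_ring_1 mpoly set \<Rightarrow> 'k mpoly \<Rightarrow> nat \<Rightarrow> bool" where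
  "mult_inj_mod n J f d \<longleftrightarrow> (\<forall>p\<in>forms n d. f * p \<in> J \<longrightarrow> p \<in> J)"

definition mult_surj_mod :: "nat \<Rightarrow> 'k::comm_ring_1 mpoly set \<Rightarrow> 'k mpoly \<Rightarrow> nat \<Rightarrow> nat \<Rightarrow> bool" where
  "mult_surj_mod n J f d e \<longleftrightarrow> (\<forall>q\<in>forms n e. \<exists>p\<in>forms n d. q - f * p \<in> J)"

definition lefschetz_element :: "nat \<Rightarrow> 'k::comm_ring_1 mpoly set \<Rightarrow> 'k mpoly \<Rightarrow> bool" where
  "lefschetz_element n J L \<longleftrightarrow> (\<forall>d i. mult_inj_mod n J (L ^ i) d \<or> mult_surj_mod n J (L ^ i) d (d + i))"

lemma slp_iff_lefschetz_element: "slp n J \<longleftrightarrow> (\<exists>L\<in>forms n 1. lefschetz_element n J L)"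
  unfolding slp_def lefschetz_element_def mult_inj_mod_def mult_surj_mod_def forms_def
  by (simp add: Ball_def Bex_def imp_conjL conj_assoc)

subsection \<open>Changes of coordinates\<close>

lemma mult_inj_mod_gact:
  fixes v :: "nat \<Rightarrow> 'k::field"
  assumes "mat_invertible n v" "is_ideal n J" "f \<in> polyR n"
  shows "mult_inj_mod n (gact n v J) (act n v f) d \<longleftrightarrow> mult_inj_mod n J f d"
proof -
  have "mult_inj_mod n (gact n v J) (act n v f) d \<longleftrightarrow>
      (\<forall>p\<in>forms n d. act n v (f * p) \<in> gact n v J \<longrightarrow> act n v p \<in> gact n v J)"
    unfolding mult_inj_mod_def by (subst act_image_forms[OF assms(1), symmetric]) (simp add: subst_mult)
  then show ?thesis
    using act_in_gact_iff[OF assms(1,2)] assms(3) forms_polyR polyR_mult unfolding mult_inj_mod_def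
    by metis
qed

lemma mult_surj_mod_gact:
  fixes v :: "nat \<Rightarrow> 'k::field"
  assumes "mat_invertible n v" "is_ideal n J" "f \<in> polyR n"
  shows "mult_surj_mod n (gact n v J) (act n v f) d e \<longleftrightarrow> mult_surj_mod n J f d e"
proof -
  have "mult_surj_mod n (gact n v J) (act n v f) d e \<longleftrightarrow>
      (\<forall>q\<in>act n v ` forms n e. \<exists>p\<in>act n v ` forms n d. q - act n v f * p \<in> gact n v J)"
    unfolding mult_surj_mod_def act_image_forms[OF assms(1)] ..
  also have "\<dots> \<longleftrightarrow> (\<forall>q\<in>forms n e. \<exists>p\<in>forms n d. act n v (q - f * p) \<in> gact n v J)"
    by (simp add: subst_diff subst_mult)
  also have "\<dots> \<longleftrightarrow> mult_surj_mod n J f d e"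
    using act_in_gact_iff[OF assms(1,2)] assms(3) forms_polyR polyR_mult polyR_diff
    unfolding mult_surj_mod_def
    by metis
  finally show ?thesis .
qed

lemma lefschetz_element_gact:
  fixes v :: "nat \<Rightarrow> 'k::field"
  assumes "mat_invertible n v" "is_ideal n J" "L \<in> polyR n"
  shows "lefschetz_element n (gact n v J) (act n v L) \<longleftrightarrow> lefschetz_element n J L"
  unfolding lefschetz_element_def subst_power[symmetric]
  using mult_inj_mod_gact[OF assms(1,2)] mult_surj_mod_gact[OF assms(1,2)] polyR_power[OF assms(3)]
  by simp

lemma ideal_plus_cong:
  assumes "\<And>j. j < i \<Longrightarrow> L j = L' j"
  shows "ideal_plus n I L i = ideal_plus n I L' i"
proof -
  have "(\<Sum>j<i. r j * L j) = (\<Sum>j<i. r j * L' j)" for r :: "nat \<Rightarrow> 'a mpoly"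
    using assms by (intro sum.cong) auto
  then show ?thesis
    by (simp add: ideal_plus_def)
qed

lemma ideal_plus_superset: "I \<subseteq> ideal_plus n I L i"
proof
  fix p assume "p \<in> I"
  then show "p \<in> ideal_plus n I L i"
    unfolding ideal_plus_def by (intro CollectI exI[of _ p] exI[of _ "\<lambda>_. 0"]) simp
qed

lemma ideal_plus_generator:
  assumes "0 \<in> I" "j < i"
  shows "L j \<in> ideal_plus n I L i"
proof -
  have "L j = 0 + (\<Sum>k<i. (if k = j then 1 else 0) * L k)"
    using assms(2) by (simp add: if_distrib[of "\<lambda>x. x * _"] cong: if_cong)
  then show ?thesis
    unfolding ideal_plus_def using assms(1)
    by (intro CollectI exI[of _ 0] exI[of _ "\<lambda>k. if k = j then 1 else 0"]) simp
qed

lemma is_ideal_ideal_plus: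
  fixes I :: "'k::comm_ring_1 mpoly set"
  assumes ideal_I: "is_ideal n I" and L_polyR: "\<And>j. j < i \<Longrightarrow> L j \<in> polyR n"
  shows "is_ideal n (ideal_plus n I L i)"
  unfolding is_ideal_def
proof (intro conjI ballI subsetI)
  fix x assume "x \<in> ideal_plus n I L i"
  then show "x \<in> polyR n"
    using L_polyR is_ideal_polyR[OF ideal_I]
    by (auto simp: ideal_plus_def intro!: polyR_add polyR_sum polyR_mult)
next
  show "0 \<in> ideal_plus n I L i"
    using ideal_I ideal_plus_superset[of I n L i] by (auto simp: is_ideal_def)
next
  fix x y assume "x \<in> ideal_plus n I L i" "y \<in> ideal_plus n I L i"
  then obtain p r q s where x_eq: "x = p + (\<Sum>j<i. r j * L j)" "p \<in> I" "\<forall>j<i. r j \<in> polyR n"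
    and y_eq: "y = q + (\<Sum>j<i. s j * L j)" "q \<in> I" "\<forall>j<i. s j \<in> polyR n"
    unfolding ideal_plus_def by blast
  have "x + y = (p + q) + (\<Sum>j<i. (r j + s j) * L j)"
    by (simp add: x_eq(1) y_eq(1) distrib_right sum.distrib)
  moreover have "p + q \<in> I"
    using ideal_I x_eq(2) y_eq(2) by (simp add: is_ideal_def)
  ultimately show "x + y \<in> ideal_plus n I L i"
    unfolding ideal_plus_def using x_eq(3) y_eq(3) polyR_add
    by (intro CollectI exI[of _ "p + q"] exI[of _ "\<lambda>j. r j + s j"]) blast
next
  fix a x :: "'k mpoly" assume a_polyR: "a \<in> polyR n" and "x \<in> ideal_plus n I L i"
  then obtain p r where x_eq: "x = p + (\<Sum>j<i. r j * L j)" "p \<in> I" "\<forall>j<i. r j \<in> polyR n"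
    unfolding ideal_plus_def by blast
  have "a * x = a * p + (\<Sum>j<i. (a * r j) * L j)"
    by (simp add: x_eq(1) distrib_left sum_distrib_left mult.assoc)
  then show "a * x \<in> ideal_plus n I L i"
    unfolding ideal_plus_def using x_eq(2,3) is_ideal_mult[OF ideal_I a_polyR] polyR_mult[OF a_polyR]
    by (intro CollectI exI[of _ "a * p"] exI[of _ "\<lambda>j. a * r j"]) blast
qed

lemma homogeneous_ideal_plus:
  assumes homogeneous_I: "homogeneous_ideal I" and L_forms: "\<And>j. j < i \<Longrightarrow> L j \<in> forms n 1"
  shows "homogeneous_ideal (ideal_plus n I L i)"
  unfolding homogeneous_ideal_def
proof (intro ballI allI)
  fix x d assume "x \<in> ideal_plus n I L i"
  then obtain p r where x_eq: "x = p + (\<Sum>j<i. r j * L j)" "p \<in> I" "\<forall>j<i. r j \<in> polyR n"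
    unfolding ideal_plus_def by blast
  let ?r = "\<lambda>j. if 1 \<le> d then homog_comp (d - 1) (r j) else 0"
  have "homog_comp d x = homog_comp d p + (\<Sum>j<i. ?r j * L j)"
    unfolding x_eq(1) homog_comp_add homog_comp_sum using homog_comp_mult_form[OF _ L_forms] x_eq(3)
    by (auto intro!: sum.cong)
  moreover have "homog_comp d p \<in> I" "\<forall>j<i. ?r j \<in> polyR n"
    using homogeneous_I x_eq(2,3) homog_comp_in_forms forms_polyR
    by (auto simp: homogeneous_ideal_def) blast
  ultimately show "homog_comp d x \<in> ideal_plus n I L i"
    unfolding ideal_plus_def by (intro CollectI exI[of _ "homog_comp d p"] exI[of _ ?r]) simp
qed

lemma gact_ideal_plus:
  fixes v :: "nat \<Rightarrow> 'k::field"
  assumes "mat_invertible n v"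
  shows "gact n v (ideal_plus n I L i) = ideal_plus n (gact n v I) (\<lambda>j. act n v (L j)) i"
proof
  show "gact n v (ideal_plus n I L i) \<subseteq> ideal_plus n (gact n v I) (\<lambda>j. act n v (L j)) i"
  proof
    fix x assume "x \<in> gact n v (ideal_plus n I L i)"
    then obtain p r where "x = act n v (p + (\<Sum>j<i. r j * L j))" "p \<in> I" "\<forall>j<i. r j \<in> polyR n"
      unfolding gact_def ideal_plus_def by blast
    then show "x \<in> ideal_plus n (gact n v I) (\<lambda>j. act n v (L j)) i"
      unfolding ideal_plus_def gact_def
      by (intro CollectI exI[of _ "act n v p"] exI[of _ "\<lambda>j. act n v (r j)"])
        (simp add: subst_add subst_sum subst_mult act_polyR)
  qed
  obtain w where inverse: "inverse_pair n v w"
    by (rule ex_inverse_pair[OF assms])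
  show "ideal_plus n (gact n v I) (\<lambda>j. act n v (L j)) i \<subseteq> gact n v (ideal_plus n I L i)"
  proof
    fix x assume "x \<in> ideal_plus n (gact n v I) (\<lambda>j. act n v (L j)) i"
    then obtain p r where x_eq: "x = act n v p + (\<Sum>j<i. r j * act n v (L j))" "p \<in> I"
      "\<forall>j<i. r j \<in> polyR n"
      unfolding ideal_plus_def gact_def by blast
    have "(\<Sum>j<i. r j * act n v (L j)) = (\<Sum>j<i. act n v (act n w (r j)) * act n v (L j))"
      using x_eq(3) inverse_pairD(1)[OF inverse] by (intro sum.cong) auto
    then have "x = act n v (p + (\<Sum>j<i. act n w (r j) * L j))"
      unfolding x_eq(1) by (simp only: subst_add subst_sum subst_mult)
    then show "x \<in> gact n v (ideal_plus n I L i)"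
      unfolding gact_def ideal_plus_def using x_eq(2,3)
      by (intro image_eqI CollectI exI[of _ p] exI[of _ "\<lambda>j. act n w (r j)"]) (simp_all add: act_polyR)
  qed
qed

subsection \<open>Multiplication by a variable modulo the later variables\<close>

definition mono_lefschetz :: "nat \<Rightarrow> mon set \<Rightarrow> nat \<Rightarrow> bool" where
  "mono_lefschetz n G j \<longleftrightarrow> (\<forall>d e. (\<forall>m\<in>monomials n d. m \<notin> G \<longrightarrow> m + single j e \<notin> G) \<or>
     (\<forall>m\<in>monomials n (d + e). m \<notin> G \<longrightarrow> e \<le> lookup m j))"

definition trunc :: "nat \<Rightarrow> 'k::comm_ring_1 mpoly \<Rightarrow> 'k mpoly" where
  "trunc k p = (\<Sum>m\<in>{m \<in> keys p. keys m \<subseteq> {..<k}}. single m (lookup p m))"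

lemma lookup_trunc: "lookup (trunc k p) m = (if keys m \<subseteq> {..<k} then lookup p m else 0)"
  by (auto simp: trunc_def lookup_sum lookup_single when_def in_keys_iff)

lemma keys_trunc: "keys (trunc k p) = {m \<in> keys p. keys m \<subseteq> {..<k}}"
  by (rule set_eqI) (simp add: in_keys_iff lookup_trunc)

lemma lm_single_mult:
  fixes p :: "'k::comm_ring_1 mpoly"
  assumes "p \<noteq> 0"
  shows "lm (single a 1 * p) = a + lm p"
  using lm_in_keys[OF assms] mon_gt_lm[of _ p] by (intro lm_eqI) (auto simp: keys_single_mult)

lemma forms_of_single_mult:
  assumes "single a 1 * p \<in> forms n (d + mdeg a)"
  shows "p \<in> forms n (d :: nat)"
  unfolding forms_iff_keys
proof
  fix m assume "m \<in> keys p"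
  then have "a + m \<in> monomials n (d + mdeg a)"
    using assms by (auto simp: forms_iff_keys keys_single_mult)
  then show "m \<in> monomials n d"
    by (simp add: monomials_add_iff) (simp add: monomials_def)
qed

locale ideal_with_later_vars =
  fixes n j :: nat and K :: "'k::field mpoly set"
  assumes ideal: "is_ideal n K" and homogeneous: "homogeneous_ideal K" and j_less: "j < n"
    and later_vars: "\<And>l. j < l \<Longrightarrow> l < n \<Longrightarrow> Var l \<in> K"
begin

lemma single_mem:
  assumes "keys m \<subseteq> {..<n}" "\<not> keys m \<subseteq> {..<Suc j}"
  shows "single m c \<in> K"
proof -
  obtain l where l_key: "l \<in> keys m" "j < l" "l < n"
    using assms by (force simp: subset_iff less_Suc_eq_le)
  then have m_split: "single l 1 + (m - single l 1) = m"
    by (intro mon_dvd_add_diff) (simp add: mon_dvd_single_iff in_keys_iff)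
  have "single (m - single l 1) c * Var l \<in> K"
    using assms(1) l_key later_vars
    by (intro is_ideal_mult[OF ideal] polyR_single) (auto simp: in_keys_iff lookup_minus subset_iff)
  moreover have "single (m - single l 1) c * Var l = single m c"
    using m_split by (simp add: Var_def var_mon_def Poly_Mapping.mult_single add.commute)
  ultimately show ?thesis
    by simp
qed

lemma trunc_mem_iff:
  assumes "p \<in> polyR n"
  shows "trunc (Suc j) p \<in> K \<longleftrightarrow> p \<in> K"
proof -
  let ?r = "p - trunc (Suc j) p"
  have "keys m \<subseteq> {..<n}" "\<not> keys m \<subseteq> {..<Suc j}" if "m \<in> keys ?r" for m
    using that assms by (auto simp: in_keys_iff lookup_minus lookup_trunc polyR_def split: if_splits)
  then have "(\<Sum>m\<in>keys ?r. single m (lookup ?r m)) \<in> K"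
    by (intro mp.subspace_sum[OF is_ideal_subspace[OF ideal]] single_mem)
  then have "?r \<in> K"
    by (simp flip: poly_mapping_sum_single)
  then show ?thesis
    using is_ideal_diff[OF ideal, of p ?r]
      mp.subspace_add[OF is_ideal_subspace[OF ideal], of ?r "trunc (Suc j) p"]
    by auto
qed

lemma init_monsI:
  assumes "p \<in> K" "m \<in> keys p" "keys m \<subseteq> {..<Suc j}"
    and "\<And>m'. m' \<in> keys p \<Longrightarrow> m' \<noteq> m \<Longrightarrow> keys m' \<subseteq> {..<Suc j} \<Longrightarrow> mon_gt m m'"
  shows "m \<in> init_mons n K"
proof -
  have m_key: "m \<in> keys (trunc (Suc j) p)"
    using assms(2,3) by (simp add: keys_trunc)
  moreover from m_key have "lm (trunc (Suc j) p) = m"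
    using assms(4) by (intro lm_eqI) (auto simp: keys_trunc)
  moreover have "trunc (Suc j) p \<in> K"
    using assms(1) trunc_mem_iff[OF is_ideal_polyR[OF ideal assms(1)]] by simp
  ultimately show ?thesis
    using lm_in_init_mons[OF ideal] by fastforce
qed

lemma later_vars_init_mons:
  assumes "keys m \<subseteq> {..<n}" "\<not> keys m \<subseteq> {..<Suc j}"
  shows "m \<in> init_mons n K"
  using lm_in_init_mons[OF ideal single_mem[OF assms, of 1]] lm_eqI[of m "single m (1 :: 'k)"]
  by (simp flip: keys_eq_empty)

lemma Var_power_forms: "Var j ^ e * p \<in> forms n (d + e) \<longleftrightarrow> p \<in> forms n d"
proof
  show "Var j ^ e * p \<in> forms n (d + e) \<Longrightarrow> p \<in> forms n d"
    using forms_of_single_mult[of "single j e" p n d] by (simp add: Var_power)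
  show "p \<in> forms n d \<Longrightarrow> Var j ^ e * p \<in> forms n (d + e)"
    using forms_mult[OF forms_power[OF forms_Var[OF j_less], of e]] by (fastforce simp: add.commute)
qed

lemma init_mons_Var_powerE:
  assumes m_vars: "m \<in> monomials n d" "keys m \<subseteq> {..<Suc j}" and init: "m + single j e \<in> init_mons n K"
  obtains p where "p \<in> forms n d" "Var j ^ e * p \<in> K" "p \<noteq> 0" "lm p = m"
proof -
  let ?m = "m + single j e"
  have vars: "keys ?m \<subseteq> {..<Suc j}" and mdeg: "mdeg ?m = d + e"
    using m_vars by (auto simp: monomials_def keys_add_mon)
  obtain f where f_lead: "f \<in> K \<inter> forms n (d + e)" "keys (f - single ?m 1) \<subseteq> below n ?m"
    using init init_mons_iff[OF ideal homogeneous, of ?m] unfolding mdeg by blast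
  have lead: "?m \<in> keys f" "\<And>q. q \<in> keys f \<Longrightarrow> q \<noteq> ?m \<Longrightarrow> mon_gt ?m q"
    using keys_minus_monomial_subset_below[OF f_lead(2)] by (auto simp: in_keys_iff below_def)
  let ?f = "trunc (Suc j) f"
  have "mon_dvd (single j e) q" if "q \<in> keys ?f" for q
  proof (cases "q = ?m")
    case False
    then have "lookup ?m j \<le> lookup q j"
      using that lead(2) f_lead(1) mdeg
      by (intro mon_gt_lookup_last_le) (auto simp: keys_trunc forms_iff_keys monomials_def)
    then show ?thesis
      by (simp add: mon_dvd_single_iff lookup_add)
  qed (simp add: mon_dvd_single_iff lookup_add)
  then obtain p where quotient: "?f = single (single j e) 1 * p"
    by (rule single_dvd_polyE)
  have "?f \<in> K" "?f \<in> forms n (d + e)"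
    using f_lead(1) trunc_mem_iff[OF is_ideal_polyR[OF ideal, of f]]
    by (auto simp: forms_iff_keys keys_trunc)
  then have "Var j ^ e * p \<in> K" "p \<in> forms n d"
    using Var_power_forms unfolding quotient Var_power[symmetric] by blast+
  moreover have "lm ?f = ?m" "?f \<noteq> 0"
    using lead vars by (auto simp: keys_trunc intro!: lm_eqI simp flip: keys_eq_empty)
  then have "p \<noteq> 0" "single j e + lm p = ?m"
    using lm_single_mult[of p "single j e"] unfolding quotient by auto
  ultimately show ?thesis
    using that by (simp add: add.commute)
qed

lemma mult_inj_mod_Var_powerD:
  assumes inj: "mult_inj_mod n K (Var j ^ e) d" and m_std: "m \<in> monomials n d" "m \<notin> init_mons n K"
  shows "m + single j e \<notin> init_mons n K"
proof
  have "keys m \<subseteq> {..<Suc j}"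
    using m_std later_vars_init_mons by (auto simp: monomials_def)
  moreover assume "m + single j e \<in> init_mons n K"
  ultimately obtain p where "p \<in> forms n d" "Var j ^ e * p \<in> K" "p \<noteq> 0" "lm p = m"
    by (rule init_mons_Var_powerE[OF m_std(1)])
  then show False
    using inj m_std(2) lm_in_init_mons[OF ideal, of p] unfolding mult_inj_mod_def by blast
qed

lemma mult_inj_mod_Var_powerI:
  assumes std: "\<And>m. m \<in> monomials n d \<Longrightarrow> m \<notin> init_mons n K \<Longrightarrow> m + single j e \<notin> init_mons n K"
  shows "mult_inj_mod n K (Var j ^ e) d"
  unfolding mult_inj_mod_def
proof (intro ballI impI)
  fix p assume p_form: "p \<in> forms n d" "Var j ^ e * p \<in> K"
  obtain r where normal_form: "r \<in> forms n d" "keys r \<inter> init_mons n K = {}" "p - r \<in> K"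
    using ex_normal_form[OF ideal homogeneous p_form(1)] .
  have "Var j ^ e * p - Var j ^ e * (p - r) \<in> K"
    using is_ideal_diff[OF ideal p_form(2)
        is_ideal_mult[OF ideal polyR_power[OF polyR_Var[OF j_less]] normal_form(3)]] .
  then have "single (single j e) 1 * r \<in> K"
    by (simp add: right_diff_distrib Var_power)
  moreover have "single (single j e) (1 :: 'k) \<noteq> 0"
    by (simp flip: keys_eq_empty)
  ultimately have "lm r + single j e \<in> init_mons n K" if "r \<noteq> 0"
    using that lm_in_init_mons[OF ideal, of "single (single j e) 1 * r"]
      lm_single_mult[of r "single j e"]
    by (simp add: add.commute)
  moreover have "lm r \<in> monomials n d" "lm r \<notin> init_mons n K" if "r \<noteq> 0"
    using lm_in_keys[OF that] normal_form(1,2) by (auto simp: forms_iff_keys)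
  ultimately have "r = 0"
    using std by blast
  then show "p \<in> K"
    using normal_form(3) by simp
qed

lemma mult_surj_mod_Var_powerD:
  assumes surj: "mult_surj_mod n K (Var j ^ e) d (d + e)"
    and m_std: "m \<in> monomials n (d + e)" "m \<notin> init_mons n K"
  shows "e \<le> lookup m j"
proof (rule ccontr)
  assume small: "\<not> e \<le> lookup m j"
  obtain p where p_form: "p \<in> forms n d" "single m 1 - Var j ^ e * p \<in> K"
    using surj forms_single[OF m_std(1)] unfolding mult_surj_mod_def by blast
  have big: "e \<le> lookup q j" "mdeg q = mdeg m" if "q \<in> keys (Var j ^ e * p)" for q
    using that p_form(1) m_std(1) Var_power_forms[of e p d]
    unfolding Var_power keys_single_mult forms_iff_keys
    by (auto simp: lookup_add monomials_def)
  have vars: "keys m \<subseteq> {..<Suc j}"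
    using m_std later_vars_init_mons by (auto simp: monomials_def)
  have "m \<in> init_mons n K"
  proof (rule init_monsI[OF p_form(2) _ vars])
    show "m \<in> keys (single m 1 - Var j ^ e * p)"
      using big(1)[of m] small by (auto simp: in_keys_iff lookup_minus)
    fix q assume q_key: "q \<in> keys (single m 1 - Var j ^ e * p)" "q \<noteq> m" "keys q \<subseteq> {..<Suc j}"
    then have "q \<in> keys (Var j ^ e * p)"
      by (auto simp: in_keys_iff lookup_minus lookup_single)
    then show "mon_gt m q"
      using big[of q] small vars q_key(3) by (intro lookup_last_less_imp_mon_gt) auto
  qed
  then show False
    using m_std(2) by simp
qed

lemma mult_surj_mod_Var_powerI:
  assumes std: "\<And>m. m \<in> monomials n (d + e) \<Longrightarrow> m \<notin> init_mons n K \<Longrightarrow> e \<le> lookup m j"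
  shows "mult_surj_mod n K (Var j ^ e) d (d + e)"
  unfolding mult_surj_mod_def
proof
  fix q :: "'k mpoly" assume q_form: "q \<in> forms n (d + e)"
  obtain r where normal_form: "r \<in> forms n (d + e)" "keys r \<inter> init_mons n K = {}" "q - r \<in> K"
    using ex_normal_form[OF ideal homogeneous q_form] .
  then have "mon_dvd (single j e) m" if "m \<in> keys r" for m
    using that std by (auto simp: mon_dvd_single_iff forms_iff_keys)
  then obtain p where "r = Var j ^ e * p"
    unfolding Var_power by (rule single_dvd_polyE)
  then show "\<exists>p\<in>forms n d. q - Var j ^ e * p \<in> K"
    using normal_form(1,3) Var_power_forms by blast
qed

theorem lefschetz_element_Var_iff: "lefschetz_element n K (Var j) \<longleftrightarrow> mono_lefschetz n (init_mons n K) j"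
  unfolding lefschetz_element_def mono_lefschetz_def
  by (meson mult_inj_mod_Var_powerD mult_inj_mod_Var_powerI mult_surj_mod_Var_powerD
      mult_surj_mod_Var_powerI)

end

lemma init_mons_mono: "J \<subseteq> K \<Longrightarrow> init_mons n J \<subseteq> init_mons n K"
  by (auto simp: init_mons_def)

lemma ideal_plus_later_varsE:
  assumes f_mem: "f \<in> ideal_plus n J L i" and L_Var: "\<And>l. l < i \<Longrightarrow> \<exists>b\<ge>k. L l = Var b"
  obtains q where "q \<in> J" "\<And>m. keys m \<subseteq> {..<k} \<Longrightarrow> lookup q m = lookup f m"
proof -
  obtain q r where f_eq: "f = q + (\<Sum>l<i. r l * L l)" "q \<in> J"
    using f_mem unfolding ideal_plus_def by blast
  have "lookup (r l * L l) m = 0" if l_less: "l < i" and m_vars: "keys m \<subseteq> {..<k}" for l m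
  proof -
    obtain b where "b \<ge> k" "L l = Var b"
      using L_Var[OF l_less] by blast
    then have "r l * L l = single (single b 1) 1 * r l"
      by (simp add: Var_def var_mon_def mult.commute)
    then have "m \<in> keys (r l * L l) \<Longrightarrow> b \<in> keys m"
      by (auto simp: keys_single_mult keys_add_mon)
    then show ?thesis
      using m_vars \<open>b \<ge> k\<close> by (meson in_keys_iff lessThan_iff not_le subsetD)
  qed
  then show ?thesis
    using that[OF f_eq(2)] by (simp add: f_eq(1) lookup_add lookup_sum)
qed

lemma init_mons_kill_later_vars_iff:
  fixes J :: "'k::field mpoly set"
  assumes ideal_J: "is_ideal n J" "homogeneous_ideal J"
    and ideal_K: "is_ideal n (ideal_plus n J L i)" "homogeneous_ideal (ideal_plus n J L i)"
    and L_Var: "\<And>l. l < i \<Longrightarrow> \<exists>b\<ge>k. L l = Var b"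
    and m_vars: "keys m \<subseteq> {..<k}"
  shows "m \<in> init_mons n (ideal_plus n J L i) \<longleftrightarrow> m \<in> init_mons n J"
proof
  assume "m \<in> init_mons n (ideal_plus n J L i)"
  then obtain f where f_lead: "f \<in> ideal_plus n J L i" "keys (f - single m 1) \<subseteq> below n m"
    using init_mons_iff[OF ideal_K] by blast
  note lead = keys_minus_monomial_subset_below[OF f_lead(2)]
  obtain q where q_agrees: "q \<in> J" "\<And>a. keys a \<subseteq> {..<k} \<Longrightarrow> lookup q a = lookup f a"
    using ideal_plus_later_varsE[OF f_lead(1) L_Var] by blast
  define g where "g = homog_comp (mdeg m) q"
  have m_keys: "m \<in> keys g"
    using q_agrees(2)[OF m_vars] lead(1) by (simp add: g_def in_keys_iff lookup_homog_comp)
  have "mon_gt m a" if a_key: "a \<in> keys g" "a \<noteq> m" for a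
  proof -
    have deg: "mdeg a = mdeg m" "lookup q a \<noteq> 0"
      using a_key by (auto simp: g_def in_keys_iff lookup_homog_comp split: if_splits)
    show ?thesis
    proof (cases "keys a \<subseteq> {..<k}")
      case True
      then have "a \<in> keys f"
        using deg(2) q_agrees(2) by (simp add: in_keys_iff)
      then show ?thesis
        using lead(2) a_key(2) by (auto simp: below_def)
    next
      case False
      then show ?thesis
        using mon_gt_of_extra_var m_vars deg(1) by simp
    qed
  qed
  with m_keys have "lm g = m" "g \<noteq> 0"
    by (auto intro: lm_eqI)
  moreover have "g \<in> J"
    using ideal_J(2) q_agrees(1) by (simp add: g_def homogeneous_ideal_def)
  ultimately show "m \<in> init_mons n J"
    using lm_in_init_mons[OF ideal_J(1)] by blast
qed (use init_mons_mono[OF ideal_plus_superset] in blast)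

lemma mono_lefschetz_restrict_vars:
  assumes agree: "\<And>m. keys m \<subseteq> {..<Suc j} \<Longrightarrow> m \<in> H \<longleftrightarrow> m \<in> G"
    and later: "\<And>m. keys m \<subseteq> {..<n} \<Longrightarrow> \<not> keys m \<subseteq> {..<Suc j} \<Longrightarrow> m \<in> H"
    and "j < n"
  shows "mono_lefschetz n H j \<longleftrightarrow> mono_lefschetz (Suc j) G j"
proof -
  have std: "m \<in> monomials n d \<and> m \<notin> H \<longleftrightarrow> m \<in> monomials (Suc j) d \<and> m \<notin> G" for m d
    using agree later \<open>j < n\<close> by (fastforce simp: monomials_def)
  have "m + single j e \<in> H \<longleftrightarrow> m + single j e \<in> G" if "m \<in> monomials (Suc j) d" for m d e
    using that by (intro agree) (auto simp: monomials_def keys_add_mon)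
  then have "(\<forall>m\<in>monomials n d. m \<notin> H \<longrightarrow> m + single j e \<notin> H) \<longleftrightarrow>
      (\<forall>m\<in>monomials (Suc j) d. m \<notin> G \<longrightarrow> m + single j e \<notin> G)" for d e
    using std by meson
  moreover have "(\<forall>m\<in>monomials n d. m \<notin> H \<longrightarrow> e \<le> lookup m j) \<longleftrightarrow>
      (\<forall>m\<in>monomials (Suc j) d. m \<notin> G \<longrightarrow> e \<le> lookup m j)" for d e
    using std by meson
  ultimately show ?thesis
    by (simp add: mono_lefschetz_def)
qed

lemma lefschetz_element_kill_later_vars_iff:
  fixes J :: "'k::field mpoly set"
  assumes ideal_J: "is_ideal n J" "homogeneous_ideal J" and i_less: "i < n"
  shows "lefschetz_element n (ideal_plus n J (\<lambda>l. Var (n - 1 - l)) i) (Var (n - 1 - i)) \<longleftrightarrow>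
    mono_lefschetz (n - i) (init_mons n J) (n - 1 - i)"
proof -
  let ?j = "n - 1 - i" and ?K = "ideal_plus n J (\<lambda>l. Var (n - 1 - l)) i"
  interpret ideal_with_later_vars n ?j ?K
  proof
    show "is_ideal n ?K"
      using i_less by (intro is_ideal_ideal_plus[OF ideal_J(1)]) simp
    show "homogeneous_ideal ?K"
      using i_less by (intro homogeneous_ideal_plus[OF ideal_J(2)] forms_Var) simp
    show "?j < n"
      using i_less by simp
    show "Var l \<in> ?K" if "?j < l" "l < n" for l
      using ideal_plus_generator[of J "n - 1 - l" i "\<lambda>l. Var (n - 1 - l)" n] ideal_J(1) that i_less
      by (simp add: is_ideal_def)
  qed
  have "\<exists>b\<ge>Suc ?j. (Var (n - 1 - l) :: 'k mpoly) = Var b" if "l < i" for l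
    using that i_less by (intro exI[of _ "n - 1 - l"]) auto
  then have "m \<in> init_mons n ?K \<longleftrightarrow> m \<in> init_mons n J" if "keys m \<subseteq> {..<Suc ?j}" for m
    using that by (rule init_mons_kill_later_vars_iff[OF ideal_J ideal homogeneous])
  then have "mono_lefschetz n (init_mons n ?K) ?j \<longleftrightarrow> mono_lefschetz (Suc ?j) (init_mons n J) ?j"
    using later_vars_init_mons i_less by (intro mono_lefschetz_restrict_vars) auto
  then show ?thesis
    unfolding lefschetz_element_Var_iff using i_less by (simp add: Suc_diff_Suc)
qed

subsection \<open>Openness of the Lefschetz condition\<close>

definition mult_rank :: "nat \<Rightarrow> 'k::field mpoly set \<Rightarrow> 'k mpoly \<Rightarrow> nat \<Rightarrow> nat \<Rightarrow> nat" where
  "mult_rank n J f d e = mp.dim (J \<inter> forms n e \<union> (*) f ` forms n d)"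

lemma mult_inj_mod_iff_rank:
  fixes J :: "'k::field mpoly set"
  assumes ideal_J: "is_ideal n J" and f_form: "f \<in> forms n e"
  shows "mult_inj_mod n J f d \<longleftrightarrow>
    mp.dim (forms n d :: 'k mpoly set) + mp.dim (J \<inter> forms n (d + e)) \<le>
    mult_rank n J f d (d + e) + mp.dim (J \<inter> forms n d)"
proof -
  let ?N = "{p \<in> forms n d. f * p \<in> J \<inter> forms n (d + e)}"
  have "f * p \<in> forms n (d + e)" if "p \<in> forms n d" for p
    using forms_mult[OF f_form that] by (simp add: add.commute)
  then have kernel_eq: "?N = {p \<in> forms n d. f * p \<in> J}"
    by blast
  have "mp.dim ?N + mult_rank n J f d (d + e) =
      mp.dim (forms n d :: 'k mpoly set) + mp.dim (J \<inter> forms n (d + e))"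
    unfolding mult_rank_def
    by (intro mp.dim_linear_preimage mpoly_linear_mult subspace_forms subspace_ideal_forms[OF ideal_J]
        fin_dim_forms fin_dim_subset_forms[OF Int_lower2])
  then have "mp.dim (forms n d :: 'k mpoly set) + mp.dim (J \<inter> forms n (d + e)) \<le>
      mult_rank n J f d (d + e) + mp.dim (J \<inter> forms n d) \<longleftrightarrow> mp.dim ?N \<le> mp.dim (J \<inter> forms n d)"
    by linarith
  also have "\<dots> \<longleftrightarrow> ?N \<subseteq> J \<inter> forms n d"
  proof -
    have "mp.fin_dim ?N"
      by (rule fin_dim_subset_forms[of _ n d]) blast
    moreover have "J \<inter> forms n d \<subseteq> ?N"
      using is_ideal_mult[OF ideal_J forms_polyR[OF f_form]] unfolding kernel_eq by blast
    then have "J \<inter> forms n d \<subseteq> mp.span ?N"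
      using mp.span_superset by (rule subset_trans)
    ultimately show ?thesis
      by (simp only: mp.dim_le_iff_subset_span span_ideal_forms[OF ideal_J])
  qed
  finally show ?thesis
    unfolding mult_inj_mod_def kernel_eq by blast
qed

lemma mult_surj_mod_iff_rank:
  fixes J :: "'k::field mpoly set"
  assumes ideal_J: "is_ideal n J" and f_form: "f \<in> forms n e"
  shows "mult_surj_mod n J f d (d + e) \<longleftrightarrow>
      mp.dim (forms n (d + e) :: 'k mpoly set) \<le> mult_rank n J f d (d + e)"
proof -
  interpret f: Vector_Spaces.linear "\<lambda>(c::'k) p. const c * p" "\<lambda>c p. const c * p" "(*) f"
    by (rule mpoly_linear_mult)
  let ?X = "J \<inter> forms n (d + e) \<union> (*) f ` forms n d"
  have f_forms: "f * p \<in> forms n (d + e)" if "p \<in> forms n d" for p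
    using forms_mult[OF f_form that] by (simp add: add.commute)
  then have X_forms: "?X \<subseteq> forms n (d + e)"
    by blast
  have span_X: "mp.span ?X = {p + q | p q. p \<in> J \<inter> forms n (d + e) \<and> q \<in> (*) f ` forms n d}"
    unfolding mp.span_Un span_ideal_forms[OF ideal_J] f.span_image span_forms ..
  have "mult_surj_mod n J f d (d + e) \<longleftrightarrow> forms n (d + e) \<subseteq> mp.span ?X"
  proof
    assume surj: "mult_surj_mod n J f d (d + e)"
    show "forms n (d + e) \<subseteq> mp.span ?X"
    proof
      fix q :: "'k mpoly" assume q_form: "q \<in> forms n (d + e)"
      then obtain p where p_form: "p \<in> forms n d" "q - f * p \<in> J"
        using surj unfolding mult_surj_mod_def by blast
      then have "q = (q - f * p) + f * p" "q - f * p \<in> J \<inter> forms n (d + e)"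
        using forms_diff[OF q_form f_forms] by auto
      then show "q \<in> mp.span ?X"
        unfolding span_X using p_form(1) by blast
    qed
  next
    assume "forms n (d + e) \<subseteq> mp.span ?X"
    then show "mult_surj_mod n J f d (d + e)"
      unfolding mult_surj_mod_def span_X by force
  qed
  also have "\<dots> \<longleftrightarrow> mp.dim (forms n (d + e) :: 'k mpoly set) \<le> mult_rank n J f d (d + e)"
    unfolding mult_rank_def using X_forms
    by (intro mp.dim_le_iff_subset_span[symmetric] fin_dim_forms) simp
  finally show ?thesis .
qed

lemma eventually_mult_rank_ge:
  fixes J :: "'k::field mpoly set"
  assumes "polyfam N f"
  shows "\<forall>\<^sub>F v in zariski_nhds N a. mult_rank n J (f a) d e \<le> mult_rank n J (f v) d e"
  unfolding mult_rank_def
  by (intro dim_Un_image_semicontinuous mpoly_linear_mult polyfam_mult assms polyfam_const fin_dim_forms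
      fin_dim_subset_forms[OF Int_lower2])

lemma eventually_lefschetz_element:
  fixes J :: "'k::field_char_0 mpoly set"
  assumes ideal_J: "is_ideal n J" and high: "\<And>d. d \<ge> D \<Longrightarrow> forms n d \<subseteq> J" and slp: "slp n J"
  shows "\<forall>\<^sub>F c in zariski_generic n. lefschetz_element n J (linform n c)"
proof -
  obtain L where "L \<in> forms n 1" "lefschetz_element n J L"
    using slp slp_iff_lefschetz_element by blast
  then obtain c where c_lefschetz: "lefschetz_element n J (linform n c)"
    using forms_1_eq_linform by metis
  let ?P = "\<lambda>c d i. mult_inj_mod n J (linform n c ^ i) d \<or>
    mult_surj_mod n J (linform n c ^ i) d (d + i)"
  have L_forms: "linform n c' ^ i \<in> forms n i" for c' :: "nat \<Rightarrow> 'k" and i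
    using forms_power[OF linform_in_forms, of n c' i] by simp
  have "\<forall>\<^sub>F c' in zariski_nhds n c. ?P c' d i" for d i
  proof -
    have "\<forall>\<^sub>F c' in zariski_nhds n c.
        mult_rank n J (linform n c ^ i) d (d + i) \<le> mult_rank n J (linform n c' ^ i) d (d + i)"
      by (intro eventually_mult_rank_ge polyfam_power polyfam_linform polyfun_coord)
    then show ?thesis
      by (rule eventually_mono) (use c_lefschetz in \<open>auto simp: lefschetz_element_def
        mult_inj_mod_iff_rank[OF ideal_J L_forms] mult_surj_mod_iff_rank[OF ideal_J L_forms]
        dest: spec2[of _ d i]\<close>)
  qed
  then have "\<forall>\<^sub>F c' in zariski_nhds n c. \<forall>(d, i)\<in>{..<D} \<times> {..<D}. ?P c' d i"
    by (intro eventually_ball_finite) auto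
  moreover have "?P c' d i" if "(d, i) \<notin> {..<D} \<times> {..<D}" for c' d i
  proof -
    have "q - linform n c' ^ i * 0 \<in> J" if "q \<in> forms n (d + i)" for q
      using that high[of "d + i"] \<open>(d, i) \<notin> {..<D} \<times> {..<D}\<close> by auto
    then show ?thesis
      unfolding mult_surj_mod_def using forms_0 by blast
  qed
  ultimately have "\<forall>\<^sub>F c' in zariski_nhds n c. \<forall>d i. ?P c' d i"
    by (elim eventually_mono) blast
  then have "\<forall>\<^sub>F c' in zariski_nhds n c. lefschetz_element n J (linform n c')"
    unfolding lefschetz_element_def .
  then show ?thesis
    by (rule eventually_nhds_imp_generic)
qed

subsection \<open>General linear sections\<close>

lemma lin_in_forms: "lin n u j \<in> forms n 1"
  unfolding lin_eq_linform by (rule linform_in_forms)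

lemma ideal_plus_splice:
  "ideal_plus n I (lin n (splice (n * i) u v)) i = ideal_plus n I (lin n u) i"
  unfolding lin_eq_linform
  by (intro ideal_plus_cong linform_cong) (simp add: splice_def matrix_index_less)

lemma lin_splice: "lin n (splice (n * i) u v) i = lin n v i"
  unfolding lin_eq_linform by (intro linform_cong) (simp add: splice_def mult.commute)

lemma eventually_row:
  fixes P :: "(nat \<Rightarrow> 'k::field_char_0) \<Rightarrow> bool"
  assumes "\<forall>\<^sub>F c in zariski_generic n. P c" "i < n"
  shows "\<forall>\<^sub>F u in zariski_generic (n * n). P (\<lambda>l. u (i * n + l))"
proof -
  have "filterlim (\<lambda>u l. u (i * n + l))
      (zariski_generic n) (zariski_generic (n * n) :: (nat \<Rightarrow> 'k) filter)"
  proof (rule filterlim_zariski_generic)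
    show "polyfun (n * n) (\<lambda>u :: nat \<Rightarrow> 'k. u (i * n + l))" if "l < n" for l
      using that assms(2) by (intro polyfun_coord matrix_index_less)
    show "\<exists>u. \<forall>l<n. u (i * n + l) = c l" for c :: "nat \<Rightarrow> 'k"
      by (intro exI[of _ "\<lambda>k. c (k - i * n)"]) simp
  qed
  then show ?thesis
    using assms(1) unfolding filterlim_iff by blast
qed

context artinian_ideal
begin

text \<open>The rows are listed in reverse order: the form killed first corresponds to the last variable.\<close>

definition maximal_rows :: "(nat \<Rightarrow> 'k) \<Rightarrow> bool" where
  "maximal_rows u \<longleftrightarrow> (\<exists>v w. inverse_pair n v w \<and> maximal_coords v \<and>
     (\<forall>k<n. gsubst n w k = lin n u (n - 1 - k)))"

lemma eventually_maximal_rows: "\<forall>\<^sub>F u in zariski_generic (n * n). maximal_rows u"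
proof -
  define reverse where "reverse = (\<lambda>(u :: nat \<Rightarrow> 'k) x. u ((n - 1 - x mod n) * n + x div n))"
  have index: "x div n < n" "x mod n < n" "n - 1 - x mod n < n" if "x < n * n" for x
  proof -
    have "0 < n"
      using that by (cases n) auto
    then show "x div n < n" "x mod n < n" "n - 1 - x mod n < n"
      using that by (simp_all add: less_mult_imp_div_less)
  qed
  have "filterlim reverse (zariski_generic (n * n)) (zariski_generic (n * n))"
  proof (rule filterlim_zariski_generic)
    show "polyfun (n * n) (\<lambda>u. reverse u x)" if "x < n * n" for x
      unfolding reverse_def using index[OF that] by (intro polyfun_coord matrix_index_less)
    show "\<exists>u. \<forall>x<n * n. reverse u x = w x" for w
    proof (intro exI[of _ "\<lambda>y. w ((y mod n) * n + (n - 1 - y div n))"] allI impI)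
      fix x assume "x < n * n"
      note index = index[OF this]
      let ?y = "(n - 1 - x mod n) * n + x div n"
      have "?y mod n = x div n" "?y div n = n - 1 - x mod n"
        using index(1) by simp_all
      moreover have "n - 1 - (n - 1 - x mod n) = x mod n"
        using index(2) by linarith
      ultimately show "reverse (\<lambda>y. w ((y mod n) * n + (n - 1 - y div n))) x = w x"
        unfolding reverse_def by (simp only: div_mult_mod_eq)
    qed
  qed
  then have "\<forall>\<^sub>F u in zariski_generic (n * n). \<exists>v. inverse_pair n v (reverse u) \<and> maximal_coords v"
    using eventually_maximal_coords(2) unfolding filterlim_iff by blast
  then show ?thesis
  proof eventually_elim
    case (elim u)
    moreover have "gsubst n (reverse u) k = lin n u (n - 1 - k)" if "k < n" for k
      using that by (simp add: gsubst_eq_linform lin_eq_linform reverse_def cong: linform_cong)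
    ultimately show ?case
      unfolding maximal_rows_def by blast
  qed
qed

lemma lefschetz_element_maximal_rows:
  assumes maximal_u: "maximal_rows u" and i_less: "i < n"
  shows "lefschetz_element n (ideal_plus n I (lin n u) i) (lin n u i) \<longleftrightarrow>
    mono_lefschetz (n - i) (gin n I) (n - 1 - i)"
proof -
  obtain v w where inverse: "inverse_pair n v w" and maximal_v: "maximal_coords v"
    and row: "\<And>k. k < n \<Longrightarrow> gsubst n w k = lin n u (n - 1 - k)"
    using maximal_u unfolding maximal_rows_def by blast
  note invertible = inverse_pair_imp_mat_invertible[OF inverse]
  have act_lin: "act n v (lin n u l) = Var (n - 1 - l)" if "l < n" for l
    using row[of "n - 1 - l"] inverse_pairD(1)[OF inverse polyR_Var, of "n - 1 - l"] that by simp
  have lin_polyR: "lin n u l \<in> polyR n" for l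
    by (rule forms_polyR[OF lin_in_forms])
  then have "is_ideal n (ideal_plus n I (lin n u) i)"
    by (intro is_ideal_ideal_plus[OF ideal])
  then have "lefschetz_element n (ideal_plus n I (lin n u) i) (lin n u i) \<longleftrightarrow>
      lefschetz_element n (gact n v (ideal_plus n I (lin n u) i)) (act n v (lin n u i))"
    using lefschetz_element_gact[OF invertible _ lin_polyR] by simp
  also have "gact n v (ideal_plus n I (lin n u) i) = ideal_plus n (gact n v I) (\<lambda>l. Var (n - 1 - l)) i"
    unfolding gact_ideal_plus[OF invertible] using i_less by (intro ideal_plus_cong act_lin) simp
  also have "act n v (lin n u i) = Var (n - 1 - i)"
    by (rule act_lin[OF i_less])
  also have "lefschetz_element n (ideal_plus n (gact n v I) (\<lambda>l. Var (n - 1 - l)) i) (Var (n - 1 - i)) \<longleftrightarrow>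
      mono_lefschetz (n - i) (init_mons n (gact n v I)) (n - 1 - i)"
    using is_ideal_gact[OF invertible ideal] homogeneous_gact[OF invertible ideal homogeneous] i_less
    by (rule lefschetz_element_kill_later_vars_iff)
  finally show ?thesis
    unfolding gin_eq_init_mons[OF maximal_v] .
qed

lemma slp_ideal_plus_imp_lefschetz_row:
  assumes "slp n (ideal_plus n I (lin n u) i)" "i < n"
  shows "\<forall>\<^sub>F v in zariski_generic (n * n). lefschetz_element n (ideal_plus n I (lin n u) i) (lin n v i)"
proof -
  obtain D where high_degree: "\<And>d. d \<ge> D \<Longrightarrow> forms n d \<subseteq> I"
    using ex_forms_subset_bound by blast
  have "is_ideal n (ideal_plus n I (lin n u) i)"
    by (intro is_ideal_ideal_plus[OF ideal] forms_polyR[OF lin_in_forms])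
  moreover have "forms n d \<subseteq> ideal_plus n I (lin n u) i" if "d \<ge> D" for d
    using high_degree[OF that] ideal_plus_superset by (rule subset_trans)
  ultimately have "\<forall>\<^sub>F c in zariski_generic n.
      lefschetz_element n (ideal_plus n I (lin n u) i) (linform n c)"
    using assms(1) by (rule eventually_lefschetz_element)
  then show ?thesis
    unfolding lin_eq_linform using assms(2) by (rule eventually_row)
qed

lemma generic_slp_imp_mono_lefschetz:
  assumes generic: "generic (n * i) (\<lambda>u. slp n (ideal_plus n I (lin n u) i))" and i_less: "i < n"
  shows "mono_lefschetz (n - i) (gin n I) (n - 1 - i)"
proof -
  have "n * i \<le> n * n"
    using i_less by (intro mult_le_mono2) simp
  then have "\<forall>\<^sub>F u in zariski_generic (n * n). slp n (ideal_plus n I (lin n u) i)"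
    using generic[folded eventually_zariski_generic] by (rule filter_leD[OF zariski_generic_antimono])
  with eventually_splice_right[OF eventually_maximal_rows, of "n * i"]
  have "\<forall>\<^sub>F u in zariski_generic (n * n). slp n (ideal_plus n I (lin n u) i) \<and>
      (\<forall>\<^sub>F v in zariski_generic (n * n). maximal_rows (splice (n * i) u v))"
    by eventually_elim blast
  then obtain u where slp: "slp n (ideal_plus n I (lin n u) i)"
    and maximal: "\<forall>\<^sub>F v in zariski_generic (n * n). maximal_rows (splice (n * i) u v)"
    using eventually_happens'[OF zariski_generic_neq_bot] by blast
  from maximal slp_ideal_plus_imp_lefschetz_row[OF slp i_less]
  have "\<forall>\<^sub>F v :: nat \<Rightarrow> 'k in zariski_generic (n * n). mono_lefschetz (n - i) (gin n I) (n - 1 - i)"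
  proof eventually_elim
    case (elim v)
    then show ?case
      using lefschetz_element_maximal_rows[OF elim(1) i_less]
      by (simp only: ideal_plus_splice lin_splice)
  qed
  then show ?thesis
    by simp
qed

lemma mono_lefschetz_imp_generic_slp:
  assumes lefschetz: "mono_lefschetz (n - i) (gin n I) (n - 1 - i)" and i_less: "i < n"
  shows "generic (n * i) (\<lambda>u. slp n (ideal_plus n I (lin n u) i))"
proof -
  obtain v where "\<forall>\<^sub>F u in zariski_generic (n * i). maximal_rows (splice (n * i) u v)"
    using eventually_splice_left[OF eventually_maximal_rows] .
  then show ?thesis
    unfolding eventually_zariski_generic[symmetric]
  proof eventually_elim
    case (elim u)
    have "lefschetz_element n (ideal_plus n I (lin n u) i) (lin n v i)"
      using lefschetz_element_maximal_rows[OF elim i_less] lefschetz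
      by (simp only: ideal_plus_splice lin_splice)
    then show ?case
      unfolding slp_iff_lefschetz_element using lin_in_forms by blast
  qed
qed

theorem generic_slp_iff_mono_lefschetz:
  "(\<forall>i. i + 3 \<le> n \<longrightarrow> generic (n * i) (\<lambda>u. slp n (ideal_plus n I (lin n u) i))) \<longleftrightarrow>
    (\<forall>j. 2 \<le> j \<and> j < n \<longrightarrow> mono_lefschetz (Suc j) (gin n I) j)"
proof (intro iffI allI impI)
  fix j assume generic: "\<forall>i. i + 3 \<le> n \<longrightarrow> generic (n * i) (\<lambda>u. slp n (ideal_plus n I (lin n u) i))"
    and j_range: "2 \<le> j \<and> j < n"
  then have "n - 1 - j + 3 \<le> n"
    by linarith
  then show "mono_lefschetz (Suc j) (gin n I) j"
    using generic_slp_imp_mono_lefschetz[OF generic[rule_format]] j_range by fastforce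
next
  fix i assume "\<forall>j. 2 \<le> j \<and> j < n \<longrightarrow> mono_lefschetz (Suc j) (gin n I) j" "i + 3 \<le> n"
  then have "mono_lefschetz (Suc (n - 1 - i)) (gin n I) (n - 1 - i)" "i < n"
    by auto
  then show "generic (n * i) (\<lambda>u. slp n (ideal_plus n I (lin n u) i))"
    using mono_lefschetz_imp_generic_slp[of i] by (simp add: Suc_diff_Suc)
qed

end

section \<open>Almost reverse lexicographic monomial ideals\<close>

definition fval_antimono :: "mon set \<Rightarrow> nat \<Rightarrow> bool" where
  "fval_antimono G i \<longleftrightarrow> (\<forall>\<alpha>\<in>Jset G i. \<forall>\<beta>\<in>Jset G i.
     sum_list \<alpha> = sum_list \<beta> \<and> mon_gt (Poly_Mapping.nth \<beta>) (Poly_Mapping.nth \<alpha>) \<longrightarrow> fval G \<beta> \<le> fval G \<alpha>)"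

definition equal_degree_antimono :: "mon set \<Rightarrow> nat \<Rightarrow> bool" where
  "equal_degree_antimono G i \<longleftrightarrow> (\<forall>a b t. keys a \<subseteq> {..<i} \<longrightarrow> keys b \<subseteq> {..<i} \<longrightarrow> a \<notin> G \<longrightarrow> b \<notin> G \<longrightarrow>
     mdeg a = mdeg b \<longrightarrow> mon_gt b a \<longrightarrow> a + single i t \<in> G \<longrightarrow> b + single i t \<in> G)"

locale strongly_stable =
  fixes n :: nat and G :: "mon set"
  assumes vars: "m \<in> G \<Longrightarrow> keys m \<subseteq> {..<n}"
    and mult: "m \<in> G \<Longrightarrow> keys q \<subseteq> {..<n} \<Longrightarrow> m + q \<in> G"
    and stable: "m + single b 1 \<in> G \<Longrightarrow> a < b \<Longrightarrow> b < n \<Longrightarrow> m + single a 1 \<in> G"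
begin

lemma mon_dvd_mem:
  assumes "a \<in> G" "mon_dvd a b" "keys b \<subseteq> {..<n}"
  shows "b \<in> G"
  using assms mult by (auto simp: mon_dvd_def keys_add_mon)

lemma fval_le_enat_iff:
  assumes "length \<alpha> < n"
  shows "fval G \<alpha> \<le> enat t \<longleftrightarrow> Poly_Mapping.nth \<alpha> + single (length \<alpha>) t \<in> G"
proof
  let ?P = "\<lambda>s. Poly_Mapping.nth \<alpha> + single (length \<alpha>) s \<in> G"
  assume "fval G \<alpha> \<le> enat t"
  then have ex_mem: "\<exists>s. ?P s" and "(LEAST s. ?P s) \<le> t"
    by (auto simp: fval_def split: if_splits)
  then have "mon_dvd (Poly_Mapping.nth \<alpha> + single (length \<alpha>) (LEAST s. ?P s))
      (Poly_Mapping.nth \<alpha> + single (length \<alpha>) t)"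
    by (simp add: mon_dvd_iff lookup_add lookup_single when_def)
  moreover have "keys (Poly_Mapping.nth \<alpha> + single (length \<alpha>) t) \<subseteq> {..<n}"
    using keys_nth_list[of \<alpha>] assms by (auto simp: keys_add_mon simp del: keys_nth split: if_splits)
  ultimately show "?P t"
    using mon_dvd_mem[OF LeastI_ex[OF ex_mem]] by blast
qed (auto simp: fval_def intro: Least_le)

lemma Jset_eq:
  assumes "1 \<le> i" "i \<le> n"
  shows "Jset G i = {\<alpha>. length \<alpha> = i \<and> Poly_Mapping.nth \<alpha> \<notin> G}"
proof -
  have prefix: "enat (\<alpha> ! l) < fval G (take l \<alpha>) \<longleftrightarrow> Poly_Mapping.nth (take (Suc l) \<alpha>) \<notin> G"
    if "length \<alpha> = i" "l < i" for \<alpha> l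
  proof -
    have "Poly_Mapping.nth (take (Suc l) \<alpha>) = Poly_Mapping.nth (take l \<alpha>) + single l (\<alpha> ! l)"
      using that
      by (intro poly_mapping_eqI)
        (auto simp: lookup_nth_list lookup_add lookup_single when_def simp del: lookup_nth)
    then show ?thesis
      using fval_le_enat_iff[of "take l \<alpha>" "\<alpha> ! l"] that assms(2) by (simp flip: not_le)
  qed
  have "Poly_Mapping.nth \<alpha> \<in> G" if "length \<alpha> = i" "Poly_Mapping.nth (take l \<alpha>) \<in> G" for \<alpha> l
  proof (rule mon_dvd_mem[OF that(2)])
    show "mon_dvd (Poly_Mapping.nth (take l \<alpha>)) (Poly_Mapping.nth \<alpha>)"
      by (simp add: mon_dvd_iff lookup_nth_list del: lookup_nth)
    show "keys (Poly_Mapping.nth \<alpha>) \<subseteq> {..<n}"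
      using keys_nth_list[of \<alpha>] that(1) assms(2) by (auto simp del: keys_nth)
  qed
  moreover have "Poly_Mapping.nth (take (Suc (i - 1)) \<alpha>) = Poly_Mapping.nth \<alpha>"
    if "length \<alpha> = i" for \<alpha> :: "nat list"
    using that assms(1) by simp
  ultimately show ?thesis
    using prefix assms(1) unfolding Jset_def
    by (metis (no_types, lifting) One_nat_def Suc_diff_1 Suc_le_eq lessI)
qed

lemma fval_antimono_iff:
  assumes "1 \<le> i" "i < n"
  shows "fval_antimono G i \<longleftrightarrow> equal_degree_antimono G i"
proof -
  have le_iff: "fval G \<beta> \<le> fval G \<alpha> \<longleftrightarrow>
      (\<forall>t. Poly_Mapping.nth \<alpha> + single i t \<in> G \<longrightarrow> Poly_Mapping.nth \<beta> + single i t \<in> G)"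
    if "length \<alpha> = i" "length \<beta> = i" for \<alpha> \<beta>
  proof -
    have "fval G \<beta> \<le> fval G \<alpha> \<longleftrightarrow> (\<forall>t. fval G \<alpha> \<le> enat t \<longrightarrow> fval G \<beta> \<le> enat t)"
      by (cases "fval G \<alpha>") (auto intro: order_trans)
    then show ?thesis
      using fval_le_enat_iff that assms(2) by simp
  qed
  have nth_lists: "Poly_Mapping.nth ` {\<alpha>. length \<alpha> = i} = {a :: mon. keys a \<subseteq> {..<i}}"
  proof (intro equalityI subsetI CollectI image_eqI)
    fix a :: mon assume "a \<in> {a. keys a \<subseteq> {..<i}}"
    then show "a = Poly_Mapping.nth (map (lookup a) [0..<i])"
      by (simp add: nth_map_lookup)
  qed (use keys_nth_list in \<open>auto simp del: keys_nth\<close>)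
  have "fval_antimono G i \<longleftrightarrow>
      (\<forall>a\<in>Poly_Mapping.nth ` {\<alpha>. length \<alpha> = i}. \<forall>b\<in>Poly_Mapping.nth ` {\<alpha>. length \<alpha> = i}.
        a \<notin> G \<longrightarrow> b \<notin> G \<longrightarrow> mdeg a = mdeg b \<longrightarrow> mon_gt b a \<longrightarrow>
        (\<forall>t. a + single i t \<in> G \<longrightarrow> b + single i t \<in> G))"
    using assms le_iff unfolding fval_antimono_def by (auto simp: Jset_eq mdeg_nth_list)
  also have "\<dots> \<longleftrightarrow> equal_degree_antimono G i"
    unfolding nth_lists equal_degree_antimono_def by blast
  finally show ?thesis .
qed

lemma ex_min_gen_dvd: "m \<in> G \<Longrightarrow> \<exists>g. min_gen G g \<and> mon_dvd g m"
proof (induction "mdeg m" arbitrary: m rule: less_induct)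
  case less
  show ?case
  proof (cases "min_gen G m")
    case True
    then show ?thesis
      by (auto simp: mon_dvd_iff)
  next
    case False
    then obtain a where a_mem: "a \<in> G" "mon_dvd a m" "a \<noteq> m"
      using less.prems by (auto simp: min_gen_def)
    then have "mdeg a < mdeg m"
      using mon_dvd_mdeg mon_dvd_mdeg_eq le_neq_implies_less by blast
    then obtain g where "min_gen G g" "mon_dvd g a"
      using less.hyps a_mem(1) by blast
    then show ?thesis
      using a_mem(2) by (auto simp: mon_dvd_iff intro: order_trans)
  qed
qed

lemma ex_min_gen_on_string:
  assumes "m \<notin> G" "m + single j e \<in> G" "keys m \<subseteq> {..<Suc j}"
  obtains a s where "min_gen G (a + single j s)" "keys a \<subseteq> {..<j}" "mon_dvd a m" "1 \<le> s"
    "mon_dvd (a + single j s) (m + single j e)"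
proof -
  obtain g where g_gen: "min_gen G g" "mon_dvd g (m + single j e)"
    using ex_min_gen_dvd[OF assms(2)] by blast
  have "keys g \<subseteq> {..<Suc j}"
    using mon_dvd_keys[OF g_gen(2)] assms(3) by (auto simp: keys_add_mon split: if_splits)
  then obtain a where g_eq: "g = a + single j (lookup g j)" "keys a \<subseteq> {..<j}"
    by (rule split_last_var)
  have "mon_dvd a m"
    unfolding mon_dvd_iff
  proof
    fix k
    have "lookup a k \<le> lookup g k"
      by (subst g_eq(1)) (simp add: lookup_add)
    also have "\<dots> \<le> lookup (m + single j e) k"
      using g_gen(2) by (simp add: mon_dvd_iff)
    finally show "lookup a k \<le> lookup m k"
      using lookup_eq_0_outside[OF g_eq(2), of j]
      by (cases "k = j") (auto simp: lookup_add lookup_single)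
  qed
  moreover have "1 \<le> lookup g j"
  proof (rule ccontr)
    assume "\<not> 1 \<le> lookup g j"
    then have "a = g"
      using g_eq(1) by (simp add: not_le)
    moreover have "keys m \<subseteq> {..<n}"
      using vars[OF assms(2)] by (simp add: keys_add_mon)
    ultimately show False
      using mon_dvd_mem \<open>mon_dvd a m\<close> g_gen(1) assms(1) by (auto simp: min_gen_def)
  qed
  ultimately show ?thesis
    using that[of a "lookup g j"] g_eq g_gen by simp
qed

lemma almost_revlex_string_mem:
  assumes "almost_revlex n G" and g_gen: "min_gen G (a + single j s)" and a_vars: "keys a \<subseteq> {..<j}"
    and b_vars: "keys b \<subseteq> {..<j}" and "1 \<le> s" "j < n"
    and deg: "mdeg a < mdeg b" "mdeg a + s \<le> mdeg b + t"
  shows "b + single j t \<in> G"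
proof -
  have lookup_j: "lookup a j = 0" "lookup b j = 0"
    using lookup_eq_0_outside[OF a_vars] lookup_eq_0_outside[OF b_vars] by auto
  have mem: "m \<in> G" if "keys m \<subseteq> {..<Suc j}" "mdeg m = mdeg a + s" "lookup m j < s" for m
  proof -
    have "mon_gt m (a + single j s)"
      using that a_vars lookup_j(1)
      by (intro lookup_last_less_imp_mon_gt[of _ j]) (auto simp: lookup_add keys_add_mon)
    then show ?thesis
      using assms(1) g_gen that(1,2) \<open>j < n\<close> unfolding almost_revlex_def by fastforce
  qed
  have vars: "keys (b + single j t) \<subseteq> {..<n}"
    using b_vars \<open>j < n\<close> by (auto simp: keys_add_mon split: if_splits)
  show ?thesis
  proof (cases "mdeg a + s \<le> mdeg b")
    case True
    then obtain c where c_dvd: "mon_dvd c b" "mdeg c = mdeg a + s"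
      using ex_mon_dvd_mdeg by blast
    have c_vars: "keys c \<subseteq> {..<j}"
      using mon_dvd_keys[OF c_dvd(1)] b_vars by simp
    then have "c \<in> G"
      using c_dvd(2) \<open>1 \<le> s\<close> lookup_eq_0_outside[OF c_vars, of j] by (intro mem) auto
    then show ?thesis
      by (rule mon_dvd_mem[OF _ _ vars])
        (use c_dvd(1) in \<open>auto simp: mon_dvd_iff lookup_add intro: trans_le_add1\<close>)
  next
    case False
    define r where "r = mdeg a + s - mdeg b"
    have "b + single j r \<in> G"
      using b_vars False deg(1) lookup_j(2) by (intro mem) (auto simp: keys_add_mon lookup_add r_def)
    then show ?thesis
      by (rule mon_dvd_mem[OF _ _ vars])
        (use False deg(2) in \<open>auto simp: mon_dvd_iff lookup_add lookup_single when_def r_def\<close>)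
  qed
qed

lemma almost_revlex_imp_mono_lefschetz:
  assumes "almost_revlex n G" "j < n"
  shows "mono_lefschetz (Suc j) G j"
  unfolding mono_lefschetz_def
proof (intro allI, rule ccontr)
  fix d e
  assume "\<not> ((\<forall>m\<in>monomials (Suc j) d. m \<notin> G \<longrightarrow> m + single j e \<notin> G) \<or>
    (\<forall>m\<in>monomials (Suc j) (d + e). m \<notin> G \<longrightarrow> e \<le> lookup m j))"
  then obtain m m' where m_std: "m \<in> monomials (Suc j) d" "m \<notin> G" "m + single j e \<in> G"
    and m'_std: "m' \<in> monomials (Suc j) (d + e)" "m' \<notin> G" "lookup m' j < e"
    by (auto simp: not_le)
  obtain a s where a_gen: "min_gen G (a + single j s)" "keys a \<subseteq> {..<j}" "mon_dvd a m" "1 \<le> s"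
    "mon_dvd (a + single j s) (m + single j e)"
    using ex_min_gen_on_string[OF m_std(2,3)] m_std(1) unfolding monomials_def by blast
  obtain b where m'_eq: "m' = b + single j (lookup m' j)" "keys b \<subseteq> {..<j}"
    using split_last_var[of m' j] m'_std(1) by (auto simp: monomials_def)
  have "mdeg a \<le> d" "mdeg a + s \<le> d + e"
    using mon_dvd_mdeg[OF a_gen(3)] mon_dvd_mdeg[OF a_gen(5)] m_std(1) by (simp_all add: monomials_def)
  moreover have "mdeg b + lookup m' j = d + e"
    using arg_cong[OF m'_eq(1), of mdeg] m'_std(1) by (simp add: monomials_def)
  ultimately have "b + single j (lookup m' j) \<in> G"
    using m'_std(3)
    by (intro almost_revlex_string_mem[OF assms(1) a_gen(1,2) m'_eq(2) a_gen(4) assms(2)]) auto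
  then show False
    using m'_std(2) m'_eq(1) by simp
qed

lemma almost_revlex_imp_equal_degree_antimono:
  assumes "almost_revlex n G" "i < n"
  shows "equal_degree_antimono G i"
  unfolding equal_degree_antimono_def
proof (intro allI impI)
  fix a b t
  assume a_std: "keys a \<subseteq> {..<i}" "a \<notin> G" "a + single i t \<in> G" and b_vars: "keys b \<subseteq> {..<i}"
    and mdeg_eq: "mdeg a = mdeg b" and b_greater: "mon_gt b a"
  have "keys a \<subseteq> {..<Suc i}"
    using a_std(1) by auto
  then obtain c s where c_gen: "min_gen G (c + single i s)" "keys c \<subseteq> {..<i}" "mon_dvd c a" "1 \<le> s"
    "mon_dvd (c + single i s) (a + single i t)"
    using ex_min_gen_on_string[OF a_std(2,3)] by blast
  have "b + single i s \<in> G"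
  proof (cases "mdeg c = mdeg a")
    case True
    then have "c = a"
      using mon_dvd_mdeg_eq c_gen(3) by blast
    moreover have "keys (b + single i s) \<subseteq> {..<n}" "mdeg (b + single i s) = mdeg (a + single i s)"
      using b_vars assms(2) mdeg_eq by (auto simp: keys_add_mon split: if_splits)
    moreover have "mon_gt (b + single i s) (a + single i s)"
      using b_greater by simp
    ultimately show ?thesis
      using assms(1) c_gen(1) unfolding almost_revlex_def by blast
  next
    case False
    then show ?thesis
      using mon_dvd_mdeg[OF c_gen(3)] mdeg_eq
      by (intro almost_revlex_string_mem[OF assms(1) c_gen(1,2) b_vars c_gen(4) assms(2)]) auto
  qed
  moreover have "s \<le> t"
    using c_gen(5) lookup_eq_0_outside[OF a_std(1), of i] lookup_eq_0_outside[OF c_gen(2), of i]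
    by (auto simp: mon_dvd_iff lookup_add dest: spec[of _ i])
  then have "mon_dvd (b + single i s) (b + single i t)"
    by (simp add: mon_dvd_iff lookup_add lookup_single when_def)
  moreover have "keys (b + single i t) \<subseteq> {..<n}"
    using b_vars assms(2) by (auto simp: keys_add_mon split: if_splits)
  ultimately show "b + single i t \<in> G"
    by (rule mon_dvd_mem)
qed

lemma min_gen_lessE:
  assumes g_gen: "min_gen G g" and m_greater: "keys m \<subseteq> {..<n}" "mdeg m = mdeg g" "mon_gt m g"
  obtains j a b s r where "j < n" "g = a + single j s" "m = b + single j r" "keys a \<subseteq> {..<j}"
    "keys b \<subseteq> {..<j}" "a \<notin> G" "r \<le> s"
proof -
  have "g \<in> G"
    using g_gen by (simp add: min_gen_def)
  have "keys g \<noteq> {}"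
    using m_greater(2,3) mdeg_eq_0_iff mon_gt_irrefl by (metis keys_eq_empty)
  define j where "j = Max (keys g)"
  have j_last: "j \<in> keys g" "j < n" and g_vars: "keys g \<subseteq> {..<Suc j}"
    using Max_in[OF finite_keys \<open>keys g \<noteq> {}\<close>] Max_ge[OF finite_keys] vars[OF \<open>g \<in> G\<close>]
    by (auto simp: j_def less_Suc_eq_le)
  have m_vars: "keys m \<subseteq> {..<Suc j}"
    using mon_gt_of_extra_var[of g m "Suc j"] m_greater(2,3) g_vars mon_gt_trans mon_gt_irrefl by metis
  obtain a where g_eq: "g = a + single j (lookup g j)" "keys a \<subseteq> {..<j}"
    using split_last_var[OF g_vars] .
  obtain b where m_eq: "m = b + single j (lookup m j)" "keys b \<subseteq> {..<j}"
    using split_last_var[OF m_vars] .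
  have "mdeg g = mdeg a + lookup g j"
    using arg_cong[OF g_eq(1), of mdeg] by simp
  then have "mon_dvd a g" "a \<noteq> g"
    using g_eq(1) j_last(1) by (auto simp: mon_dvd_def in_keys_iff)
  then have "a \<notin> G"
    using g_gen by (auto simp: min_gen_def)
  moreover have "lookup m j \<le> lookup g j"
    using mon_gt_lookup_last_le[OF m_greater(3,2) g_vars] .
  ultimately show ?thesis
    using that j_last(2) g_eq m_eq by blast
qed

lemma almost_revlexI:
  assumes lefschetz: "\<And>j. j < n \<Longrightarrow> mono_lefschetz (Suc j) G j"
    and antimono: "\<And>i. i < n \<Longrightarrow> equal_degree_antimono G i"
  shows "almost_revlex n G"
  unfolding almost_revlex_def
proof (intro allI impI, elim conjE)
  fix g m assume g_gen: "min_gen G g" and m_greater: "keys m \<subseteq> {..<n}" "mdeg m = mdeg g" "mon_gt m g"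
  then obtain j a b s r where j_less: "j < n" and split: "g = a + single j s" "m = b + single j r"
    and vars: "keys a \<subseteq> {..<j}" "keys b \<subseteq> {..<j}" and "a \<notin> G" "r \<le> s"
    by (rule min_gen_lessE)
  have "a + single j s \<in> G"
    using g_gen split(1) by (simp add: min_gen_def)
  have deg: "mdeg b + r = mdeg a + s"
    using m_greater(2) by (simp add: split)
  consider (less) "r < s" | (mem) "b \<in> G" | (eq) "r = s" "b \<notin> G"
    using \<open>r \<le> s\<close> by linarith
  then show "m \<in> G"
  proof cases
    case less
    have "lookup m j = r"
      using lookup_eq_0_outside[OF vars(2), of j] by (simp add: split(2) lookup_add)
    moreover have "a \<in> monomials (Suc j) (mdeg a)" "m \<in> monomials (Suc j) (mdeg a + s)"
      using vars deg by (auto simp: split(2) monomials_def keys_add_mon)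
    ultimately show ?thesis
      using lefschetz[OF j_less] \<open>a \<notin> G\<close> \<open>a + single j s \<in> G\<close> less unfolding mono_lefschetz_def
      by (metis not_le)
  next
    case mem
    then show ?thesis
      using mult[of b "single j r"] j_less by (simp add: split(2))
  next
    case eq
    then have "mon_gt b a" "mdeg a = mdeg b"
      using m_greater(3) deg by (simp_all add: split)
    then show ?thesis
      using antimono[OF j_less] \<open>a \<notin> G\<close> \<open>a + single j s \<in> G\<close> vars eq
      unfolding equal_degree_antimono_def split(2) by blast
  qed
qed

lemma stable_power:
  assumes "1 < n"
  shows "m + single 1 c \<in> G \<Longrightarrow> m + single 0 c \<in> G"
proof (induction c arbitrary: m)
  case (Suc c)
  have split: "single k (Suc c) = single k c + single k 1" for k :: nat
    by (simp flip: single_add)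
  have "(m + single 1 c) + single 1 1 \<in> G"
    using Suc.prems by (simp add: split add_ac)
  then have "(m + single 1 c) + single 0 1 \<in> G"
    by (rule stable) (use assms in auto)
  then have "(m + single 0 1) + single 0 c \<in> G"
    by (intro Suc.IH) (simp add: add_ac)
  then show ?case
    by (simp add: split add_ac)
qed simp

lemma stable_two_vars:
  assumes "1 < n" "keys a \<subseteq> {..<2}" "keys b \<subseteq> {..<2}" "mdeg a = mdeg b"
    and "lookup b 1 \<le> lookup a 1" and "a + r \<in> G"
  shows "b + r \<in> G"
proof -
  have two_vars: "m = single 0 (lookup m 0) + single 1 (lookup m 1)" "mdeg m = lookup m 0 + lookup m 1"
    if m_vars: "keys m \<subseteq> {..<2}" for m
  proof -
    show "m = single 0 (lookup m 0) + single 1 (lookup m 1)"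
    proof (rule poly_mapping_eqI)
      show "lookup m k = lookup (single 0 (lookup m 0) + single 1 (lookup m 1)) k" for k
        using lookup_eq_0_outside[OF m_vars, of k]
        by (cases "k = 0 \<or> k = 1") (auto simp: lookup_add lookup_single when_def)
    qed
    then show "mdeg m = lookup m 0 + lookup m 1"
      using mdeg_add mdeg_single by metis
  qed
  define c where "c = lookup a 1 - lookup b 1"
  have lookup_eq: "lookup a 1 = lookup b 1 + c" "lookup b 0 = lookup a 0 + c"
    using assms(4,5) two_vars(2)[OF assms(2)] two_vars(2)[OF assms(3)] by (auto simp: c_def)
  let ?m = "single 0 (lookup a 0) + single 1 (lookup b 1) + r"
  have "a + r = ?m + single 1 c"
    by (subst two_vars(1)[OF assms(2)]) (simp only: lookup_eq(1) single_add add_ac)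
  moreover have "b + r = ?m + single 0 c"
    by (subst two_vars(1)[OF assms(3)]) (simp only: lookup_eq(2) single_add add_ac)
  ultimately show ?thesis
    using stable_power[OF assms(1)] assms(6) by simp
qed

lemma mono_lefschetz_two_vars:
  assumes "j < 2" "j < n"
  shows "mono_lefschetz (Suc j) G j"
proof (cases "j = 0")
  case True
  have "lookup m 0 = d" if "m \<in> monomials (Suc 0) d" for m d
    using that mdeg_superset[of "{..<Suc 0}" m] by (simp add: monomials_def)
  then show ?thesis
    using True by (simp add: mono_lefschetz_def)
next
  case False
  have "m' \<in> G" if "m \<in> monomials 2 d" "m + single 1 e \<in> G" "m' \<in> monomials 2 (d + e)" "lookup m' 1 < e"
    for m m' d e
    using stable_two_vars[of "m + single 1 e" m' 0] that assms False
    by (auto simp: monomials_def keys_add_mon lookup_add split: if_splits)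
  then have "mono_lefschetz 2 G 1"
    unfolding mono_lefschetz_def by (meson not_le)
  moreover have "j = 1"
    using assms(1) False by simp
  ultimately show ?thesis
    by (simp add: numeral_2_eq_2)
qed

lemma equal_degree_antimono_two_vars:
  assumes "i \<le> 2" "i < n"
  shows "equal_degree_antimono G i"
  unfolding equal_degree_antimono_def
proof (intro allI impI)
  fix a b t
  assume hyps_ab: "keys a \<subseteq> {..<i}" "keys b \<subseteq> {..<i}" "mdeg a = mdeg b" "mon_gt b a"
    "a + single i t \<in> G"
  then have two: "keys a \<subseteq> {..<2}" "keys b \<subseteq> {..<2}"
    using assms(1) by auto
  have "i \<noteq> 0"
    using hyps_ab by (intro notI) simp
  then have "1 < n"
    using assms(2) by simp
  moreover have "lookup b 1 \<le> lookup a 1"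
    using mon_gt_lookup_last_le[OF hyps_ab(4)] hyps_ab(3) two(1) by (simp add: numeral_2_eq_2)
  ultimately show "b + single i t \<in> G"
    using stable_two_vars[of a b] two hyps_ab(3,5) by simp
qed

theorem almost_revlex_iff:
  "almost_revlex n G \<longleftrightarrow>
    (\<forall>j. 2 \<le> j \<and> j < n \<longrightarrow> mono_lefschetz (Suc j) G j) \<and> (\<forall>i. 3 \<le> i \<and> i < n \<longrightarrow> fval_antimono G i)"
proof
  assume "almost_revlex n G"
  then show "(\<forall>j. 2 \<le> j \<and> j < n \<longrightarrow> mono_lefschetz (Suc j) G j) \<and> (\<forall>i. 3 \<le> i \<and> i < n \<longrightarrow> fval_antimono G i)"
    by (simp add: almost_revlex_imp_mono_lefschetz almost_revlex_imp_equal_degree_antimono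
        fval_antimono_iff)
next
  assume conditions: "(\<forall>j. 2 \<le> j \<and> j < n \<longrightarrow> mono_lefschetz (Suc j) G j) \<and>
      (\<forall>i. 3 \<le> i \<and> i < n \<longrightarrow> fval_antimono G i)"
  show "almost_revlex n G"
  proof (rule almost_revlexI)
    show "mono_lefschetz (Suc j) G j" if "j < n" for j
      using conditions that mono_lefschetz_two_vars by (cases "j < 2") auto
    show "equal_degree_antimono G i" if "i < n" for i
      using conditions that equal_degree_antimono_two_vars fval_antimono_iff[of i]
      by (cases "i \<le> 2") auto
  qed
qed

end

lemma (in artinian_ideal) strongly_stable_gin: "strongly_stable n (gin n I)"
proof -
  obtain v where "maximal_coords v"
    by (rule ex_maximal_coords)
  then show ?thesis
    using gin_replace_variable init_mons_vars init_mons_add gin_eq_init_mons by unfold_locales simp_all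
qed

theorem theorem2p7:
  fixes I :: "'k::field_char_0 mpoly set" and n :: nat
  assumes "is_ideal n I" and "homogeneous_ideal I" and "artinian n I"
  shows "almost_revlex n (gin n I) \<longleftrightarrow>
    ((\<forall>i. i + 3 \<le> n \<longrightarrow> generic (n * i) (\<lambda>v. slp n (ideal_plus n I (lin n v) i))) \<and>
     (\<forall>i. 3 \<le> i \<and> i \<le> n - 1 \<longrightarrow>
        (\<forall>\<alpha>\<in>Jset (gin n I) i. \<forall>\<beta>\<in>Jset (gin n I) i.
           sum_list \<alpha> = sum_list \<beta> \<and> mon_gt (Poly_Mapping.nth \<beta>) (Poly_Mapping.nth \<alpha>)
           \<longrightarrow> fval (gin n I) \<beta> \<le> fval (gin n I) \<alpha>)))"
proof -
  interpret artinian_ideal n I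
    by unfold_locales (fact assms)+
  interpret strongly_stable n "gin n I"
    by (rule strongly_stable_gin)
  have "almost_revlex n (gin n I) \<longleftrightarrow>
      (\<forall>i. i + 3 \<le> n \<longrightarrow> generic (n * i) (\<lambda>v. slp n (ideal_plus n I (lin n v) i))) \<and>
      (\<forall>i. 3 \<le> i \<and> i < n \<longrightarrow> fval_antimono (gin n I) i)"
    unfolding almost_revlex_iff generic_slp_iff_mono_lefschetz ..
  moreover have "3 \<le> i \<and> i < n \<longleftrightarrow> 3 \<le> i \<and> i \<le> n - 1" for i
    by auto
  ultimately show ?thesis
    by (simp only: fval_antimono_def)
qed

end
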